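(* Let $1<q\le2$ and $0<p<2$, and let $q'$ be defined by $\frac1q+\frac1{q'}=1$. Then $M_p(B_q^n,d_2)$ behaves asymptotically as $n^{p/q'}$; that is, there exist constants $A,B>0$ (depending on $p$ and $q$ but not on $n$) such that for every $n\in\mathbb N$ $$A\,n^{p/q'}\le M_p(B_q^n,d_2)\le B\,n^{p/q'}.$$
   Context: $B_q^n=\{x\in\mathbb R^n:\sum_i|x_i|^q\le1\}$ is the closed unit ball of $\ell_q^n$, and $d_2(x,y)=\|x-y\|_2$ is the Euclidean distance. For a compact set $K\subset\mathbb R^n$, $\mathfrak M^1(K)$ is the set of finite signed Borel measures $\mu$ on $K$ with $\mu(K)=1$, and $M_p(K,d_2)=\sup\{\int_K\int_K\|x-y\|_2^p\,d\mu(x)d\mu(y):\mu\in\mathfrak M^1(K)\}$. *)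

theory Defs
  imports "HOL-Analysis.Analysis"
begin

text \<open>
  The dimension n has to range over all natural numbers inside one statement, so \<open>\<real>\<^sup>n\<close> is
  the carrier of \<^term>\<open>Euclidean_space n\<close>: sequences \<open>nat \<Rightarrow> real\<close> vanishing from index n on, with
  the topology induced by the product topology.
\<close>

definition lq_ball :: "nat \<Rightarrow> real \<Rightarrow> (nat \<Rightarrow> real) set" where
  "lq_ball n q = {x \<in> topspace (Euclidean_space n). (\<Sum>i<n. \<bar>x i\<bar> powr q) \<le> 1}"

definition dist2 :: "nat \<Rightarrow> (nat \<Rightarrow> real) \<Rightarrow> (nat \<Rightarrow> real) \<Rightarrow> real" where
  "dist2 n x y = L2_set (\<lambda>i. x i - y i) {..<n}"

text \<open>
  Finite signed measures are real-valued countably additive set functions; only the values on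
  \<^term>\<open>sets M\<close> matter.
\<close>

definition finite_signed_measure :: "'a measure \<Rightarrow> ('a set \<Rightarrow> real) \<Rightarrow> bool" where
  "finite_signed_measure M \<mu> \<longleftrightarrow>
     \<mu> {} = 0 \<and>
     (\<forall>A :: nat \<Rightarrow> 'a set. range A \<subseteq> sets M \<longrightarrow> disjoint_family A \<longrightarrow>
        (\<lambda>i. \<mu> (A i)) sums \<mu> (\<Union>i. A i))"

text \<open>
  The upper variation, i.e. the positive part of the Jordan decomposition. Since \<^const>\<open>ennreal\<close>
  sends negative reals to 0 and \<open>\<mu> {} = 0\<close>, the supremum is that of \<open>\<mu> B\<close> over measurable
  \<open>B \<subseteq> A\<close>. The negative part is the upper variation of \<open>-\<mu>\<close>.
\<close>

definition upper_variation :: "'a measure \<Rightarrow> ('a set \<Rightarrow> real) \<Rightarrow> 'a measure" where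
  "upper_variation M \<mu> =
     measure_of (space M) (sets M) (\<lambda>A. SUP B\<in>{B \<in> sets M. B \<subseteq> A}. ennreal (\<mu> B))"

definition signed_integral ::
    "'a measure \<Rightarrow> ('a set \<Rightarrow> real) \<Rightarrow> ('a \<Rightarrow> real) \<Rightarrow> real" where
  "signed_integral M \<mu> f =
     integral\<^sup>L (upper_variation M \<mu>) f - integral\<^sup>L (upper_variation M (\<lambda>B. - \<mu> B)) f"

text \<open>
  For \<open>K \<subseteq> \<real>\<^sup>n\<close>, \<^term>\<open>restrict_space borel K\<close> carries the Borel sigma-algebra of the subspace K;
  the measure component of \<^const>\<open>borel\<close> plays no role.
\<close>

definition signed_measures_mass1 :: "(nat \<Rightarrow> real) set \<Rightarrow> ((nat \<Rightarrow> real) set \<Rightarrow> real) set" where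
  "signed_measures_mass1 K = {\<mu>. finite_signed_measure (restrict_space borel K) \<mu> \<and> \<mu> K = 1}"

definition energy ::
    "nat \<Rightarrow> real \<Rightarrow> (nat \<Rightarrow> real) set \<Rightarrow> ((nat \<Rightarrow> real) set \<Rightarrow> real) \<Rightarrow> real" where
  "energy n p K \<mu> =
     signed_integral (restrict_space borel K) \<mu>
       (\<lambda>y. signed_integral (restrict_space borel K) \<mu> (\<lambda>x. dist2 n x y powr p))"

text \<open>The supremum is taken in \<^typ>\<open>ereal\<close>, as its finiteness is part of the upper bound.\<close>

definition M_const :: "nat \<Rightarrow> real \<Rightarrow> (nat \<Rightarrow> real) set \<Rightarrow> ereal" where
  "M_const n p K = (SUP \<mu>\<in>signed_measures_mass1 K. ereal (energy n p K \<mu>))"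

end

(*
  Upper bound. For a standard Gaussian vector g the p-th moment of <g, x - y> is a multiple of
  |x - y|^p. For fixed g the numbers <g, x>, x in the l_q ball, lie in an interval of length
  2 W(g) with W(g) of the order of the l_q'-norm of g, and an interval of length T with the
  metric |x - y|^(p/2) embeds isometrically into a sphere of squared radius proportional to T^p
  in L^2. Integrating over g, the l_q ball with the distance |x - y|^(p/2) embeds (up to scale) into
  a sphere of squared radius R of the order of E W^p, hence of n^(p/q'), and then the energy of a
  measure of mass 1 is at most 2 R.

  Lower bound. A signed combination of the laws of sqrt(v_k) g, with v_k proportional to k <= n,
  has energy proportional to the sum of a_k a_l (v_k + v_l)^(p/2) times E |g|^p. Writing
  u^(p/2) as an integral of 1 - exp(-s u), the sum becomes an integral of 1 - P(exp(-s))^2, where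
  P is the polynomial with coefficients a_k. A shifted Chebyshev polynomial of degree n drops
  from P(1) = 1 already at distance of order n^(-2), which gives the sum the order n^p. Its
  coefficients grow only exponentially in n, whereas the Gaussians put mass exp(-C n) outside the
  ball, with C as large as desired after shrinking the v_k by a constant; so sending the mass
  outside the ball to 0 does not destroy the bound.
*)

theory Submission
  imports Defs "HOL-Probability.Probability"
begin

subsection \<open>Signed measures\<close>

text \<open>Signed cancellation is what the lower bound rests on. Gaussians that stay in the ball
  have Euclidean norm of order n^(1/2 - 1/q), and a probability measure at that scale has energy of
  order at most n^(p/2 - p/q). The missing factor n^(p/2) comes from the alternating coefficients
  alone, whose total size is bounded only by 7^n. Moving the mass outside the ball must therefore
  cost less than any fixed exponential; shrinking all variances by a constant \<kappa> achieves this
  and costs only \<kappa>^(p/2) in the main term.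

  The signed integral is defined through two upper variations, which are not computable for a
  combination of overlapping Gaussian laws. Only two facts about them are used: they are finite
  measures, and their difference is \<mu>. Identities between integrals are accordingly proved with
  all negative terms moved to the other side, where everything is a nonnegative combination of
  measures.

  Rotation invariance of the Gaussian enters only through the law of a single linear functional;
  distances are reached by integrating over an additional Gaussian direction.\<close>

lemma finite_signed_measure_empty: "finite_signed_measure M \<mu> \<Longrightarrow> \<mu> {} = 0"
  unfolding finite_signed_measure_def by (rule conjunct1)

lemma finite_signed_measure_sums:
  assumes "finite_signed_measure M \<mu>" "range A \<subseteq> sets M" "disjoint_family A"
  shows "(\<lambda>i. \<mu> (A i)) sums \<mu> (\<Union>i. A i)"
  using assms unfolding finite_signed_measure_def by blast

lemma finite_signed_measure_uminus:
  assumes "finite_signed_measure M \<mu>"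
  shows "finite_signed_measure M (\<lambda>B. - \<mu> B)"
  unfolding finite_signed_measure_def
proof (intro conjI allI impI)
  show "- \<mu> {} = 0"
    using finite_signed_measure_empty[OF assms] by simp
  show "(\<lambda>i. - \<mu> (A i)) sums - \<mu> (\<Union>i. A i)"
    if "range A \<subseteq> sets M" "disjoint_family A" for A :: "nat \<Rightarrow> 'a set"
    by (rule sums_minus) (rule finite_signed_measure_sums[OF assms that])
qed

lemma finite_signed_measure_Un:
  assumes "finite_signed_measure M \<mu>" "A \<in> sets M" "B \<in> sets M" "A \<inter> B = {}"
  shows "\<mu> (A \<union> B) = \<mu> A + \<mu> B"
proof -
  have "(\<lambda>i. \<mu> (binaryset A B i)) sums \<mu> (\<Union>i. binaryset A B i)"
    using assms(2-4)
    by (intro finite_signed_measure_sums[OF assms(1)])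
      (auto simp: disjoint_family_on_def binaryset_def)
  moreover have "(\<lambda>i. \<mu> (binaryset A B i)) sums (\<mu> A + \<mu> B)"
    by (intro binaryset_sums finite_signed_measure_empty[OF assms(1)])
  ultimately show ?thesis
    unfolding UN_binaryset_eq by (rule sums_unique2)
qed

lemma finite_signed_measure_Diff:
  assumes "finite_signed_measure M \<mu>" "A \<in> sets M" "B \<in> sets M" "B \<subseteq> A"
  shows "\<mu> (A - B) = \<mu> A - \<mu> B"
proof -
  have "\<mu> ((A - B) \<union> B) = \<mu> (A - B) + \<mu> B"
    using assms by (intro finite_signed_measure_Un[OF assms(1)]) auto
  moreover have "(A - B) \<union> B = A"
    using assms(4) by auto
  ultimately show ?thesis
    by simp
qed

text \<open>Unbounded values would produce a decreasing sequence of sets that sheds disjoint pieces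
  whose measures stay away from 0, contradicting the convergence of the series over these pieces.
  This is the source of the finiteness of the upper variation.\<close>

lemma finite_signed_measure_bounded_above:
  assumes \<mu>: "finite_signed_measure M \<mu>"
  obtains C where "\<And>B. B \<in> sets M \<Longrightarrow> \<mu> B \<le> C"
proof (rule ccontr)
  assume not: "\<not> thesis"
  define bad where "bad A \<longleftrightarrow> A \<in> sets M \<and> (\<forall>C. \<exists>B\<in>sets M. B \<subseteq> A \<and> C < \<mu> B)" for A
  \<comment> \<open>A set with unbounded subsets splits off a piece of measure at least 1 in absolute value,
    and the rest still has unbounded subsets.\<close>
  have step: "\<exists>A'. bad A' \<and> A' \<subseteq> A \<and> 1 \<le> \<bar>\<mu> (A - A')\<bar>" if A: "bad A" for A
  proof -
    \<comment> \<open>The threshold makes both pieces large: \<open>\<mu> B > 1\<close> and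
      \<open>\<mu> (A - B) = \<mu> A - \<mu> B < - 1\<close>. So it does not matter which of
      \<open>B\<close> and \<open>A - B\<close> has to be kept.\<close>
    obtain B where B: "B \<in> sets M" "B \<subseteq> A" "\<bar>\<mu> A\<bar> + 1 < \<mu> B"
      using A unfolding bad_def by blast
    have As: "A \<in> sets M"
      using A by (simp add: bad_def)
    show ?thesis
    proof (cases "bad B")
      case True
      then show ?thesis
        using B finite_signed_measure_Diff[OF \<mu> As B(1,2)] by (intro exI[of _ B]) auto
    next
      case False
      then have "\<exists>D. \<forall>E\<in>sets M. E \<subseteq> B \<longrightarrow> \<not> D < \<mu> E"
        using B(1) by (simp add: bad_def)
      then obtain D where D: "\<And>E. E \<in> sets M \<Longrightarrow> E \<subseteq> B \<Longrightarrow> \<mu> E \<le> D"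
        by (auto simp: not_less)
      have "\<exists>E\<in>sets M. E \<subseteq> A - B \<and> C < \<mu> E" for C
      proof -
        obtain E where E: "E \<in> sets M" "E \<subseteq> A" "C + D < \<mu> E"
          using A unfolding bad_def by blast
        have "\<mu> (E - (E \<inter> B)) = \<mu> E - \<mu> (E \<inter> B)"
          using E B by (intro finite_signed_measure_Diff[OF \<mu>]) auto
        moreover have "\<mu> (E \<inter> B) \<le> D"
          using E B by (intro D) auto
        ultimately show ?thesis
          using E B by (intro bexI[of _ "E - (E \<inter> B)"]) auto
      qed
      then have "bad (A - B)"
        using As B by (auto simp: bad_def)
      moreover have "A - (A - B) = B"
        using B by auto
      ultimately show ?thesis
        using B by (intro exI[of _ "A - B"]) auto
    qed
  qed
  have unb: "\<exists>B\<in>sets M. C < \<mu> B" for C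
    using not that[of C] by (auto simp: not_le[symmetric])
  have "bad (space M)"
    unfolding bad_def
  proof (intro conjI allI)
    fix C
    obtain B where "B \<in> sets M" "C < \<mu> B"
      using unb[of C] by blast
    with sets.sets_into_space[OF this(1)] show "\<exists>B\<in>sets M. B \<subseteq> space M \<and> C < \<mu> B"
      by blast
  qed simp
  then have "\<exists>A. \<forall>n. bad (A n) \<and> A (Suc n) \<subseteq> A n \<and> 1 \<le> \<bar>\<mu> (A n - A (Suc n))\<bar>"
    by (intro dependent_nat_choice) (use step in blast)+
  then obtain A
    where A: "\<And>n. bad (A n)" "\<And>n. A (Suc n) \<subseteq> A n \<and> 1 \<le> \<bar>\<mu> (A n - A (Suc n))\<bar>"
    by blast
  define D where "D n = A n - A (Suc n)" for n
  have "decseq A"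
    using A(2) by (intro decseq_SucI) auto
  then have "disjoint_family D"
  proof -
    have "D m \<inter> D n = {}" if "m < n" for m n
      using decseqD[OF \<open>decseq A\<close>, of "Suc m" n] that by (auto simp: D_def)
    then show ?thesis
      unfolding disjoint_family_on_def by (auto simp: neq_iff Int_commute)
  qed
  moreover have "range D \<subseteq> sets M"
    using A(1) by (auto simp: D_def bad_def)
  ultimately have "(\<lambda>i. \<mu> (D i)) sums \<mu> (\<Union>i. D i)"
    by (intro finite_signed_measure_sums[OF \<mu>])
  then have "(\<lambda>i. \<mu> (D i)) \<longlonglongrightarrow> 0"
    by (intro summable_LIMSEQ_zero) (rule sums_summable)
  then have "eventually (\<lambda>i. \<bar>\<mu> (D i)\<bar> < 1) sequentially"
    by (auto dest!: tendstoD[where e = 1])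
  then obtain i where "\<bar>\<mu> (D i)\<bar> < 1"
    unfolding eventually_sequentially by blast
  then show False
    using A(2)[of i] by (simp add: D_def)
qed

lemma space_upper_variation [simp]: "space (upper_variation M \<mu>) = space M"
  and sets_upper_variation [simp, measurable_cong]: "sets (upper_variation M \<mu>) = sets M"
  by (simp_all add: upper_variation_def)

text \<open>\<open>measure_of\<close> returns the given set function only if that function is
  countably additive. Superadditivity holds because subsets of disjoint sets can be united; the
  converse inequality splits a subset of the union along the pieces and uses countable additivity of
  \<mu>. No Hahn decomposition is involved.\<close>

lemma emeasure_upper_variation:
  assumes \<mu>: "finite_signed_measure M \<mu>" and A: "A \<in> sets M"
  shows "emeasure (upper_variation M \<mu>) A = (SUP B\<in>{B \<in> sets M. B \<subseteq> A}. ennreal (\<mu> B))"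
proof -
  define v where "v A = (SUP B\<in>{B \<in> sets M. B \<subseteq> A}. ennreal (\<mu> B))" for A
  have v_upper: "ennreal (\<mu> B) \<le> v A" if "B \<in> sets M" "B \<subseteq> A" for A B
    unfolding v_def using that by (intro SUP_upper) auto
  have mono: "v A \<le> v B" if "A \<subseteq> B" for A B
    unfolding v_def using that by (intro SUP_subset_mono) auto
  have zero: "v {} = 0"
  proof -
    have "{B \<in> sets M. B \<subseteq> {}} = {{}}"
      by auto
    then show ?thesis
      using finite_signed_measure_empty[OF \<mu>] by (simp add: v_def)
  qed
  have super: "v A + v B \<le> v (A \<union> B)" if AB: "A \<inter> B = {}" for A B
  proof -
    have ne: "{C \<in> sets M. C \<subseteq> D} \<noteq> {}" for D
      by auto
    have "ennreal (\<mu> E) + ennreal (\<mu> F) \<le> v (A \<union> B)"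
      if E: "E \<in> sets M" "E \<subseteq> A" and F: "F \<in> sets M" "F \<subseteq> B" for E F
    \<comment> \<open>\<open>ennreal\<close> cuts negative values to 0 and is additive only on
      nonnegative ones. If one value is negative, its summand vanishes and the other set alone
      competes in the supremum for the union.\<close>
    proof (cases "0 \<le> \<mu> E \<and> 0 \<le> \<mu> F")
      case True
      have "E \<inter> F = {}"
        using E F AB by auto
      then have "ennreal (\<mu> E) + ennreal (\<mu> F) = ennreal (\<mu> (E \<union> F))"
        using finite_signed_measure_Un[OF \<mu> E(1) F(1)] True by (simp add: ennreal_plus)
      also have "\<dots> \<le> v (A \<union> B)"
        using E F by (intro v_upper) auto
      finally show ?thesis .
    next
      case False
      then have "ennreal (\<mu> E) = 0 \<or> ennreal (\<mu> F) = 0"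
        by (auto simp: ennreal_eq_0_iff)
      moreover have "ennreal (\<mu> E) \<le> v (A \<union> B)" "ennreal (\<mu> F) \<le> v (A \<union> B)"
        using E F by (auto intro!: v_upper)
      ultimately show ?thesis
        by auto
    qed
    then have "(SUP E\<in>{C \<in> sets M. C \<subseteq> A}. SUP F\<in>{C \<in> sets M. C \<subseteq> B}. ennreal (\<mu> E) + ennreal (\<mu> F))
        \<le> v (A \<union> B)"
      by (auto intro!: SUP_least)
    then show ?thesis
      unfolding v_def[of A] v_def[of B]
      by (simp only: ennreal_SUP_add_left[OF ne, symmetric] ennreal_SUP_add_right[OF ne, symmetric])
  qed
  have "countably_additive (sets M) v"
  proof (rule countably_additiveI)
    fix A :: "nat \<Rightarrow> 'a set"
    assume A: "range A \<subseteq> sets M" "disjoint_family A" "(\<Union>i. A i) \<in> sets M"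
    show "(\<Sum>i. v (A i)) = v (\<Union>i. A i)"
    proof (rule antisym)
      have fin: "(\<Sum>i<n. v (A i)) \<le> v (\<Union>i<n. A i)" for n
      proof (induction n)
        case (Suc n)
        have "A i \<inter> A n = {}" if "i < n" for i
          using that by (intro disjoint_family_onD[OF A(2)]) auto
        then have "(\<Union>i<n. A i) \<inter> A n = {}"
          by auto
        have "(\<Sum>i<Suc n. v (A i)) \<le> v (\<Union>i<n. A i) + v (A n)"
          using add_right_mono[OF Suc, of "v (A n)"] by simp
        also have "\<dots> \<le> v ((\<Union>i<n. A i) \<union> A n)"
          by (rule super) (rule \<open>(\<Union>i<n. A i) \<inter> A n = {}\<close>)
        also have "(\<Union>i<n. A i) \<union> A n = (\<Union>i<Suc n. A i)"
          by (auto simp: less_Suc_eq)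
        finally show ?case .
      qed (simp add: zero)
      show "(\<Sum>i. v (A i)) \<le> v (\<Union>i. A i)"
        by (rule suminf_le_const[OF summableI]) (rule order_trans[OF fin mono], blast)
    next
      have "ennreal (\<mu> B) \<le> (\<Sum>i. v (A i))" if B: "B \<in> sets M" "B \<subseteq> (\<Union>i. A i)" for B
      proof -
        have "(\<lambda>i. \<mu> (B \<inter> A i)) sums \<mu> (\<Union>i. B \<inter> A i)"
          using A B by (intro finite_signed_measure_sums[OF \<mu>]) (auto simp: disjoint_family_on_def)
        moreover have "(\<Union>i. B \<inter> A i) = B"
          using B by auto
        ultimately have "(\<lambda>n. \<Sum>i<n. \<mu> (B \<inter> A i)) \<longlonglongrightarrow> \<mu> B"
          by (simp add: sums_def)
        then have "(\<lambda>n. ennreal (\<Sum>i<n. \<mu> (B \<inter> A i))) \<longlonglongrightarrow> ennreal (\<mu> B)"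
          by (intro tendsto_ennrealI)
        moreover have "ennreal (\<Sum>i<n. \<mu> (B \<inter> A i)) \<le> (\<Sum>i. v (A i))" for n
        proof -
          have "ennreal (\<Sum>i<n. \<mu> (B \<inter> A i)) \<le> ennreal (\<Sum>i<n. max 0 (\<mu> (B \<inter> A i)))"
            by (intro ennreal_leI sum_mono) auto
          also have "\<dots> = (\<Sum>i<n. ennreal (max 0 (\<mu> (B \<inter> A i))))"
            by (rule sum_ennreal[symmetric]) auto
          also have "\<dots> \<le> (\<Sum>i<n. v (A i))"
            using A B by (intro sum_mono) (auto simp: max_def intro!: v_upper)
          also have "\<dots> \<le> (\<Sum>i. v (A i))"
            by (intro sum_le_suminf summableI) auto
          finally show ?thesis .
        qed
        ultimately show ?thesis
          by (intro LIMSEQ_le_const2) auto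
      qed
      then show "v (\<Union>i. A i) \<le> (\<Sum>i. v (A i))"
        unfolding v_def[of "\<Union>i. A i"] by (intro SUP_least) auto
    qed
  qed
  moreover have "positive (sets M) v"
    by (simp add: positive_def zero)
  ultimately have "emeasure (measure_of (space M) (sets M) v) A = v A"
    using A by (intro emeasure_measure_of_sigma sets.sigma_algebra_axioms)
  then show ?thesis
    by (simp add: upper_variation_def v_def[abs_def])
qed

lemma finite_measure_upper_variation:
  assumes "finite_signed_measure M \<mu>"
  shows "finite_measure (upper_variation M \<mu>)"
proof
  obtain C where C: "\<And>B. B \<in> sets M \<Longrightarrow> \<mu> B \<le> C"
    using finite_signed_measure_bounded_above[OF assms] by blast
  have "emeasure (upper_variation M \<mu>) (space M) \<le> ennreal C"
    unfolding emeasure_upper_variation[OF assms sets.top]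
    using C by (intro SUP_least ennreal_leI) auto
  then show "emeasure (upper_variation M \<mu>) (space (upper_variation M \<mu>)) \<noteq> \<infinity>"
    by (auto simp: top_unique)
qed

text \<open>For \<open>B \<subseteq> A\<close> one has
  \<open>\<mu> B = \<mu> A - \<mu> (A - B)\<close>, and \<open>- \<mu> (A - B)\<close> is at most
  the negative variation of \<open>A\<close>. Applied to \<mu> and to its negative, this gives the
  Jordan decomposition as an equality.\<close>

lemma upper_variation_le:
  assumes \<mu>: "finite_signed_measure M \<mu>" and A: "A \<in> sets M"
  shows "measure (upper_variation M \<mu>) A \<le> \<mu> A + measure (upper_variation M (\<lambda>B. - \<mu> B)) A"
proof -
  let ?P = "upper_variation M \<mu>" and ?N = "upper_variation M (\<lambda>B. - \<mu> B)"
  interpret P: finite_measure ?P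
    by (rule finite_measure_upper_variation[OF \<mu>])
  have \<mu>': "finite_signed_measure M (\<lambda>B. - \<mu> B)"
    by (rule finite_signed_measure_uminus[OF \<mu>])
  interpret N: finite_measure ?N
    by (rule finite_measure_upper_variation[OF \<mu>'])
  have N: "- \<mu> B \<le> measure ?N A" if "B \<in> sets M" "B \<subseteq> A" for B
  proof -
    have "ennreal (- \<mu> B) \<le> emeasure ?N A"
      unfolding emeasure_upper_variation[OF \<mu>' A] using that by (intro SUP_upper) auto
    then show ?thesis
      by (simp add: N.emeasure_eq_measure)
  qed
  have "emeasure ?P A \<le> ennreal (\<mu> A + measure ?N A)"
    unfolding emeasure_upper_variation[OF \<mu> A]
  proof (intro SUP_least ennreal_leI)
    fix B assume B: "B \<in> {B \<in> sets M. B \<subseteq> A}"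
    then show "\<mu> B \<le> \<mu> A + measure ?N A"
      using N[of "A - B"] finite_signed_measure_Diff[OF \<mu> A, of B] A by auto
  qed
  moreover have "0 \<le> \<mu> A + measure ?N A"
    using N[OF A] by simp
  ultimately show ?thesis
    by (simp add: P.emeasure_eq_measure)
qed

lemma upper_variation_diff:
  assumes \<mu>: "finite_signed_measure M \<mu>" and A: "A \<in> sets M"
  shows "measure (upper_variation M \<mu>) A - measure (upper_variation M (\<lambda>B. - \<mu> B)) A = \<mu> A"
  using upper_variation_le[OF \<mu> A] upper_variation_le[OF finite_signed_measure_uminus[OF \<mu>] A]
  by simp

text \<open>The identity passes from sets to functions by the standard induction on measurable
  functions, which preserves it because it contains no subtraction. The combinations are never
  formed as measures, and the two sides may have unrelated index types.\<close>

lemma nn_integral_sum_measures_cong: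
  fixes P :: "'i \<Rightarrow> 'a measure" and Q :: "'j \<Rightarrow> 'a measure"
  assumes fin: "finite I" "finite J"
    and sets: "\<And>i. i \<in> I \<Longrightarrow> sets (P i) = sets M" "\<And>j. j \<in> J \<Longrightarrow> sets (Q j) = sets M"
    and eq: "\<And>A. A \<in> sets M \<Longrightarrow>
      (\<Sum>i\<in>I. c i * emeasure (P i) A) = (\<Sum>j\<in>J. d j * emeasure (Q j) A)"
    and f: "f \<in> borel_measurable M"
  shows "(\<Sum>i\<in>I. c i * (\<integral>\<^sup>+x. f x \<partial>P i)) = (\<Sum>j\<in>J. d j * (\<integral>\<^sup>+x. f x \<partial>Q j))"
  using f
proof (induction rule: borel_measurable_induct)
  case (cong f g)
  have "(\<integral>\<^sup>+x. f x \<partial>P i) = (\<integral>\<^sup>+x. g x \<partial>P i)" if "i \<in> I" for i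
    using cong(3) sets_eq_imp_space_eq[OF sets(1)[OF that]] by (intro nn_integral_cong) auto
  moreover have "(\<integral>\<^sup>+x. f x \<partial>Q j) = (\<integral>\<^sup>+x. g x \<partial>Q j)" if "j \<in> J" for j
    using cong(3) sets_eq_imp_space_eq[OF sets(2)[OF that]] by (intro nn_integral_cong) auto
  ultimately show ?case
    using cong(4) by simp
next
  case (set A)
  then show ?case
    using eq[OF set] sets by simp
next
  case (mult u c)
  have "u \<in> borel_measurable (P i)" if "i \<in> I" for i
    using mult(2) by (subst measurable_cong_sets[OF sets(1)[OF that] refl])
  moreover have "u \<in> borel_measurable (Q j)" if "j \<in> J" for j
    using mult(2) by (subst measurable_cong_sets[OF sets(2)[OF that] refl])
  ultimately show ?case
    using mult(4) by (simp add: nn_integral_cmult mult.left_commute[of _ c] flip: sum_distrib_left)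
next
  case (add u v)
  have "u \<in> borel_measurable (P i)" "v \<in> borel_measurable (P i)" if "i \<in> I" for i
    unfolding measurable_cong_sets[OF sets(1)[OF that] refl] by (rule add)+
  moreover have "u \<in> borel_measurable (Q j)" "v \<in> borel_measurable (Q j)" if "j \<in> J" for j
    unfolding measurable_cong_sets[OF sets(2)[OF that] refl] by (rule add)+
  ultimately show ?case
    using add(6,7) by (simp add: nn_integral_add distrib_left sum.distrib)
next
  case (seq U)
  have *: "(\<Sum>i\<in>K. e i * (\<integral>\<^sup>+x. (SUP n. U n) x \<partial>R i)) = (SUP n. \<Sum>i\<in>K. e i * (\<integral>\<^sup>+x. U n x \<partial>R i))"
    if R: "\<And>i. i \<in> K \<Longrightarrow> sets (R i) = sets M" for K :: "'k set" and e R
  proof -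
    have "e i * (\<integral>\<^sup>+x. (SUP n. U n) x \<partial>R i) = (SUP n. e i * (\<integral>\<^sup>+x. U n x \<partial>R i))" if "i \<in> K" for i
    proof -
      have "(\<integral>\<^sup>+x. (SUP n. U n) x \<partial>R i) = (SUP n. \<integral>\<^sup>+x. U n x \<partial>R i)"
        unfolding SUP_apply using seq(1,3)
        by (intro nn_integral_monotone_convergence_SUP) (auto simp: measurable_cong_sets[OF R[OF that] refl])
      then show ?thesis
        by (simp add: SUP_mult_left_ennreal)
    qed
    then have "(\<Sum>i\<in>K. e i * (\<integral>\<^sup>+x. (SUP n. U n) x \<partial>R i))
        = (\<Sum>i\<in>K. SUP n. e i * (\<integral>\<^sup>+x. U n x \<partial>R i))"
      by simp
    also have "\<dots> = (SUP n. \<Sum>i\<in>K. e i * (\<integral>\<^sup>+x. U n x \<partial>R i))"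
      using seq(3)
      by (intro ennreal_SUP_sum[symmetric]) (auto intro!: mult_left_mono nn_integral_mono simp: incseq_def le_fun_def)[1]
    finally show ?thesis .
  qed
  show ?case
    unfolding seq(4) by (simp only: *[OF sets(1)] *[OF sets(2)] seq.IH)
qed

subsection \<open>Energies of kernels realised on a sphere\<close>

text \<open>The bound \<open>\<bar>a * b\<bar> \<le> (a\<^sup>2 + b\<^sup>2) / 2\<close> keeps the
  integral of \<open>\<bar>\<Psi> x \<omega> * \<Psi> y \<omega>\<bar>\<close> over \<omega> below
  \<open>R\<close>. As \<open>P\<close> and \<open>Q\<close> are finite, the triple integral
  converges absolutely and Fubini applies. Two measures are allowed because the square of a
  difference of two measures has mixed terms.\<close>

lemma gram_integral:
  fixes \<Psi> :: "'a \<Rightarrow> 'b \<Rightarrow> real"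
  assumes "finite_measure P" "finite_measure Q" "sigma_finite_measure \<Omega>"
    and sets [measurable_cong]: "sets P = sets M" "sets Q = sets M"
    and [measurable]: "(\<lambda>(x, \<omega>). \<Psi> x \<omega>) \<in> borel_measurable (M \<Otimes>\<^sub>M \<Omega>)"
    and int: "\<And>x. x \<in> space M \<Longrightarrow> integrable \<Omega> (\<lambda>\<omega>. (\<Psi> x \<omega>)\<^sup>2)"
    and R: "\<And>x. x \<in> space M \<Longrightarrow> (\<integral>\<omega>. (\<Psi> x \<omega>)\<^sup>2 \<partial>\<Omega>) = R"
  shows "\<And>x y. x \<in> space M \<Longrightarrow> y \<in> space M \<Longrightarrow> integrable \<Omega> (\<lambda>\<omega>. \<Psi> x \<omega> * \<Psi> y \<omega>)"
    and "\<And>x y. x \<in> space M \<Longrightarrow> y \<in> space M \<Longrightarrow> \<bar>\<integral>\<omega>. \<Psi> x \<omega> * \<Psi> y \<omega> \<partial>\<Omega>\<bar> \<le> R"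
    and "integrable \<Omega> (\<lambda>\<omega>. (\<integral>x. \<Psi> x \<omega> \<partial>P) * (\<integral>y. \<Psi> y \<omega> \<partial>Q))"
    and "(\<integral>y. \<integral>x. (\<integral>\<omega>. \<Psi> x \<omega> * \<Psi> y \<omega> \<partial>\<Omega>) \<partial>P \<partial>Q) =
      (\<integral>\<omega>. (\<integral>x. \<Psi> x \<omega> \<partial>P) * (\<integral>y. \<Psi> y \<omega> \<partial>Q) \<partial>\<Omega>)"
proof -
  interpret P: finite_measure P by fact
  interpret Q: finite_measure Q by fact
  interpret \<Omega>: sigma_finite_measure \<Omega> by fact
  interpret PQ: pair_sigma_finite P Q ..
  interpret PQf: finite_measure "P \<Otimes>\<^sub>M Q"
    by (intro finite_measure_pair_measure) fact+
  interpret PQ\<Omega>: pair_sigma_finite "P \<Otimes>\<^sub>M Q" \<Omega> ..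
  have [simp]: "space P = space M" "space Q = space M"
    using sets by (auto dest: sets_eq_imp_space_eq)
  have bnd: "\<bar>a * b\<bar> \<le> (a\<^sup>2 + b\<^sup>2) / 2" for a b :: real
    using sum_squares_bound[of "\<bar>a\<bar>" "\<bar>b\<bar>"] by (simp add: abs_mult)
  have [measurable]: "\<Psi> x \<in> borel_measurable \<Omega>" if "x \<in> space M" for x
    using that by measurable
  show i: "integrable \<Omega> (\<lambda>\<omega>. \<Psi> x \<omega> * \<Psi> y \<omega>)" if "x \<in> space M" "y \<in> space M" for x y
  proof (rule Bochner_Integration.integrable_bound)
    show "integrable \<Omega> (\<lambda>\<omega>. ((\<Psi> x \<omega>)\<^sup>2 + (\<Psi> y \<omega>)\<^sup>2) / 2)"
      using int that by auto
  qed (use that bnd in \<open>auto simp: abs_mult\<close>)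
  have n: "(\<integral>\<omega>. \<bar>\<Psi> x \<omega> * \<Psi> y \<omega>\<bar> \<partial>\<Omega>) \<le> R" if "x \<in> space M" "y \<in> space M" for x y
  proof -
    have "(\<integral>\<omega>. \<bar>\<Psi> x \<omega> * \<Psi> y \<omega>\<bar> \<partial>\<Omega>) \<le> (\<integral>\<omega>. ((\<Psi> x \<omega>)\<^sup>2 + (\<Psi> y \<omega>)\<^sup>2) / 2 \<partial>\<Omega>)"
      using int i that bnd by (intro integral_mono integrable_abs) auto
    also have "\<dots> = R"
      using int R that by simp
    finally show ?thesis .
  qed
  show "\<bar>\<integral>\<omega>. \<Psi> x \<omega> * \<Psi> y \<omega> \<partial>\<Omega>\<bar> \<le> R" if "x \<in> space M" "y \<in> space M" for x y
    using integral_abs_bound n[OF that] by (rule order_trans)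
  have I: "integrable ((P \<Otimes>\<^sub>M Q) \<Otimes>\<^sub>M \<Omega>) (\<lambda>(z, \<omega>). \<Psi> (fst z) \<omega> * \<Psi> (snd z) \<omega>)"
  proof (rule PQ\<Omega>.Fubini_integrable)
    show "integrable (P \<Otimes>\<^sub>M Q)
        (\<lambda>z. \<integral>\<omega>. norm (case (z, \<omega>) of (z, \<omega>) \<Rightarrow> \<Psi> (fst z) \<omega> * \<Psi> (snd z) \<omega>) \<partial>\<Omega>)"
      using n by (intro PQf.integrable_const_bound[where B = R] AE_I2) (auto simp: space_pair_measure)
    show "AE z in P \<Otimes>\<^sub>M Q. integrable \<Omega> (\<lambda>\<omega>. case (z, \<omega>) of (z, \<omega>) \<Rightarrow> \<Psi> (fst z) \<omega> * \<Psi> (snd z) \<omega>)"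
      using i by (intro AE_I2) (auto simp: space_pair_measure)
  qed measurable
  have "AE \<omega> in \<Omega>. integrable (P \<Otimes>\<^sub>M Q) (\<lambda>z. \<Psi> (fst z) \<omega> * \<Psi> (snd z) \<omega>)"
    by (rule PQ\<Omega>.AE_integrable_snd[OF I])
  then have ae: "AE \<omega> in \<Omega>. (\<integral>z. \<Psi> (fst z) \<omega> * \<Psi> (snd z) \<omega> \<partial>(P \<Otimes>\<^sub>M Q)) =
      (\<integral>x. \<Psi> x \<omega> \<partial>P) * (\<integral>y. \<Psi> y \<omega> \<partial>Q)"
  proof eventually_elim
    case (elim \<omega>)
    then have "(\<integral>z. \<Psi> (fst z) \<omega> * \<Psi> (snd z) \<omega> \<partial>(P \<Otimes>\<^sub>M Q)) = (\<integral>y. \<integral>x. \<Psi> x \<omega> * \<Psi> y \<omega> \<partial>P \<partial>Q)"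
      using PQ.integral_snd[of "\<lambda>x y. \<Psi> x \<omega> * \<Psi> y \<omega>"] by (simp add: case_prod_beta')
    then show ?case
      by simp
  qed
  have m: "(\<lambda>\<omega>. (\<integral>x. \<Psi> x \<omega> \<partial>P) * (\<integral>y. \<Psi> y \<omega> \<partial>Q)) \<in> borel_measurable \<Omega>"
    by measurable
  have m': "(\<lambda>\<omega>. \<integral>z. \<Psi> (fst z) \<omega> * \<Psi> (snd z) \<omega> \<partial>(P \<Otimes>\<^sub>M Q)) \<in> borel_measurable \<Omega>"
    by measurable
  have "integrable \<Omega> (\<lambda>\<omega>. \<integral>z. \<Psi> (fst z) \<omega> * \<Psi> (snd z) \<omega> \<partial>(P \<Otimes>\<^sub>M Q))"
    by (rule PQ\<Omega>.integrable_snd[OF I])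
  then show "integrable \<Omega> (\<lambda>\<omega>. (\<integral>x. \<Psi> x \<omega> \<partial>P) * (\<integral>y. \<Psi> y \<omega> \<partial>Q))"
    using integrable_cong_AE[OF m' m ae] by simp
  have I': "integrable (P \<Otimes>\<^sub>M Q) (\<lambda>(x, y). \<integral>\<omega>. \<Psi> x \<omega> * \<Psi> y \<omega> \<partial>\<Omega>)"
    using PQ\<Omega>.integrable_fst[OF I] by (simp add: case_prod_beta')
  have "(\<integral>y. \<integral>x. (\<integral>\<omega>. \<Psi> x \<omega> * \<Psi> y \<omega> \<partial>\<Omega>) \<partial>P \<partial>Q) =
      (\<integral>z. \<integral>\<omega>. \<Psi> (fst z) \<omega> * \<Psi> (snd z) \<omega> \<partial>\<Omega> \<partial>(P \<Otimes>\<^sub>M Q))"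
    using PQ.integral_snd[OF I'] by (simp add: case_prod_beta')
  also have "\<dots> = (\<integral>\<omega>. \<integral>z. \<Psi> (fst z) \<omega> * \<Psi> (snd z) \<omega> \<partial>(P \<Otimes>\<^sub>M Q) \<partial>\<Omega>)"
    by (rule PQ\<Omega>.Fubini_integral[OF I, symmetric])
  also have "\<dots> = (\<integral>\<omega>. (\<integral>x. \<Psi> x \<omega> \<partial>P) * (\<integral>y. \<Psi> y \<omega> \<partial>Q) \<partial>\<Omega>)"
    by (rule integral_cong_AE[OF m' m ae])
  finally show "(\<integral>y. \<integral>x. (\<integral>\<omega>. \<Psi> x \<omega> * \<Psi> y \<omega> \<partial>\<Omega>) \<partial>P \<partial>Q) =
      (\<integral>\<omega>. (\<integral>x. \<Psi> x \<omega> \<partial>P) * (\<integral>y. \<Psi> y \<omega> \<partial>Q) \<partial>\<Omega>)" .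
qed

text \<open>If \<open>D x y = \<parallel>\<Psi> x - \<Psi> y\<parallel>\<^sup>2\<close> with \<open>\<Psi>\<close> on a sphere of squared radius \<open>R\<close>, then the
  energy of a measure of mass 1 is \<open>2 R - 2 \<parallel>\<integral>\<Psi>\<parallel>\<^sup>2\<close>.\<close>

lemma energy_sphere_le:
  fixes \<Psi> :: "'a \<Rightarrow> 'b \<Rightarrow> real"
  assumes "finite_measure P" "finite_measure N" "sigma_finite_measure \<Omega>"
    and sets [measurable_cong]: "sets P = sets M" "sets N = sets M"
    and meas [measurable]: "(\<lambda>(x, \<omega>). \<Psi> x \<omega>) \<in> borel_measurable (M \<Otimes>\<^sub>M \<Omega>)"
    and int: "\<And>x. x \<in> space M \<Longrightarrow> integrable \<Omega> (\<lambda>\<omega>. (\<Psi> x \<omega>)\<^sup>2)"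
    and R: "\<And>x. x \<in> space M \<Longrightarrow> (\<integral>\<omega>. (\<Psi> x \<omega>)\<^sup>2 \<partial>\<Omega>) = R"
    and D: "\<And>x y. x \<in> space M \<Longrightarrow> y \<in> space M \<Longrightarrow> D x y = (\<integral>\<omega>. (\<Psi> x \<omega> - \<Psi> y \<omega>)\<^sup>2 \<partial>\<Omega>)"
    and mass: "measure P (space M) - measure N (space M) = 1"
  shows "(\<integral>y. (\<integral>x. D x y \<partial>P) - (\<integral>x. D x y \<partial>N) \<partial>P)
       - (\<integral>y. (\<integral>x. D x y \<partial>P) - (\<integral>x. D x y \<partial>N) \<partial>N) \<le> 2 * R"
proof -
  interpret P: finite_measure P by fact
  interpret N: finite_measure N by fact
  interpret \<Omega>: sigma_finite_measure \<Omega> by fact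
  have sp [simp]: "space P = space M" "space N = space M"
    using sets by (auto dest: sets_eq_imp_space_eq)
  note gram = gram_integral[OF _ _ assms(3) _ _ meas int R]
  define ip where "ip x y = (\<integral>\<omega>. \<Psi> x \<omega> * \<Psi> y \<omega> \<partial>\<Omega>)" for x y
  have ip_le: "\<bar>ip x y\<bar> \<le> R" if "x \<in> space M" "y \<in> space M" for x y
    unfolding ip_def using gram(2)[OF assms(1,1) sets(1,1)] that by simp
  have [measurable]: "(\<lambda>(x, y). ip x y) \<in> borel_measurable (M \<Otimes>\<^sub>M M)"
    unfolding ip_def by measurable
  have Dip: "D x y = 2 * R - 2 * ip x y" if "x \<in> space M" "y \<in> space M" for x y
  proof -
    have "integrable \<Omega> (\<lambda>\<omega>. \<Psi> x \<omega> * \<Psi> y \<omega>)"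
      using gram(1)[OF assms(1,1) sets(1,1)] that by simp
    then show ?thesis
      using int that R[OF that(1)] R[OF that(2)]
      by (simp add: D power2_diff ip_def mult.assoc)
  qed
  have intP: "integrable P (\<lambda>x. ip x y)" and intN: "integrable N (\<lambda>x. ip x y)" if "y \<in> space M" for y
    using that ip_le
    by (auto intro!: P.integrable_const_bound[where B = R] N.integrable_const_bound[where B = R] AE_I2)
  define F where "F y = (\<integral>x. ip x y \<partial>P) - (\<integral>x. ip x y \<partial>N)" for y
  have SD: "(\<integral>x. D x y \<partial>P) - (\<integral>x. D x y \<partial>N) = 2 * R - 2 * F y" if "y \<in> space M" for y
  proof -
    have "(\<integral>x. D x y \<partial>P) = (\<integral>x. 2 * R - 2 * ip x y \<partial>P)" "(\<integral>x. D x y \<partial>N) = (\<integral>x. 2 * R - 2 * ip x y \<partial>N)"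
      using that Dip by (auto intro!: Bochner_Integration.integral_cong)
    then have "(\<integral>x. D x y \<partial>P) - (\<integral>x. D x y \<partial>N) =
        2 * R * (measure P (space M) - measure N (space M)) - 2 * F y"
      using intP[OF that] intN[OF that] by (simp add: F_def algebra_simps)
    then show ?thesis
      by (simp add: mass)
  qed
  have [measurable]: "(\<lambda>y. \<integral>x. ip x y \<partial>P) \<in> borel_measurable M" "(\<lambda>y. \<integral>x. ip x y \<partial>N) \<in> borel_measurable M"
    by measurable
  have bP: "\<bar>\<integral>x. ip x y \<partial>P\<bar> \<le> R * measure P (space M)" and bN: "\<bar>\<integral>x. ip x y \<partial>N\<bar> \<le> R * measure N (space M)"
    if y: "y \<in> space M" for y
  proof -
    have "\<bar>\<integral>x. ip x y \<partial>P\<bar> \<le> (\<integral>x. R \<partial>P)"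
      using ip_le y by (intro order_trans[OF integral_abs_bound] integral_mono integrable_abs intP) auto
    then show "\<bar>\<integral>x. ip x y \<partial>P\<bar> \<le> R * measure P (space M)"
      by (simp add: mult.commute)
    have "\<bar>\<integral>x. ip x y \<partial>N\<bar> \<le> (\<integral>x. R \<partial>N)"
      using ip_le y by (intro order_trans[OF integral_abs_bound] integral_mono integrable_abs intN) auto
    then show "\<bar>\<integral>x. ip x y \<partial>N\<bar> \<le> R * measure N (space M)"
      by (simp add: mult.commute)
  qed
  have intF: "integrable P (\<lambda>y. \<integral>x. ip x y \<partial>P)" "integrable N (\<lambda>y. \<integral>x. ip x y \<partial>P)"
      "integrable P (\<lambda>y. \<integral>x. ip x y \<partial>N)" "integrable N (\<lambda>y. \<integral>x. ip x y \<partial>N)"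
    using bP bN
    by (auto intro!: P.integrable_const_bound[where B = "R * measure P (space M)", OF AE_I2]
          N.integrable_const_bound[where B = "R * measure P (space M)", OF AE_I2])[2]
      (use bP bN in \<open>auto intro!: P.integrable_const_bound[where B = "R * measure N (space M)", OF AE_I2]
          N.integrable_const_bound[where B = "R * measure N (space M)", OF AE_I2]\<close>)
  have "(\<integral>y. (\<integral>x. D x y \<partial>P) - (\<integral>x. D x y \<partial>N) \<partial>P) - (\<integral>y. (\<integral>x. D x y \<partial>P) - (\<integral>x. D x y \<partial>N) \<partial>N)
      = (\<integral>y. 2 * R - 2 * F y \<partial>P) - (\<integral>y. 2 * R - 2 * F y \<partial>N)"
    by (rule arg_cong2[where f = "(-)"]; rule Bochner_Integration.integral_cong) (simp_all add: SD)
  also have "\<dots> = 2 * R * (measure P (space M) - measure N (space M)) - 2 * ((\<integral>y. F y \<partial>P) - (\<integral>y. F y \<partial>N))"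
    using intF by (simp add: F_def algebra_simps)
  also have "\<dots> = 2 * R - 2 * ((\<integral>y. F y \<partial>P) - (\<integral>y. F y \<partial>N))"
    by (simp add: mass)
  finally have eq: "(\<integral>y. (\<integral>x. D x y \<partial>P) - (\<integral>x. D x y \<partial>N) \<partial>P)
      - (\<integral>y. (\<integral>x. D x y \<partial>P) - (\<integral>x. D x y \<partial>N) \<partial>N) = 2 * R - 2 * ((\<integral>y. F y \<partial>P) - (\<integral>y. F y \<partial>N))" .
  \<comment> \<open>Positive semidefiniteness of the Gram kernel: the four double integrals combine
    into the squared norm of \<open>GP - GN\<close>, the mean of \<Psi> under the signed
    measure.\<close>
  have "0 \<le> (\<integral>y. F y \<partial>P) - (\<integral>y. F y \<partial>N)"
  proof -
    define GP where "GP \<omega> = (\<integral>x. \<Psi> x \<omega> \<partial>P)" for \<omega>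
    define GN where "GN \<omega> = (\<integral>x. \<Psi> x \<omega> \<partial>N)" for \<omega>
    note gPP = gram(3,4)[OF assms(1,1) sets(1,1), folded ip_def GP_def]
    note gPN = gram(3,4)[OF assms(1,2) sets(1,2), folded ip_def GP_def GN_def]
    note gNP = gram(3,4)[OF assms(2,1) sets(2,1), folded ip_def GP_def GN_def]
    note gNN = gram(3,4)[OF assms(2,2) sets(2,2), folded ip_def GN_def]
    have "(\<integral>y. F y \<partial>P) - (\<integral>y. F y \<partial>N) =
        ((\<integral>\<omega>. GP \<omega> * GP \<omega> \<partial>\<Omega>) - (\<integral>\<omega>. GN \<omega> * GP \<omega> \<partial>\<Omega>)) - ((\<integral>\<omega>. GP \<omega> * GN \<omega> \<partial>\<Omega>) - (\<integral>\<omega>. GN \<omega> * GN \<omega> \<partial>\<Omega>))"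
      using intF by (simp add: F_def gPP gPN gNP gNN)
    also have "\<dots> = (\<integral>\<omega>. (GP \<omega> * GP \<omega> - GN \<omega> * GP \<omega>) - (GP \<omega> * GN \<omega> - GN \<omega> * GN \<omega>) \<partial>\<Omega>)"
      using gPP gPN gNP gNN by (simp add: mult.commute)
    also have "\<dots> = (\<integral>\<omega>. (GP \<omega> - GN \<omega>)\<^sup>2 \<partial>\<Omega>)"
      by (simp add: power2_eq_square algebra_simps)
    also have "\<dots> \<ge> 0"
      by simp
    finally show ?thesis .
  qed
  then show ?thesis
    by (simp add: eq)
qed

subsection \<open>Gaussian vectors\<close>

definition std_gauss :: "real measure" where
  "std_gauss = density lborel (\<lambda>x. ennreal (std_normal_density x))"

definition gauss :: "nat \<Rightarrow> (nat \<Rightarrow> real) measure" where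
  "gauss n = PiM {..<n} (\<lambda>_. std_gauss)"

lemma sets_std_gauss [simp, measurable_cong]: "sets std_gauss = sets borel"
  and space_std_gauss [simp]: "space std_gauss = UNIV"
  by (simp_all add: std_gauss_def)

lemma measurable_std_gauss [simp]: "measurable std_gauss M = measurable borel M"
  by (rule measurable_cong_sets) simp_all

lemma sets_gauss [measurable_cong]: "sets (gauss n) = sets (PiM {..<n} (\<lambda>_. borel))"
  unfolding gauss_def by (intro sets_PiM_cong) simp_all

lemma prob_space_std_gauss: "prob_space std_gauss"
  unfolding std_gauss_def by (rule prob_space_normal_density) simp

interpretation std_gauss: prob_space std_gauss
  by (rule prob_space_std_gauss)

interpretation std_gauss_prod: product_prob_space "\<lambda>_ :: nat. std_gauss" UNIV
  by unfold_locales

lemma prob_space_gauss: "prob_space (gauss n)"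
  unfolding gauss_def by (rule prob_space_PiM) (rule prob_space_std_gauss)

interpretation gauss: prob_space "gauss n" for n
  by (rule prob_space_gauss)

lemma measurable_gauss_component [measurable]:
  "i < n \<Longrightarrow> (\<lambda>g. g i) \<in> borel_measurable (gauss n)"
  unfolding measurable_cong_sets[OF sets_gauss refl] by (rule measurable_component_singleton) simp

lemma nn_integral_std_gauss:
  "f \<in> borel_measurable borel \<Longrightarrow> (\<integral>\<^sup>+x. f x \<partial>std_gauss) = (\<integral>\<^sup>+x. f x * ennreal (std_normal_density x) \<partial>lborel)"
  by (simp add: std_gauss_def nn_integral_density mult.commute)

lemma normal_density_scale:
  assumes "c \<noteq> 0"
  shows "\<bar>c\<bar> * normal_density 0 \<bar>c\<bar> (c * x) = std_normal_density x"
  using assms by (simp add: normal_density_def power_mult_distrib real_sqrt_mult)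

lemma nn_integral_std_gauss_affine:
  assumes [measurable]: "F \<in> borel_measurable borel" and c: "c \<noteq> 0"
  shows "(\<integral>\<^sup>+x. F (t + c * x) \<partial>std_gauss) = (\<integral>\<^sup>+z. F z * ennreal (normal_density 0 \<bar>c\<bar> (z - t)) \<partial>lborel)"
proof -
  have "(\<integral>\<^sup>+z. F z * ennreal (normal_density 0 \<bar>c\<bar> (z - t)) \<partial>lborel) =
      \<bar>c\<bar> * (\<integral>\<^sup>+x. F (t + c * x) * ennreal (normal_density 0 \<bar>c\<bar> (c * x)) \<partial>lborel)"
    by (subst nn_integral_real_affine[OF _ c, of _ t]) simp_all
  also have "\<dots> = (\<integral>\<^sup>+x. F (t + c * x) * ennreal (\<bar>c\<bar> * normal_density 0 \<bar>c\<bar> (c * x)) \<partial>lborel)"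
    by (subst nn_integral_cmult[symmetric]) (simp_all add: ennreal_mult' mult.left_commute)
  also have "\<dots> = (\<integral>\<^sup>+x. F (t + c * x) \<partial>std_gauss)"
    using c by (simp add: normal_density_scale nn_integral_std_gauss)
  finally show ?thesis ..
qed

text \<open>Rotation invariance in the plane, read off from the convolution of two centred normal
  densities. Vanishing coefficients are split off since a normal density needs a positive standard
  deviation; the sign of a single coefficient is removed by symmetry.\<close>

lemma nn_integral_std_gauss_linear2:
  assumes [measurable]: "F \<in> borel_measurable borel"
  shows "(\<integral>\<^sup>+x. \<integral>\<^sup>+y. F (a * x + b * y) \<partial>std_gauss \<partial>std_gauss) = (\<integral>\<^sup>+z. F (sqrt (a\<^sup>2 + b\<^sup>2) * z) \<partial>std_gauss)"
proof -
  have abs: "(\<integral>\<^sup>+x. F (c * x) \<partial>std_gauss) = (\<integral>\<^sup>+x. F (\<bar>c\<bar> * x) \<partial>std_gauss)" for c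
  proof (cases "c = 0")
    case False
    then show ?thesis
      using nn_integral_std_gauss_affine[of F c 0] nn_integral_std_gauss_affine[of F "\<bar>c\<bar>" 0] by simp
  qed simp
  consider "a = 0" | "b = 0" | "a \<noteq> 0" "b \<noteq> 0"
    by blast
  then show ?thesis
  proof cases
    case 1
    then show ?thesis
      using abs[of b] by (simp add: std_gauss.emeasure_space_1[simplified])
  next
    case 2
    then show ?thesis
      using abs[of a] by (simp add: std_gauss.emeasure_space_1[simplified])
  next
    case 3
    let ?s = "sqrt (a\<^sup>2 + b\<^sup>2)"
    have s: "?s \<noteq> 0" "\<bar>?s\<bar> = ?s"
      using 3 by (simp_all add: sum_power2_eq_zero_iff)
    have conv: "(\<integral>\<^sup>+x. ennreal (normal_density 0 \<bar>b\<bar> (z - a * x)) \<partial>std_gauss) = normal_density 0 ?s z" for z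
    proof -
      have "(\<integral>\<^sup>+x. ennreal (normal_density 0 \<bar>b\<bar> (z - a * x)) \<partial>std_gauss) =
          (\<integral>\<^sup>+w. ennreal (normal_density 0 \<bar>b\<bar> (z - w)) * ennreal (normal_density 0 \<bar>a\<bar> w) \<partial>lborel)"
        using nn_integral_std_gauss_affine[of "\<lambda>w. ennreal (normal_density 0 \<bar>b\<bar> (z - w))" a 0] 3
        by simp
      also have "\<dots> = normal_density 0 (sqrt (\<bar>b\<bar>\<^sup>2 + \<bar>a\<bar>\<^sup>2)) z"
        using conv_normal_density_zero_mean[of "\<bar>b\<bar>" "\<bar>a\<bar>"] 3
        by (simp add: fun_eq_iff ennreal_mult')
      finally show ?thesis
        by (simp add: add.commute)
    qed
    have "(\<integral>\<^sup>+x. \<integral>\<^sup>+y. F (a * x + b * y) \<partial>std_gauss \<partial>std_gauss) =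
        (\<integral>\<^sup>+x. \<integral>\<^sup>+z. F z * ennreal (normal_density 0 \<bar>b\<bar> (z - a * x)) \<partial>lborel \<partial>std_gauss)"
      using 3 by (simp add: nn_integral_std_gauss_affine)
    also have "\<dots> = (\<integral>\<^sup>+z. \<integral>\<^sup>+x. F z * ennreal (normal_density 0 \<bar>b\<bar> (z - a * x)) \<partial>std_gauss \<partial>lborel)"
    proof -
      interpret pair_sigma_finite lborel std_gauss ..
      show ?thesis
        by (rule Fubini') measurable
    qed
    also have "\<dots> = (\<integral>\<^sup>+z. F z * ennreal (normal_density 0 \<bar>?s\<bar> (z - 0)) \<partial>lborel)"
      unfolding s(2) by (subst nn_integral_cmult) (simp_all add: conv)
    also have "\<dots> = (\<integral>\<^sup>+z. F (0 + ?s * z) \<partial>std_gauss)"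
      by (rule nn_integral_std_gauss_affine[symmetric]) (use s in auto)
    finally show ?thesis
      by simp
  qed
qed

lemma nn_integral_gauss_Suc:
  assumes "F \<in> borel_measurable (gauss (Suc n))"
  shows "(\<integral>\<^sup>+g. F g \<partial>gauss (Suc n)) = (\<integral>\<^sup>+y. \<integral>\<^sup>+g. F (g(n := y)) \<partial>gauss n \<partial>std_gauss)"
proof -
  have "finite {..<n}" "n \<notin> {..<n}" "{..<Suc n} = insert n {..<n}"
    by auto
  then show ?thesis
    using std_gauss_prod.product_nn_integral_insert_rev[of "{..<n}" n F] assms
    by (simp add: gauss_def)
qed

text \<open>Stability of the normal law: each induction step merges the new coordinate with the
  normal variable that already represents the first \<open>n\<close> ones, and the coefficients add
  up in squares.\<close>

lemma nn_integral_gauss_linear: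
  assumes [measurable]: "F \<in> borel_measurable borel"
  shows "(\<integral>\<^sup>+g. F (\<Sum>i<n. h i * g i) \<partial>gauss n) = (\<integral>\<^sup>+z. F (L2_set h {..<n} * z) \<partial>std_gauss)"
  using assms
proof (induction n arbitrary: F)
  case 0
  then show ?case
    by (simp add: gauss.emeasure_space_1 std_gauss.emeasure_space_1[simplified])
next
  case (Suc n)
  note [measurable] = Suc.prems
  have "(\<integral>\<^sup>+g. F (\<Sum>i<Suc n. h i * g i) \<partial>gauss (Suc n)) =
      (\<integral>\<^sup>+y. \<integral>\<^sup>+g. F (\<Sum>i<Suc n. h i * (g(n := y)) i) \<partial>gauss n \<partial>std_gauss)"
    by (rule nn_integral_gauss_Suc) measurable
  also have "\<dots> = (\<integral>\<^sup>+y. \<integral>\<^sup>+g. F (h n * y + (\<Sum>i<n. h i * g i)) \<partial>gauss n \<partial>std_gauss)"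
    by (simp add: add.commute)
  also have "\<dots> = (\<integral>\<^sup>+y. \<integral>\<^sup>+z. F (h n * y + L2_set h {..<n} * z) \<partial>std_gauss \<partial>std_gauss)"
    by (intro nn_integral_cong Suc.IH) measurable
  also have "\<dots> = (\<integral>\<^sup>+z. F (sqrt ((h n)\<^sup>2 + (L2_set h {..<n})\<^sup>2) * z) \<partial>std_gauss)"
    by (rule nn_integral_std_gauss_linear2) (rule Suc.prems)
  also have "sqrt ((h n)\<^sup>2 + (L2_set h {..<n})\<^sup>2) = L2_set h {..<Suc n}"
    by (simp add: L2_set_def sum_nonneg add.commute)
  finally show ?case .
qed

lemma nn_integral_gauss_component:
  assumes "F \<in> borel_measurable borel" "i < n"
  shows "(\<integral>\<^sup>+g. F (g i) \<partial>gauss n) = (\<integral>\<^sup>+z. F z \<partial>std_gauss)"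
proof -
  let ?h = "\<lambda>j. if j = i then 1 else 0 :: real"
  have "(\<Sum>j<n. ?h j * g j) = g i" for g :: "nat \<Rightarrow> real"
    using assms(2) by (simp add: if_distrib[of "\<lambda>x. x * _"] cong: if_cong)
  moreover have "L2_set ?h {..<n} = 1"
    using assms(2) by (simp add: L2_set_def if_distrib[of "\<lambda>x. x\<^sup>2"] cong: if_cong)
  ultimately show ?thesis
    using nn_integral_gauss_linear[OF assms(1), where h = ?h and n = n] by simp
qed

section \<open>Absolute and square-exponential moments of Gaussians\<close>

definition abs_moment :: "real \<Rightarrow> real" where
  "abs_moment r = (\<integral>z. \<bar>z\<bar> powr r \<partial>std_gauss)"

lemma integrable_abs_moment:
  assumes "0 \<le> r"
  shows "integrable std_gauss (\<lambda>z. \<bar>z\<bar> powr r)"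
proof -
  obtain k :: nat where k: "r \<le> k"
    using real_arch_simple by blast
  have "integrable std_gauss (\<lambda>z. 1 + \<bar>z\<bar> ^ k)"
  proof (rule Bochner_Integration.integrable_add)
    show "integrable std_gauss (\<lambda>z. \<bar>z\<bar> ^ k)"
      unfolding std_gauss_def using integrable_std_normal_moment_abs[of k]
      by (subst integrable_density) (auto simp: normal_density_nonneg)
  qed simp
  then show ?thesis
  proof (rule Bochner_Integration.integrable_bound)
    have "\<bar>z\<bar> powr r \<le> 1 + \<bar>z\<bar> ^ k" for z :: real
    proof (cases "\<bar>z\<bar> \<le> 1")
      case True
      then have "\<bar>z\<bar> powr r \<le> 1 powr r"
        using assms by (intro powr_mono2) auto
      then show ?thesis
        by (simp add: add_increasing2)
    next
      case False
      then have "\<bar>z\<bar> powr r \<le> \<bar>z\<bar> powr k"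
        using k by (intro powr_mono) auto
      then show ?thesis
        using False by (simp add: powr_realpow)
    qed
    then show "AE z in std_gauss. norm (\<bar>z\<bar> powr r) \<le> norm (1 + \<bar>z\<bar> ^ k)"
      by (intro AE_I2) (simp add: order_trans[OF _ abs_ge_self])
  qed simp
qed

lemma nn_integral_abs_moment:
  assumes "0 \<le> r"
  shows "(\<integral>\<^sup>+z. ennreal (\<bar>z\<bar> powr r) \<partial>std_gauss) = ennreal (abs_moment r)"
  unfolding abs_moment_def by (intro nn_integral_eq_integral integrable_abs_moment assms) simp

lemma abs_moment_pos:
  assumes "0 \<le> r"
  shows "0 < abs_moment r"
proof -
  have "(\<integral>\<^sup>+z. ennreal (\<bar>z\<bar> powr r) \<partial>std_gauss) \<noteq> 0"
  proof
    assume "(\<integral>\<^sup>+z. ennreal (\<bar>z\<bar> powr r) \<partial>std_gauss) = 0"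
    then have "AE z in std_gauss. z = 0"
      by (subst (asm) nn_integral_0_iff_AE) auto
    then have "AE z in lborel. z = (0 :: real)"
      unfolding std_gauss_def by (subst (asm) AE_density) (auto simp: normal_density_pos)
    moreover have "AE z in lborel. z \<noteq> (0 :: real)"
      by (rule AE_lborel_singleton)
    ultimately have "AE z in lborel :: real measure. False"
      by eventually_elim simp
    then show False
      using AE_iff_measurable[of UNIV "lborel :: real measure" "\<lambda>_. False"] by simp
  qed
  then show ?thesis
    unfolding nn_integral_abs_moment[OF assms] by (simp add: ennreal_eq_0_iff)
qed

lemma nn_integral_gauss_linear_powr:
  assumes "0 \<le> r"
  shows "(\<integral>\<^sup>+g. ennreal (\<bar>\<Sum>i<n. h i * g i\<bar> powr r) \<partial>gauss n) = ennreal (abs_moment r * L2_set h {..<n} powr r)"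
proof -
  have "(\<integral>\<^sup>+g. ennreal (\<bar>\<Sum>i<n. h i * g i\<bar> powr r) \<partial>gauss n) =
      (\<integral>\<^sup>+z. ennreal (L2_set h {..<n} powr r) * ennreal (\<bar>z\<bar> powr r) \<partial>std_gauss)"
    by (subst nn_integral_gauss_linear[of "\<lambda>t. ennreal (\<bar>t\<bar> powr r)"])
      (simp_all add: abs_mult powr_mult ennreal_mult L2_set_nonneg)
  also have "\<dots> = ennreal (abs_moment r * L2_set h {..<n} powr r)"
    using abs_moment_pos[OF assms]
    by (simp add: nn_integral_multc nn_integral_abs_moment assms ennreal_mult mult.commute)
  finally show ?thesis .
qed

text \<open>Multiplication by \<open>exp (z\<^sup>2 / 4)\<close> halves the exponent of the density
  and gives \<open>sqrt 2\<close> times the density of variance 2. Through this moment the event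
  that a Gaussian vector leaves the ball becomes an exponentially small error.\<close>

lemma nn_integral_exp_square: "(\<integral>\<^sup>+z. ennreal (exp (z\<^sup>2 / 4)) \<partial>std_gauss) = ennreal (sqrt 2)"
proof -
  have "exp (z\<^sup>2 / 4) * std_normal_density z = sqrt 2 * normal_density 0 (sqrt 2) z" for z :: real
  proof -
    have "exp (z\<^sup>2 / 4) * exp (- z\<^sup>2 / 2) = exp (- z\<^sup>2 / 4)"
      unfolding exp_add[symmetric] by simp
    moreover have "sqrt (2 * pi * (sqrt 2)\<^sup>2) = sqrt (2 * pi) * sqrt 2"
      by (simp add: real_sqrt_mult)
    ultimately show ?thesis
      by (simp add: normal_density_def)
  qed
  then have "(\<integral>\<^sup>+z. ennreal (exp (z\<^sup>2 / 4)) \<partial>std_gauss) =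
      (\<integral>\<^sup>+z. ennreal (sqrt 2) * ennreal (normal_density 0 (sqrt 2) z) \<partial>lborel)"
    by (simp add: nn_integral_std_gauss flip: ennreal_mult')
  also have "\<dots> = ennreal (sqrt 2)"
    using prob_space.emeasure_space_1[OF prob_space_normal_density[of "sqrt 2" 0]]
    by (simp add: nn_integral_cmult emeasure_density)
  finally show ?thesis .
qed

lemma nn_integral_gauss_exp_square:
  "(\<integral>\<^sup>+g. ennreal (exp ((\<Sum>i<n. (g i)\<^sup>2) / 4)) \<partial>gauss n) = ennreal (sqrt 2 ^ n)"
proof -
  have "(\<integral>\<^sup>+g. ennreal (exp ((\<Sum>i<n. (g i)\<^sup>2) / 4)) \<partial>gauss n) =
      (\<integral>\<^sup>+g. (\<Prod>i<n. ennreal (exp ((g i)\<^sup>2 / 4))) \<partial>gauss n)"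
    by (simp add: sum_divide_distrib exp_sum prod_ennreal)
  also have "\<dots> = (\<Prod>i<n. \<integral>\<^sup>+z. ennreal (exp (z\<^sup>2 / 4)) \<partial>std_gauss)"
    unfolding gauss_def by (rule std_gauss_prod.product_nn_integral_prod) auto
  also have "\<dots> = ennreal (sqrt 2 ^ n)"
    by (simp add: nn_integral_exp_square ennreal_power)
  finally show ?thesis .
qed

subsection \<open>Snowflakes of intervals on a Hilbert sphere\<close>

text \<open>The kernel \<open>(x - s)_+ ^ b\<close> of the Mandelbrot-van Ness representation of
  fractional Brownian motion. With \<open>b = (p - 1) / 2\<close> the Hurst index is
  \<open>p / 2\<close>, so that increments have squared norm proportional to
  \<open>\<bar>x - y\<bar> powr p\<close>.\<close>

definition half_power :: "real \<Rightarrow> real \<Rightarrow> real \<Rightarrow> real" where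
  "half_power b x s = (if s < x then (x - s) powr b else 0)"

lemma borel_measurable_half_power [measurable]:
  assumes [measurable]: "f \<in> borel_measurable M" "g \<in> borel_measurable M"
  shows "(\<lambda>z. half_power b (f z) (g z)) \<in> borel_measurable M"
  unfolding half_power_def by measurable

lemma half_power_scale:
  assumes "0 < t"
  shows "half_power b (y + t * x) (y + t * u) = t powr b * half_power b x u"
proof -
  have "y + t * x - (y + t * u) = t * (x - u)"
    by (simp add: algebra_simps)
  then show ?thesis
    using assms by (auto simp: half_power_def powr_mult)
qed

lemma nn_integral_powr_interval:
  assumes "- 1 < e" "0 \<le> c"
  shows "(\<integral>\<^sup>+x. ennreal (indicator {0..c} x * x powr e) \<partial>lborel) = ennreal (c powr (e + 1) / (e + 1))"
  by (rule nn_integral_has_integral_lebesgue[OF _ has_integral_powr_from_0[OF assms]]) simp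

text \<open>At the two singularities the square behaves like a power with exponent
  \<open>p - 1 > - 1\<close>. Far out the two terms nearly cancel: by the mean value theorem the
  square is bounded by a power with exponent \<open>p - 3 < - 1\<close>. The functions
  \<open>D1\<close>, \<open>D2\<close>, \<open>D3\<close> dominate these three
  contributions.\<close>

lemma nn_integral_half_power_diff_finite:
  assumes p: "0 < p" "p < 2" and b: "b = (p - 1) / 2"
  shows "(\<integral>\<^sup>+u. ennreal ((half_power b 1 u - half_power b 0 u)\<^sup>2) \<partial>lborel) < \<infinity>"
proof -
  define D1 where "D1 v = ennreal (indicator {0..2} v * v powr (p - 1))" for v :: real
  define D2 where "D2 v = ennreal (indicator {0..1} v * v powr (p - 1))" for v :: real
  define D3 where "D3 v = ennreal (indicator {1..} v * v powr (p - 3))" for v :: real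
  have [measurable]: "D1 \<in> borel_measurable borel" "D2 \<in> borel_measurable borel" "D3 \<in> borel_measurable borel"
    unfolding D1_def D2_def D3_def by measurable
  have sq: "(x powr b)\<^sup>2 = x powr (p - 1)" "(x powr (b - 1))\<^sup>2 = x powr (p - 3)" for x :: real
    by (simp_all add: b power2_eq_square flip: powr_add)
  \<comment> \<open>The variable is reflected, \<open>u = 1 - v\<close>, so that the terms become
    \<open>v powr b\<close> and \<open>(v - 1) powr b\<close>. Arguments are spelt
    \<open>1 + (- 1) * v\<close> and \<open>- 1 + 1 * v\<close> to match the shape
    \<open>t + c * x\<close> of the affine substitution rule.\<close>
  have dom: "ennreal ((half_power b 1 (1 + (- 1) * v) - half_power b 0 (1 + (- 1) * v))\<^sup>2)
      \<le> 2 * D1 v + (2 * D2 (- 1 + 1 * v) + D3 (- 1 + 1 * v))" for v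
  proof -
    consider "v \<le> 0" | "0 < v" "v \<le> 1" | "1 < v" "v \<le> 2" | "2 < v"
      by linarith
    then show ?thesis
    proof cases
      case 1
      then show ?thesis
        by (simp add: half_power_def)
    next
      case 2
      then have "ennreal ((half_power b 1 (1 + (- 1) * v) - half_power b 0 (1 + (- 1) * v))\<^sup>2) = D1 v"
        by (simp add: half_power_def sq D1_def)
      also have "\<dots> \<le> 2 * D1 v + (2 * D2 (- 1 + 1 * v) + D3 (- 1 + 1 * v))"
        by (simp add: mult_2 add.assoc)
      finally show ?thesis .
    next
      case 3
      have "(v powr b - (v - 1) powr b)\<^sup>2 \<le> 2 * (v powr b)\<^sup>2 + 2 * ((v - 1) powr b)\<^sup>2"
        using zero_le_power2[of "v powr b + (v - 1) powr b"] unfolding power2_sum power2_diff by linarith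
      then have "ennreal ((half_power b 1 (1 + (- 1) * v) - half_power b 0 (1 + (- 1) * v))\<^sup>2)
          \<le> ennreal (2 * v powr (p - 1) + 2 * (v - 1) powr (p - 1))"
        using 3 by (intro ennreal_leI) (simp add: half_power_def sq)
      also have "\<dots> = 2 * D1 v + 2 * D2 (- 1 + 1 * v)"
        using 3 by (simp add: D1_def D2_def ennreal_mult')
      also have "\<dots> \<le> 2 * D1 v + (2 * D2 (- 1 + 1 * v) + D3 (- 1 + 1 * v))"
        by (intro add_left_mono) simp
      finally show ?thesis .
    next
      case 4
      have "\<exists>\<xi>>v - 1. \<xi> < v \<and> v powr b - (v - 1) powr b = (v - (v - 1)) * (b * \<xi> powr (b - 1))"
        using 4 by (intro MVT2 has_real_derivative_powr) auto
      then obtain \<xi> where "v - 1 < \<xi>" "v powr b - (v - 1) powr b = (v - (v - 1)) * (b * \<xi> powr (b - 1))"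
        by blast
      then have \<xi>: "v - 1 < \<xi>" "v powr b - (v - 1) powr b = b * \<xi> powr (b - 1)"
        by simp_all
      have "\<bar>v powr b - (v - 1) powr b\<bar> \<le> 1 * (v - 1) powr (b - 1)"
        unfolding \<xi>(2) abs_mult
      proof (intro mult_mono)
        show "\<bar>b\<bar> \<le> 1"
          using p by (simp add: b abs_le_iff)
        show "\<bar>\<xi> powr (b - 1)\<bar> \<le> (v - 1) powr (b - 1)"
          using p 4 \<xi>(1) by (simp add: b powr_mono2')
      qed auto
      then have "(v powr b - (v - 1) powr b)\<^sup>2 \<le> ((v - 1) powr (b - 1))\<^sup>2"
        by (intro abs_le_square_iff[THEN iffD1]) simp
      then have "ennreal ((half_power b 1 (1 + (- 1) * v) - half_power b 0 (1 + (- 1) * v))\<^sup>2) \<le> D3 (- 1 + 1 * v)"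
        using 4 by (simp add: half_power_def D3_def sq)
      also have "\<dots> \<le> 2 * D1 v + (2 * D2 (- 1 + 1 * v) + D3 (- 1 + 1 * v))"
        by (simp add: add_increasing)
      finally show ?thesis .
    qed
  qed
  have "(\<integral>\<^sup>+u. ennreal ((half_power b 1 u - half_power b 0 u)\<^sup>2) \<partial>lborel) =
      (\<integral>\<^sup>+v. ennreal ((half_power b 1 (1 + (- 1) * v) - half_power b 0 (1 + (- 1) * v))\<^sup>2) \<partial>lborel)"
    by (subst nn_integral_real_affine[where c = "- 1" and t = 1]) simp_all
  also have "\<dots> \<le> (\<integral>\<^sup>+v. 2 * D1 v + (2 * D2 (- 1 + 1 * v) + D3 (- 1 + 1 * v)) \<partial>lborel)"
    by (intro nn_integral_mono dom)
  also have "\<dots> = 2 * (\<integral>\<^sup>+v. D1 v \<partial>lborel) +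
      (2 * (\<integral>\<^sup>+v. D2 (- 1 + 1 * v) \<partial>lborel) + (\<integral>\<^sup>+v. D3 (- 1 + 1 * v) \<partial>lborel))"
    by (simp add: nn_integral_add nn_integral_cmult)
  also have "(\<integral>\<^sup>+v. D2 (- 1 + 1 * v) \<partial>lborel) = (\<integral>\<^sup>+v. D2 v \<partial>lborel)"
    using nn_integral_real_affine[of D2 1 "- 1"] by simp
  also have "(\<integral>\<^sup>+v. D3 (- 1 + 1 * v) \<partial>lborel) = (\<integral>\<^sup>+v. D3 v \<partial>lborel)"
    using nn_integral_real_affine[of D3 1 "- 1"] by simp
  also have "(\<integral>\<^sup>+v. D1 v \<partial>lborel) = ennreal (2 powr p / p)"
    using nn_integral_powr_interval[of "p - 1" 2] p by (simp add: D1_def)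
  also have "(\<integral>\<^sup>+v. D2 v \<partial>lborel) = ennreal (1 / p)"
    using nn_integral_powr_interval[of "p - 1" 1] p by (simp add: D2_def)
  also have "(\<integral>\<^sup>+v. D3 v \<partial>lborel) = ennreal (- (1 powr (p - 3 + 1)) / (p - 3 + 1))"
    unfolding D3_def using p
    by (intro nn_integral_has_integral_lebesgue has_integral_powr_to_inf) auto
  also have "2 * ennreal (2 powr p / p) + (2 * ennreal (1 / p) + ennreal (- (1 powr (p - 3 + 1)) / (p - 3 + 1))) < \<infinity>"
    by (simp add: ennreal_mult_less_top)
  finally show ?thesis .
qed

text \<open>Substituting \<open>s = y + t * u\<close> with \<open>t = x - y\<close> takes
  \<open>t powr (2 * b)\<close> out of the square and \<open>t\<close> out of the measure, and
  \<open>2 * b + 1 = p\<close>.\<close>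

lemma nn_integral_half_power_diff:
  assumes p: "0 < p" "p < 2" and b: "b = (p - 1) / 2"
  shows "(\<integral>\<^sup>+s. ennreal ((half_power b x s - half_power b y s)\<^sup>2) \<partial>lborel) =
    ennreal (\<bar>x - y\<bar> powr p) * (\<integral>\<^sup>+u. ennreal ((half_power b 1 u - half_power b 0 u)\<^sup>2) \<partial>lborel)"
proof -
  have two_b: "2 * b = p - 1"
    by (simp add: b)
  have *: "(\<integral>\<^sup>+s. ennreal ((half_power b x s - half_power b y s)\<^sup>2) \<partial>lborel) =
      ennreal (\<bar>x - y\<bar> powr p) * (\<integral>\<^sup>+u. ennreal ((half_power b 1 u - half_power b 0 u)\<^sup>2) \<partial>lborel)"
    if xy: "y < x" for x y
  proof -
    define t where "t = x - y"
    have t: "0 < t" "x = y + t * 1" "y = y + t * 0"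
      using xy by (auto simp: t_def)
    have eq: "(half_power b x (y + t * u) - half_power b y (y + t * u))\<^sup>2 =
        t powr (2 * b) * (half_power b 1 u - half_power b 0 u)\<^sup>2" for u
    proof -
      have "half_power b x (y + t * u) - half_power b y (y + t * u) =
          t powr b * (half_power b 1 u - half_power b 0 u)"
        using half_power_scale[OF t(1), of b y 1 u] half_power_scale[OF t(1), of b y 0 u] t(2)
        by (simp add: algebra_simps)
      then show ?thesis
        by (simp add: power_mult_distrib power2_eq_square powr_add flip: powr_add)
    qed
    have "(\<integral>\<^sup>+s. ennreal ((half_power b x s - half_power b y s)\<^sup>2) \<partial>lborel) =
        ennreal t * (\<integral>\<^sup>+u. ennreal (t powr (2 * b)) * ennreal ((half_power b 1 u - half_power b 0 u)\<^sup>2) \<partial>lborel)"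
      using t(1) by (subst nn_integral_real_affine[where c = t and t = y]) (simp_all add: eq ennreal_mult')
    also have "\<dots> = ennreal (t * t powr (2 * b)) * (\<integral>\<^sup>+u. ennreal ((half_power b 1 u - half_power b 0 u)\<^sup>2) \<partial>lborel)"
      using t(1) by (simp add: nn_integral_cmult ennreal_mult' mult.assoc)
    also have "t * t powr (2 * b) = \<bar>x - y\<bar> powr p"
      using t(1) powr_add[of t 1 "p - 1"] xy by (simp add: two_b t_def)
    finally show ?thesis .
  qed
  consider "x = y" | "x < y" | "y < x"
    by linarith
  then show ?thesis
  proof cases
    case 1
    then show ?thesis
      by simp
  next
    case 2
    then show ?thesis
      using *[of x y] by (simp only: power2_commute[of "half_power b x _"] abs_minus_commute[of x])
  next
    case 3
    then show ?thesis
      by (rule *)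
  qed
qed

text \<open>For \<open>s > 0\<close> the subtrahend \<^term>\<open>half_power b 0 s\<close> vanishes, so for \<open>x\<close> in the interval
  \<open>[0, T]\<close> the inner product of the embedding \<open>half_power b x - half_power b 0\<close> with
  \<open>s \<mapsto> s powr b\<close> on \<open>(0, T)\<close> is a multiple of \<open>x powr p\<close>, just as its squared norm. So the
  image lies on a sphere through the origin; \<open>snowflake\<close> moves the centre to 0.\<close>

definition snowflake :: "real \<Rightarrow> real \<Rightarrow> real \<Rightarrow> real \<Rightarrow> real \<Rightarrow> real" where
  "snowflake b l T x s =
     half_power b x s - half_power b 0 s - l / 2 * (if 0 < s \<and> s < T then s powr b else 0)"

lemma snowflake_sphere:
  assumes p: "0 < p" "p < 2" and b: "b = (p - 1) / 2"
  obtains c l where "0 < c"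
    and "\<And>T x y. has_bochner_integral lborel (\<lambda>s. (snowflake b l T x s - snowflake b l T y s)\<^sup>2) (c * \<bar>x - y\<bar> powr p)"
    and "\<And>T x. 0 \<le> x \<Longrightarrow> x \<le> T \<Longrightarrow> has_bochner_integral lborel (\<lambda>s. (snowflake b l T x s)\<^sup>2) (l\<^sup>2 / (4 * p) * T powr p)"
proof -
  have two_b: "2 * b = p - 1"
    by (simp add: b)
  define C where "C = (\<integral>\<^sup>+u. ennreal ((half_power b 1 u - half_power b 0 u)\<^sup>2) \<partial>lborel)"
  \<comment> \<open>The Beta integral with both parameters \<open>b + 1\<close>. Only
    \<open>0 < B < \<infinity>\<close> is used; finiteness follows from the inequality between the
    product and the sum of squares, as the squares have exponent \<open>p - 1\<close>.\<close>
  define B where "B = (\<integral>\<^sup>+u. ennreal (if 0 < u \<and> u < 1 then u powr b * (1 - u) powr b else 0) \<partial>lborel)"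
  have sq: "(x powr b)\<^sup>2 = x powr (p - 1)" for x :: real
    by (simp add: b power2_eq_square flip: powr_add)
  have pos: "(\<integral>\<^sup>+u. f u \<partial>lborel) \<noteq> 0" if [measurable]: "f \<in> borel_measurable borel" and f: "\<And>u. 0 < u \<Longrightarrow> u < 1 \<Longrightarrow> f u \<noteq> 0"
    for f :: "real \<Rightarrow> ennreal"
  proof
    assume "(\<integral>\<^sup>+u. f u \<partial>lborel) = 0"
    then have "AE u in lborel. f u = 0"
      by (subst (asm) nn_integral_0_iff_AE) auto
    then have "AE u in lborel. u \<notin> {0<..<1::real}"
      by eventually_elim (use f in auto)
    then have "emeasure lborel {u \<in> space lborel. \<not> u \<notin> {0<..<1::real}} = 0"
      by (subst (asm) AE_iff_measurable[OF _ refl]) auto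
    moreover have "{u \<in> space lborel. \<not> u \<notin> {0<..<1::real}} = {0<..<1}"
      by auto
    ultimately show False
      by simp
  qed
  have "C < \<infinity>"
    unfolding C_def by (rule nn_integral_half_power_diff_finite[OF p b])
  moreover have "C \<noteq> 0"
    unfolding C_def by (rule pos) (auto simp: half_power_def)
  ultimately obtain c where c: "C = ennreal c" "0 < c"
    by (intro that[of "enn2real C"]) (simp_all add: enn2real_positive_iff zero_less_iff_neq_zero)
  have "B \<le> (\<integral>\<^sup>+u. ennreal (indicator {0..1} u * u powr (p - 1)) + ennreal (indicator {0..1} (1 + (- 1) * u) * (1 + (- 1) * u) powr (p - 1)) \<partial>lborel)"
    unfolding B_def
  proof (intro nn_integral_mono)
    fix u :: real
    have "2 * (u powr b * (1 - u) powr b) \<le> u powr (p - 1) + (1 - u) powr (p - 1)"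
      using sum_squares_bound[of "u powr b" "(1 - u) powr b"] by (simp add: sq)
    moreover have "0 \<le> u powr b * (1 - u) powr b"
      by simp
    ultimately have "u powr b * (1 - u) powr b \<le> u powr (p - 1) + (1 - u) powr (p - 1)"
      by linarith
    then show "ennreal (if 0 < u \<and> u < 1 then u powr b * (1 - u) powr b else 0) \<le>
        ennreal (indicator {0..1} u * u powr (p - 1)) + ennreal (indicator {0..1} (1 + (- 1) * u) * (1 + (- 1) * u) powr (p - 1))"
      by (auto simp: simp flip: ennreal_plus intro!: ennreal_leI)
  qed
  also have "\<dots> = (\<integral>\<^sup>+u. ennreal (indicator {0..1} u * u powr (p - 1)) \<partial>lborel) + (\<integral>\<^sup>+u. ennreal (indicator {0..1} u * u powr (p - 1)) \<partial>lborel)"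
    using nn_integral_real_affine[of "\<lambda>u. ennreal (indicator {0..1} u * u powr (p - 1))" "- 1" 1]
    by (simp add: nn_integral_add)
  also have "\<dots> < \<infinity>"
    using nn_integral_powr_interval[of "p - 1" 1] p by simp
  finally have "B < \<infinity>" .
  moreover have "B \<noteq> 0"
    unfolding B_def by (rule pos) auto
  ultimately obtain \<beta> where \<beta>: "B = ennreal \<beta>" "0 < \<beta>"
    by (intro that[of "enn2real B"]) (simp_all add: enn2real_positive_iff zero_less_iff_neq_zero)
  \<comment> \<open>With this value the cross term \<open>l * (\<beta> * x powr p)\<close> of the
    expanded square cancels the squared norm \<open>c * x powr p\<close>, and only the norm of the
    centre remains, which does not depend on \<open>x\<close>.\<close>
  define l where "l = c / \<beta>"
  have diff: "has_bochner_integral lborel (\<lambda>s. (half_power b x s - half_power b y s)\<^sup>2) (c * \<bar>x - y\<bar> powr p)" for x y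
    using nn_integral_half_power_diff[OF p b, of x y, folded C_def] c
    by (intro has_bochner_integral_nn_integral) (auto simp: ennreal_mult' mult.commute)
  have beta: "has_bochner_integral lborel (\<lambda>s. (if 0 < s \<and> s < x then s powr b * (x - s) powr b else 0)) (\<beta> * x powr p)"
    if x: "0 \<le> x" for x
  proof (cases "x = 0")
    case False
    then have x0: "0 < x"
      using x by simp
    have eq: "(if 0 < x * u \<and> x * u < x then (x * u) powr b * (x - x * u) powr b else 0) =
        x powr (2 * b) * (if 0 < u \<and> u < 1 then u powr b * (1 - u) powr b else 0)" for u
    proof -
      have "x - x * u = x * (1 - u)"
        by (simp add: algebra_simps)
      moreover have "x powr (2 * b) = x powr b * x powr b"
        by (simp flip: powr_add)
      moreover have "0 < x * u \<and> x * u < x \<longleftrightarrow> 0 < u \<and> u < 1"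
        using x0 by (simp add: zero_less_mult_iff)
      ultimately show ?thesis
        using x0 by (simp add: powr_mult)
    qed
    let ?f = "\<lambda>s. ennreal (if 0 < s \<and> s < x then s powr b * (x - s) powr b else 0)"
    have "(\<integral>\<^sup>+s. ?f s \<partial>lborel) = ennreal \<bar>x\<bar> * (\<integral>\<^sup>+u. ?f (0 + x * u) \<partial>lborel)"
      using x0 by (intro nn_integral_real_affine) auto
    also have "\<dots> = ennreal x *
        (\<integral>\<^sup>+u. ennreal (x powr (2 * b)) * ennreal (if 0 < u \<and> u < 1 then u powr b * (1 - u) powr b else 0) \<partial>lborel)"
      using x0 unfolding add_0_left eq by (simp add: ennreal_mult')
    also have "\<dots> = ennreal (x * x powr (2 * b)) * B"
      using x0 by (simp add: nn_integral_cmult ennreal_mult' mult.assoc B_def)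
    also have "x * x powr (2 * b) = x powr p"
      using x0 powr_add[of x 1 "p - 1"] by (simp add: two_b)
    finally show ?thesis
      using \<beta> by (intro has_bochner_integral_nn_integral) (auto simp: ennreal_mult' mult.commute)
  next
    case True
    then have "(\<lambda>s. if 0 < s \<and> s < x then s powr b * (x - s) powr b else 0) = (\<lambda>_. 0)"
      by auto
    then show ?thesis
      using True has_bochner_integral_zero[of lborel] by simp
  qed
  have sqint: "has_bochner_integral lborel (\<lambda>s. (if 0 < s \<and> s < T then s powr b else 0)\<^sup>2) (T powr p / p)" if T: "0 \<le> T" for T
  proof (intro has_bochner_integral_nn_integral)
    have "(\<integral>\<^sup>+s. ennreal ((if 0 < s \<and> s < T then s powr b else 0)\<^sup>2) \<partial>lborel) = (\<integral>\<^sup>+s. ennreal (indicator {0..T} s * s powr (p - 1)) \<partial>lborel)"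
    proof (rule nn_integral_cong_AE)
      have "AE s in lborel. s \<noteq> (0 :: real) \<and> s \<noteq> T"
        using AE_lborel_singleton[of "0 :: real"] AE_lborel_singleton[of T] by eventually_elim simp
      then show "AE s in lborel. ennreal ((if 0 < s \<and> s < T then s powr b else 0)\<^sup>2) = ennreal (indicator {0..T} s * s powr (p - 1))"
        by eventually_elim (auto simp: sq indicator_def)
    qed
    then show "(\<integral>\<^sup>+s. ennreal ((if 0 < s \<and> s < T then s powr b else 0)\<^sup>2) \<partial>lborel) = ennreal (T powr p / p)"
      using nn_integral_powr_interval[of "p - 1" T] p T by simp
  qed (use p in auto)
  show ?thesis
  proof (rule that[of c l])
    show "has_bochner_integral lborel (\<lambda>s. (snowflake b l T x s - snowflake b l T y s)\<^sup>2) (c * \<bar>x - y\<bar> powr p)" for T x y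
      using diff[of x y] by (simp add: snowflake_def)
    show "has_bochner_integral lborel (\<lambda>s. (snowflake b l T x s)\<^sup>2) (l\<^sup>2 / (4 * p) * T powr p)"
      if x: "0 \<le> x" "x \<le> T" for T x
    proof -
      have prod: "(if 0 < s \<and> s < x then s powr b * (x - s) powr b else 0) =
          (half_power b x s - half_power b 0 s) * (if 0 < s \<and> s < T then s powr b else 0)" for s
        using x by (auto simp: half_power_def)
      have eq: "(snowflake b l T x s)\<^sup>2 = (half_power b x s - half_power b 0 s)\<^sup>2
          + (l\<^sup>2 / 4 * (if 0 < s \<and> s < T then s powr b else 0)\<^sup>2
          - l * (if 0 < s \<and> s < x then s powr b * (x - s) powr b else 0))" for s
        unfolding prod snowflake_def by (simp add: power2_eq_square algebra_simps)
      have val: "l\<^sup>2 / (4 * p) * T powr p = c * \<bar>x - 0\<bar> powr p + (l\<^sup>2 / 4 * (T powr p / p) - l * (\<beta> * x powr p))"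
        using x \<beta> by (simp add: l_def)
      have "0 \<le> T"
        using x by simp
      then show ?thesis
        unfolding eq val using x(1)
        by (intro has_bochner_integral_add has_bochner_integral_diff has_bochner_integral_mult_right diff sqint beta)
    qed
  qed (rule c)
qed

subsection \<open>The upper bound\<close>

lemma mem_lq_ball:
  "x \<in> lq_ball n q \<longleftrightarrow> (\<forall>i\<ge>n. x i = 0) \<and> (\<Sum>i<n. \<bar>x i\<bar> powr q) \<le> 1"
  by (simp add: lq_ball_def topspace_Euclidean_space)

lemma borel_measurable_coordinate [measurable]:
  "(\<lambda>x :: nat \<Rightarrow> real. x i) \<in> borel_measurable (restrict_space borel K)"
  by (intro measurable_restrict_space1 borel_measurable_continuous_onI continuous_on_product_coordinates)

text \<open>An upper bound for the dual norm of \<open>g\<close>: if \<open>Y\<close> is the mean of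
  the \<open>\<bar>g i\<bar> powr r\<close>, that norm is
  \<open>n powr (1 / r) * Y powr (1 / r)\<close>, and \<open>Y powr (1 / r) \<le> 1 + Y\<close>.
  Being affine in \<open>Y\<close>, it has moments that are easy to bound.\<close>

definition width :: "real \<Rightarrow> nat \<Rightarrow> (nat \<Rightarrow> real) \<Rightarrow> real" where
  "width r n g = real n powr (1 / r) * (1 + (\<Sum>i<n. \<bar>g i\<bar> powr r) / n)"

lemma borel_measurable_width [measurable]: "width r n \<in> borel_measurable (gauss n)"
  unfolding width_def by measurable

lemma width_nonneg: "0 \<le> width r n g"
  by (simp add: width_def sum_nonneg)

lemma inner_le_width:
  assumes q: "1 < q" "1 < r" "1 / q + 1 / r = 1" and x: "x \<in> lq_ball n q"
  shows "\<bar>\<Sum>i<n. x i * g i\<bar> \<le> width r n g"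
proof (cases "n = 0")
  case False
  \<comment> \<open>The scale in Young's inequality: since \<open>t powr r = n\<close>, the terms
    \<open>(\<bar>g i\<bar> / t) powr r\<close> add up to an average over the coordinates.\<close>
  define t where "t = real n powr (1 / r)"
  have t: "0 < t" "t powr r = real n"
    using False q by (simp_all add: t_def powr_powr)
  have "\<bar>\<Sum>i<n. x i * g i\<bar> \<le> (\<Sum>i<n. t * (\<bar>x i\<bar> * (\<bar>g i\<bar> / t)))"
    using t by (intro order_trans[OF sum_abs] sum_mono) (simp add: abs_mult)
  also have "\<dots> \<le> (\<Sum>i<n. t * (\<bar>x i\<bar> powr q / q + (\<bar>g i\<bar> / t) powr r / r))"
    using t q by (intro sum_mono mult_left_mono Youngs_inequality) auto
  also have "\<dots> = t * ((\<Sum>i<n. \<bar>x i\<bar> powr q) / q + (\<Sum>i<n. \<bar>g i\<bar> powr r) / n / r)"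
    using t by (simp add: sum.distrib powr_divide flip: sum_distrib_left sum_divide_distrib)
  also have "\<dots> \<le> t * (1 + (\<Sum>i<n. \<bar>g i\<bar> powr r) / n)"
  proof (intro mult_left_mono add_mono)
    show "(\<Sum>i<n. \<bar>x i\<bar> powr q) / q \<le> 1"
      using x q by (simp add: mem_lq_ball)
    show "(\<Sum>i<n. \<bar>g i\<bar> powr r) / n / r \<le> (\<Sum>i<n. \<bar>g i\<bar> powr r) / n"
      using q divide_left_mono[of 1 r "(\<Sum>i<n. \<bar>g i\<bar> powr r) / n"] by (simp add: sum_nonneg)
  qed (use t in auto)
  finally show ?thesis
    by (simp add: width_def t_def)
qed (simp add: width_def)

text \<open>As \<open>1 + Y \<ge> 1\<close>, the exponent \<open>p\<close> may be raised to 2, and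
  the square of a mean is at most the mean of the squares. The expectation of the resulting average
  is independent of the dimension.\<close>

lemma width_powr_le:
  assumes p: "0 < p" "p < 2" and r: "1 < r"
  shows "width r n g powr p \<le> real n powr (p / r) * (2 + 2 * ((\<Sum>i<n. \<bar>g i\<bar> powr (2 * r)) / n))"
proof (cases "n = 0")
  case False
  define Y where "Y = (\<Sum>i<n. \<bar>g i\<bar> powr r) / n"
  have Y: "0 \<le> Y"
    by (simp add: Y_def sum_nonneg)
  have "(1 + Y) powr p \<le> (1 + Y) powr 2"
    using p Y by (intro powr_mono) auto
  also have "\<dots> \<le> 2 + 2 * Y\<^sup>2"
    using Y zero_le_power2[of "1 - Y"] by (simp add: powr_numeral power2_sum power2_diff)
  also have "Y\<^sup>2 \<le> (\<Sum>i<n. \<bar>g i\<bar> powr (2 * r)) / n"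
  proof -
    have "(\<Sum>i<n. \<bar>g i\<bar> powr r)\<^sup>2 \<le> real n * (\<Sum>i<n. (\<bar>g i\<bar> powr r)\<^sup>2)"
      using Cauchy_Schwarz_ineq_sum[of "\<lambda>_. 1" "\<lambda>i. \<bar>g i\<bar> powr r" "{..<n}"] by simp
    also have "(\<Sum>i<n. (\<bar>g i\<bar> powr r)\<^sup>2) = (\<Sum>i<n. \<bar>g i\<bar> powr (2 * r))"
      by (simp add: power2_eq_square flip: powr_add)
    finally show ?thesis
      using False by (simp add: Y_def power_divide field_simps power2_eq_square)
  qed
  finally have "(1 + Y) powr p \<le> 2 + 2 * ((\<Sum>i<n. \<bar>g i\<bar> powr (2 * r)) / n)"
    by simp
  moreover have "width r n g powr p = real n powr (p / r) * (1 + Y) powr p"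
    using Y by (simp add: width_def Y_def powr_mult powr_powr)
  ultimately show ?thesis
    by (simp add: mult_left_mono)
qed (simp add: width_def)

lemma nn_integral_width_powr_le:
  assumes p: "0 < p" "p < 2" and r: "1 < r"
  shows "(\<integral>\<^sup>+g. ennreal (width r n g powr p) \<partial>gauss n) \<le> ennreal (real n powr (p / r) * (2 + 2 * abs_moment (2 * r)))"
proof (cases "n = 0")
  case False
  have "(\<integral>\<^sup>+g. ennreal (width r n g powr p) \<partial>gauss n) \<le>
      (\<integral>\<^sup>+g. ennreal (real n powr (p / r)) * (2 + 2 * ((\<Sum>i<n. ennreal (\<bar>g i\<bar> powr (2 * r))) * ennreal (1 / n))) \<partial>gauss n)"
  proof (intro nn_integral_mono)
    fix g :: "nat \<Rightarrow> real"
    have "ennreal (width r n g powr p) \<le> ennreal (real n powr (p / r) * (2 + 2 * ((\<Sum>i<n. \<bar>g i\<bar> powr (2 * r)) * (1 / n))))"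
      using width_powr_le[OF assms, of n g] by (intro ennreal_leI) simp
    also have "\<dots> = ennreal (real n powr (p / r)) * (2 + 2 * ((\<Sum>i<n. ennreal (\<bar>g i\<bar> powr (2 * r))) * ennreal (1 / n)))"
      by (simp only: ennreal_mult' ennreal_mult'' ennreal_plus sum_ennreal sum_nonneg mult_nonneg_nonneg
          powr_ge_zero zero_le_numeral of_nat_0_le_iff zero_le_divide_1_iff ennreal_numeral)
    finally show "ennreal (width r n g powr p) \<le>
        ennreal (real n powr (p / r)) * (2 + 2 * ((\<Sum>i<n. ennreal (\<bar>g i\<bar> powr (2 * r))) * ennreal (1 / n)))" .
  qed
  also have "\<dots> = ennreal (real n powr (p / r)) * (2 + 2 * ((\<Sum>i<n. \<integral>\<^sup>+g. ennreal (\<bar>g i\<bar> powr (2 * r)) \<partial>gauss n) * ennreal (1 / n)))"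
  proof -
    have [measurable]: "(\<lambda>g. ennreal (\<bar>g i\<bar> powr (2 * r))) \<in> borel_measurable (gauss n)" if "i < n" for i
      using that by measurable
    have "(\<integral>\<^sup>+g. (\<Sum>i<n. ennreal (\<bar>g i\<bar> powr (2 * r))) \<partial>gauss n) = (\<Sum>i<n. \<integral>\<^sup>+g. ennreal (\<bar>g i\<bar> powr (2 * r)) \<partial>gauss n)"
      by (rule nn_integral_sum) simp
    then show ?thesis
      by (simp add: nn_integral_cmult nn_integral_multc nn_integral_add gauss.emeasure_space_1 del: sum_ennreal)
  qed
  also have "(\<Sum>i<n. \<integral>\<^sup>+g. ennreal (\<bar>g i\<bar> powr (2 * r)) \<partial>gauss n) = of_nat n * ennreal (abs_moment (2 * r))"
    using r by (simp add: nn_integral_gauss_component[of "\<lambda>z. ennreal (\<bar>z\<bar> powr (2 * r))"] nn_integral_abs_moment)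
  also have "\<dots> * ennreal (1 / n) = ennreal (abs_moment (2 * r))"
    using False abs_moment_pos[of "2 * r"] r
    by (simp add: ennreal_of_nat_eq_real_of_nat flip: ennreal_mult)
  also have "ennreal (real n powr (p / r)) * (2 + 2 * ennreal (abs_moment (2 * r))) =
      ennreal (real n powr (p / r) * (2 + 2 * abs_moment (2 * r)))"
    using abs_moment_pos[of "2 * r"] r by (simp add: ennreal_mult' ennreal_plus)
  finally show ?thesis .
qed (simp add: width_def)

lemma energy_upper_bound:
  assumes q: "1 < q" "1 < r" "1 / q + 1 / r = 1" and p: "0 < p" "p < 2"
  obtains B where "0 < B"
    and "\<And>n \<mu>. \<mu> \<in> signed_measures_mass1 (lq_ball n q) \<Longrightarrow> energy n p (lq_ball n q) \<mu> \<le> B * real n powr (p / r)"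
proof -
  define b where "b = (p - 1) / 2"
  obtain c l where c: "0 < c"
    and diff: "\<And>T x y. has_bochner_integral lborel (\<lambda>s. (snowflake b l T x s - snowflake b l T y s)\<^sup>2) (c * \<bar>x - y\<bar> powr p)"
    and norm: "\<And>T x. 0 \<le> x \<Longrightarrow> x \<le> T \<Longrightarrow> has_bochner_integral lborel (\<lambda>s. (snowflake b l T x s)\<^sup>2) (l\<^sup>2 / (4 * p) * T powr p)"
    using snowflake_sphere[OF p b_def] by blast
  define m where "m = abs_moment p"
  have m: "0 < m"
    using abs_moment_pos[of p] p by (simp add: m_def)
  define L where "L = l\<^sup>2 / (4 * p) * 2 powr p * (2 + 2 * abs_moment (2 * r))"
  have L: "0 \<le> L"
    using abs_moment_pos[of "2 * r"] q p by (simp add: L_def)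
  have nn_diff: "(\<integral>\<^sup>+s. ennreal ((snowflake b l T x s - snowflake b l T y s)\<^sup>2) \<partial>lborel) = ennreal (c * \<bar>x - y\<bar> powr p)" for T x y
    using diff[of T x y] c by (subst nn_integral_eq_integral) (auto simp: has_bochner_integral_iff)
  have nn_norm: "(\<integral>\<^sup>+s. ennreal ((snowflake b l T x s)\<^sup>2) \<partial>lborel) = ennreal (l\<^sup>2 / (4 * p) * T powr p)" if "0 \<le> x" "x \<le> T" for T x
    using norm[OF that] p by (subst nn_integral_eq_integral) (auto simp: has_bochner_integral_iff)
  have bound: "c * m * energy n p (lq_ball n q) \<mu> \<le> 2 * (L * real n powr (p / r))"
    if \<mu>: "\<mu> \<in> signed_measures_mass1 (lq_ball n q)" for n \<mu>
  proof -
    let ?K = "lq_ball n q"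
    let ?M = "restrict_space borel ?K"
    let ?P = "upper_variation ?M \<mu>" and ?N = "upper_variation ?M (\<lambda>B. - \<mu> B)"
    let ?\<Omega> = "gauss n \<Otimes>\<^sub>M (lborel :: real measure)"
    have fsm: "finite_signed_measure ?M \<mu>" and mass: "\<mu> ?K = 1"
      using \<mu> by (auto simp: signed_measures_mass1_def)
    interpret \<Omega>: pair_sigma_finite "gauss n" "lborel :: real measure" ..
    have spM: "space ?M = ?K"
      by (simp add: space_restrict_space)
    \<comment> \<open>For fixed \<open>g\<close> the shift by the width moves the values
      \<open><g, x>\<close> into \<open>[0, 2 * width]\<close>, which is where
      \<open>snowflake\<close> with that \<open>T\<close> has constant norm. Differences of two
      points are unaffected by the shift.\<close>
    define \<Psi> where "\<Psi> x \<omega> = snowflake b l (2 * width r n (fst \<omega>)) ((\<Sum>i<n. x i * fst \<omega> i) + width r n (fst \<omega>)) (snd \<omega>)"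
      for x :: "nat \<Rightarrow> real" and \<omega> :: "(nat \<Rightarrow> real) \<times> real"
    have [measurable]: "(\<lambda>(x, \<omega>). \<Psi> x \<omega>) \<in> borel_measurable (?M \<Otimes>\<^sub>M ?\<Omega>)"
      unfolding \<Psi>_def snowflake_def by measurable
    have [measurable]: "\<Psi> x \<in> borel_measurable ?\<Omega>" for x
      unfolding \<Psi>_def[abs_def] snowflake_def by measurable
    define R where "R = enn2real (\<integral>\<^sup>+g. ennreal (l\<^sup>2 / (4 * p) * (2 * width r n g) powr p) \<partial>gauss n)"
    have "(\<integral>\<^sup>+g. ennreal (l\<^sup>2 / (4 * p) * (2 * width r n g) powr p) \<partial>gauss n) =
        ennreal (l\<^sup>2 / (4 * p) * 2 powr p) * (\<integral>\<^sup>+g. ennreal (width r n g powr p) \<partial>gauss n)"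
      using p by (subst nn_integral_cmult[symmetric])
        (auto simp: powr_mult width_nonneg ac_simps simp flip: ennreal_mult intro!: nn_integral_cong)
    also have "\<dots> \<le> ennreal (l\<^sup>2 / (4 * p) * 2 powr p) * ennreal (real n powr (p / r) * (2 + 2 * abs_moment (2 * r)))"
      using nn_integral_width_powr_le[OF p q(2)] by (intro mult_left_mono) auto
    also have "\<dots> = ennreal (L * real n powr (p / r))"
      using p by (simp add: L_def ac_simps flip: ennreal_mult')
    finally have le: "(\<integral>\<^sup>+g. ennreal (l\<^sup>2 / (4 * p) * (2 * width r n g) powr p) \<partial>gauss n) \<le> ennreal (L * real n powr (p / r))" .
    then have R: "(\<integral>\<^sup>+g. ennreal (l\<^sup>2 / (4 * p) * (2 * width r n g) powr p) \<partial>gauss n) = ennreal R" "0 \<le> R"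
      unfolding R_def by (auto simp: ennreal_enn2real_if top_unique)
    have R_le: "R \<le> L * real n powr (p / r)"
      using le L unfolding R(1) by (simp add: ennreal_le_iff)
    have sphere: "has_bochner_integral ?\<Omega> (\<lambda>\<omega>. (\<Psi> x \<omega>)\<^sup>2) R" if x: "x \<in> ?K" for x
    proof (rule has_bochner_integral_nn_integral)
      have "(\<integral>\<^sup>+\<omega>. ennreal ((\<Psi> x \<omega>)\<^sup>2) \<partial>?\<Omega>) = (\<integral>\<^sup>+g. \<integral>\<^sup>+s. ennreal ((\<Psi> x (g, s))\<^sup>2) \<partial>lborel \<partial>gauss n)"
        by (rule lborel.nn_integral_fst[symmetric]) measurable
      also have "\<dots> = (\<integral>\<^sup>+g. ennreal (l\<^sup>2 / (4 * p) * (2 * width r n g) powr p) \<partial>gauss n)"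
        unfolding \<Psi>_def fst_conv snd_conv
      proof (intro nn_integral_cong nn_norm)
        fix g :: "nat \<Rightarrow> real"
        show "0 \<le> (\<Sum>i<n. x i * g i) + width r n g" "(\<Sum>i<n. x i * g i) + width r n g \<le> 2 * width r n g"
          using inner_le_width[OF q x, of g] by (auto simp: abs_le_iff)
      qed
      finally show "(\<integral>\<^sup>+\<omega>. ennreal ((\<Psi> x \<omega>)\<^sup>2) \<partial>?\<Omega>) = ennreal R"
        unfolding R(1) .
    qed (use R in auto)
    have dist: "has_bochner_integral ?\<Omega> (\<lambda>\<omega>. (\<Psi> x \<omega> - \<Psi> y \<omega>)\<^sup>2) (c * m * dist2 n x y powr p)" for x y
    proof (rule has_bochner_integral_nn_integral)
      have "(\<integral>\<^sup>+\<omega>. ennreal ((\<Psi> x \<omega> - \<Psi> y \<omega>)\<^sup>2) \<partial>?\<Omega>) = (\<integral>\<^sup>+g. \<integral>\<^sup>+s. ennreal ((\<Psi> x (g, s) - \<Psi> y (g, s))\<^sup>2) \<partial>lborel \<partial>gauss n)"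
        by (rule lborel.nn_integral_fst[symmetric]) measurable
      also have "\<dots> = (\<integral>\<^sup>+g. ennreal c * ennreal (\<bar>\<Sum>i<n. (x i - y i) * g i\<bar> powr p) \<partial>gauss n)"
        using c by (simp add: \<Psi>_def nn_diff ennreal_mult' left_diff_distrib sum_subtractf)
      also have "\<dots> = ennreal c * ennreal (m * L2_set (\<lambda>i. x i - y i) {..<n} powr p)"
        using p by (subst nn_integral_cmult) (simp_all add: nn_integral_gauss_linear_powr m_def)
      also have "\<dots> = ennreal (c * m * dist2 n x y powr p)"
        using c by (simp add: dist2_def ennreal_mult' mult.assoc)
      finally show "(\<integral>\<^sup>+\<omega>. ennreal ((\<Psi> x \<omega> - \<Psi> y \<omega>)\<^sup>2) \<partial>?\<Omega>) = ennreal (c * m * dist2 n x y powr p)" .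
    qed (use c m in auto)
    have "(\<integral>y. (\<integral>x. c * m * dist2 n x y powr p \<partial>?P) - (\<integral>x. c * m * dist2 n x y powr p \<partial>?N) \<partial>?P)
        - (\<integral>y. (\<integral>x. c * m * dist2 n x y powr p \<partial>?P) - (\<integral>x. c * m * dist2 n x y powr p \<partial>?N) \<partial>?N) \<le> 2 * R"
    proof (rule energy_sphere_le[where M = ?M and \<Psi> = \<Psi> and \<Omega> = ?\<Omega>])
      show "finite_measure ?P" "finite_measure ?N"
        using finite_measure_upper_variation fsm finite_signed_measure_uminus by blast+
      show "sigma_finite_measure ?\<Omega>"
        by (rule \<Omega>.sigma_finite_measure_axioms)
      show "measure ?P (space ?M) - measure ?N (space ?M) = 1"
        using upper_variation_diff[OF fsm, of ?K] mass sets.top[of ?M] by (simp add: spM)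
    qed (use sphere dist in \<open>simp_all add: spM has_bochner_integral_iff\<close>)
    then have "c * m * energy n p ?K \<mu> \<le> 2 * R"
      unfolding energy_def signed_integral_def
      by (simp flip: right_diff_distrib)
    with R_le show ?thesis
      by simp
  qed
  show ?thesis
  \<comment> \<open>Only \<open>0 \<le> L\<close> is known, so \<open>L + 1\<close> is taken to make
    the constant positive.\<close>
  proof (rule that[of "2 * (L + 1) / (c * m)"])
    show "0 < 2 * (L + 1) / (c * m)"
      using c m L by simp
    fix n \<mu> assume "\<mu> \<in> signed_measures_mass1 (lq_ball n q)"
    then have "c * m * energy n p (lq_ball n q) \<mu> \<le> 2 * (L * real n powr (p / r))"
      by (rule bound)
    also have "\<dots> \<le> 2 * ((L + 1) * real n powr (p / r))"
      by (simp add: mult_right_mono)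
    finally show "energy n p (lq_ball n q) \<mu> \<le> 2 * (L + 1) / (c * m) * real n powr (p / r)"
      using c m by (simp add: field_simps)
  qed
qed

subsection \<open>Chebyshev weights\<close>

text \<open>The weights are the coefficients of \<open>X \<mapsto> T\<^sub>n (2 X - 1)\<close>, where \<open>T\<^sub>n\<close> is the Chebyshev
  polynomial; with \<open>X = (cos \<theta>)\<^sup>2\<close> its value is \<open>cos (2 n \<theta>)\<close>.\<close>

lemma chebyshev_weights:
  obtains a :: "nat \<Rightarrow> real"
  where "\<And>\<theta>. (\<Sum>k\<le>n. a k * ((cos \<theta>)\<^sup>2) ^ k) = cos (2 * real n * \<theta>)" and "(\<Sum>k\<le>n. \<bar>a k\<bar>) \<le> 7 ^ n"
proof -
  \<comment> \<open>The clause that the coefficients vanish above \<open>n\<close> allows the sums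
    of different degrees in the recurrence to be written over one common range.\<close>
  define good where "good n a \<longleftrightarrow> (\<forall>k>n. a k = 0) \<and> (\<forall>\<theta>. (\<Sum>k\<le>n. a k * ((cos \<theta>)\<^sup>2) ^ k) = cos (2 * real n * \<theta>)) \<and>
      (\<Sum>k\<le>n. \<bar>a k\<bar>) \<le> 7 ^ n" for n and a :: "nat \<Rightarrow> real"
  have g0: "good 0 (\<lambda>k. if k = 0 then 1 else 0)"
    by (simp add: good_def)
  have g1: "good 1 (\<lambda>k. if k = 0 then - 1 else if k = 1 then 2 else 0)"
    by (auto simp: good_def cos_double_cos)
  have step: "\<exists>c. good (Suc (Suc n)) c" if a: "good n a" and b: "good (Suc n) b" for n a b
  proof -
    define s where "s k = (case k of 0 \<Rightarrow> 0 | Suc j \<Rightarrow> b j)" for k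
    \<comment> \<open>The recurrence \<open>T_(n+2) = 2 y T_(n+1) - T_n\<close> at
      \<open>y = 2 X - 1\<close>, where \<open>s\<close> holds the coefficients of \<open>X\<close>
      times the previous polynomial. It multiplies the coefficient sum by at most 6 before adding
      the older one, and \<open>6 * 7 + 1 \<le> 7\<^sup>2\<close>.\<close>
    define c where "c k = 4 * s k - 2 * b k - a k" for k
    have zero: "a (Suc n) = 0" "a (Suc (Suc n)) = 0" "b (Suc (Suc n)) = 0"
      using a b by (auto simp: good_def)
    have s_sum: "(\<Sum>k\<le>Suc (Suc n). s k * x ^ k) = x * (\<Sum>k\<le>Suc n. b k * x ^ k)" for x :: real
      unfolding sum.atMost_Suc_shift[of _ "Suc n"] by (simp add: s_def sum_distrib_left mult.left_commute distrib_left)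
    have s_abs: "(\<Sum>k\<le>Suc (Suc n). \<bar>s k\<bar>) = (\<Sum>k\<le>Suc n. \<bar>b k\<bar>)"
      unfolding sum.atMost_Suc_shift[of _ "Suc n"] by (simp add: s_def)
    have "(\<Sum>k\<le>Suc (Suc n). c k * ((cos \<theta>)\<^sup>2) ^ k) = cos (2 * real (Suc (Suc n)) * \<theta>)" for \<theta>
    proof -
      let ?x = "(cos \<theta>)\<^sup>2"
      have "(\<Sum>k\<le>Suc (Suc n). c k * ?x ^ k) =
          4 * (\<Sum>k\<le>Suc (Suc n). s k * ?x ^ k) - 2 * (\<Sum>k\<le>Suc (Suc n). b k * ?x ^ k) - (\<Sum>k\<le>Suc (Suc n). a k * ?x ^ k)"
        unfolding c_def left_diff_distrib sum_subtractf mult.assoc sum_distrib_left[symmetric] ..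
      also have "\<dots> = 4 * (?x * cos (2 * real (Suc n) * \<theta>)) - 2 * cos (2 * real (Suc n) * \<theta>) - cos (2 * real n * \<theta>)"
        unfolding s_sum using a b zero by (simp add: good_def)
      also have "\<dots> = 2 * cos (2 * \<theta>) * cos (2 * real (Suc n) * \<theta>) - cos (2 * real n * \<theta>)"
        unfolding cos_double_cos by (simp add: algebra_simps)
      also have "\<dots> = cos (2 * real (Suc (Suc n)) * \<theta>)"
      proof -
        have "2 * real (Suc (Suc n)) * \<theta> = 2 * real (Suc n) * \<theta> + 2 * \<theta>" "2 * real n * \<theta> = 2 * real (Suc n) * \<theta> - 2 * \<theta>"
          by (simp_all add: algebra_simps)
        then show ?thesis
          by (simp add: cos_add cos_diff)
      qed
      finally show ?thesis .
    qed
    moreover have "(\<Sum>k\<le>Suc (Suc n). \<bar>c k\<bar>) \<le> 7 ^ Suc (Suc n)"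
    proof -
      have "(\<Sum>k\<le>Suc (Suc n). \<bar>c k\<bar>) \<le> (\<Sum>k\<le>Suc (Suc n). 4 * \<bar>s k\<bar> + 2 * \<bar>b k\<bar> + \<bar>a k\<bar>)"
        unfolding c_def by (intro sum_mono) linarith
      also have "\<dots> = 4 * (\<Sum>k\<le>Suc (Suc n). \<bar>s k\<bar>) + 2 * (\<Sum>k\<le>Suc (Suc n). \<bar>b k\<bar>) + (\<Sum>k\<le>Suc (Suc n). \<bar>a k\<bar>)"
        unfolding sum.distrib sum_distrib_left[symmetric] ..
      also have "\<dots> = 6 * (\<Sum>k\<le>Suc n. \<bar>b k\<bar>) + (\<Sum>k\<le>n. \<bar>a k\<bar>)"
        unfolding s_abs using zero by simp
      also have "\<dots> \<le> 6 * 7 ^ Suc n + 7 ^ n"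
        using a b by (intro add_mono mult_left_mono) (simp_all add: good_def)
      also have "\<dots> \<le> 7 ^ Suc (Suc n)"
        by simp
      finally show ?thesis .
    qed
    moreover have "\<forall>k>Suc (Suc n). c k = 0"
      using a b by (auto simp: good_def c_def s_def split: nat.split)
    ultimately show ?thesis
      unfolding good_def by blast
  qed
  have "\<exists>a b. good n a \<and> good (Suc n) b" for n
  proof (induction n)
    case 0
    then show ?case
      using g0 g1 unfolding One_nat_def by blast
  next
    case (Suc n)
    then show ?case
      using step by blast
  qed
  then obtain a where "good n a"
    by blast
  then show ?thesis
    using that[of a] by (simp add: good_def)
qed

text \<open>The interval lies inside \<open>[pi / 6, 5 * pi / 6]\<close>, for which
  \<open>3 < pi < 4\<close> suffices. Its ends are the bounds that will be found for
  \<open>2 * n * \<phi>\<close>.\<close>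

lemma sin_ge_half: "1 / 2 \<le> sin y" if "7 / 10 \<le> y" "y \<le> 2" for y :: real
proof (cases "y \<le> pi / 2")
  case True
  have "sin (pi / 6) \<le> sin y"
    using that True pi_less_4 pi_gt_zero by (intro sin_monotone_2pi_le) auto
  then show ?thesis
    by (simp add: sin_30)
next
  case False
  have "sin (pi / 6) \<le> sin (pi - y)"
    using that False pi_less_4 pi_gt3 by (intro sin_monotone_2pi_le) auto
  then show ?thesis
    by (simp add: sin_30)
qed

text \<open>The inequality \<open>x \<le> tan x\<close> freed of its denominator. It will bound an
  angle from above by its sine when the cosine is bounded below.\<close>

lemma mult_cos_le_sin:
  fixes x :: real
  assumes "0 \<le> x" "x \<le> pi"
  shows "x * cos x \<le> sin x"
proof (cases "x = 0")
  case False
  then have "\<exists>z>0. z < x \<and> sin x - sin 0 = (x - 0) * cos z"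
    using assms by (intro MVT2 DERIV_sin) auto
  then obtain z where z: "0 < z" "z < x" "sin x = x * cos z"
    by auto
  have "cos x \<le> cos z"
    using z assms by (intro cos_monotone_0_pi_le) auto
  then show ?thesis
    using z assms by (simp add: mult_left_mono)
qed simp

text \<open>With \<open>exp (- s) = (cos \<phi>)\<^sup>2\<close> the sum equals
  \<open>cos (2 * n * \<phi>)\<close>, and \<phi> is comparable to the square root of
  \<open>s\<close>. For \<open>s\<close> of order \<open>1 / n\<^sup>2\<close> in the stated range,
  \<open>2 * n * \<phi>\<close> lies between \<open>7 / 10\<close> and 2, where the sine is at least
  one half and the squared cosine at most \<open>3 / 4\<close>.\<close>

lemma chebyshev_weights_exp:
  assumes a: "\<And>\<theta>. (\<Sum>k\<le>n. a k * ((cos \<theta>)\<^sup>2) ^ k) = cos (2 * real n * \<theta>)" and s: "0 \<le> s"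
  shows "\<bar>\<Sum>k\<le>n. a k * exp (- s * real k)\<bar> \<le> 1"
    and "1 \<le> n \<Longrightarrow> 1 / (4 * real n ^ 2) \<le> s \<Longrightarrow> s \<le> 1 / (2 * real n ^ 2) \<Longrightarrow>
      (\<Sum>k\<le>n. a k * exp (- s * real k))\<^sup>2 \<le> 3 / 4"
proof -
  define \<phi> where "\<phi> = arccos (exp (- s / 2))"
  have "0 < exp (- s / 2)" "exp (- s / 2) \<le> 1"
    using s by auto
  then have b: "- 1 \<le> exp (- s / 2)" "0 \<le> exp (- s / 2)" "exp (- s / 2) \<le> 1"
    by linarith+
  have cos: "cos \<phi> = exp (- s / 2)"
    unfolding \<phi>_def using b by (intro cos_arccos)
  have cos2: "(cos \<phi>)\<^sup>2 = exp (- s)"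
    unfolding cos by (simp add: power2_eq_square flip: exp_add)
  have \<phi>: "0 \<le> \<phi>" "\<phi> \<le> pi / 2"
    unfolding \<phi>_def using b by (intro arccos_lbound arccos_le_pi2; simp)+
  have "exp (- s * real k) = ((cos \<phi>)\<^sup>2) ^ k" for k
    unfolding cos2 by (simp add: exp_of_nat_mult[symmetric] mult.commute)
  then have val: "(\<Sum>k\<le>n. a k * exp (- s * real k)) = cos (2 * real n * \<phi>)"
    using a[of \<phi>] by simp
  show "\<bar>\<Sum>k\<le>n. a k * exp (- s * real k)\<bar> \<le> 1"
    unfolding val by simp
  assume n: "1 \<le> n" and sn: "1 / (4 * real n ^ 2) \<le> s" "s \<le> 1 / (2 * real n ^ 2)"
  have n2: "1 \<le> real n ^ 2"
    using n by simp
  have s2: "s \<le> 1 / 2"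
  proof -
    have "1 / (2 * real n ^ 2) \<le> 1 / 2"
      using n2 order_less_le_trans[OF zero_less_one n2] by (simp add: divide_le_eq)
    with sn show ?thesis
      by linarith
  qed
  have sn': "1 \<le> 4 * real n ^ 2 * s" "2 * real n ^ 2 * s \<le> 1"
    using sn order_less_le_trans[OF zero_less_one n2]
    by (simp_all add: pos_divide_le_eq pos_le_divide_eq ac_simps)
  have sin0: "0 \<le> sin \<phi>"
    using \<phi> by (intro sin_ge_zero) auto
  have sin2: "(sin \<phi>)\<^sup>2 = 1 - exp (- s)"
    using sin_squared_eq[of \<phi>] cos2 by simp
  have sin2_upper: "(sin \<phi>)\<^sup>2 \<le> s"
    using exp_ge_add_one_self[of "- s"] unfolding sin2 by linarith
  have sin2_lower: "s / 2 \<le> (sin \<phi>)\<^sup>2"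
  proof -
    have "exp (- s) \<le> 1 / (1 + s)"
      using s exp_ge_add_one_self[of s] by (simp add: exp_minus field_simps)
    also have "1 / (1 + s) \<le> 1 - s / 2"
      using s s2 mult_left_mono[of s 1 s] by (simp add: field_simps)
    finally show ?thesis
      unfolding sin2 by linarith
  qed
  \<comment> \<open>\<open>7 / 10\<close> is a rational number just below the square root of
    \<open>1 / 2\<close>, the bound supplied by \<open>(sin \<phi>)\<^sup>2 \<ge> s / 2\<close> and
    \<open>4 * n\<^sup>2 * s \<ge> 1\<close>.\<close>
  have "(7 / 10)\<^sup>2 \<le> (2 * real n * sin \<phi>)\<^sup>2"
  proof -
    have "(7 / 10)\<^sup>2 \<le> (1 / 2 :: real)"
      by (simp add: power_divide)
    also have "1 / 2 \<le> 4 * real n ^ 2 * (s / 2)"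
      using sn'(1) by (simp add: mult.assoc mult.left_commute[of s] mult.commute[of s])
    also have "\<dots> \<le> 4 * real n ^ 2 * (sin \<phi>)\<^sup>2"
      using sin2_lower by (intro mult_left_mono) auto
    also have "\<dots> = (2 * real n * sin \<phi>)\<^sup>2"
      by (simp add: power_mult_distrib)
    finally show ?thesis .
  qed
  then have "7 / 10 \<le> 2 * real n * sin \<phi>"
    by (rule power2_le_imp_le) (use sin0 in auto)
  also have "\<dots> \<le> 2 * real n * \<phi>"
    using \<phi> by (intro mult_left_mono sin_x_le_x) auto
  finally have lower: "7 / 10 \<le> 2 * real n * \<phi>" .
  \<comment> \<open>Here \<open>s \<le> 1 / 2\<close> gives
    \<open>(cos \<phi>)\<^sup>2 = exp (- s) \<ge> 1 / 2\<close>, hence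
    \<open>\<phi>\<^sup>2 \<le> 2 * (sin \<phi>)\<^sup>2 \<le> 2 * s\<close>, and
    \<open>2 * n\<^sup>2 * s \<le> 1\<close> finishes.\<close>
  have "(2 * real n * \<phi>)\<^sup>2 \<le> 2\<^sup>2"
  proof -
    have "\<phi>\<^sup>2 / 2 \<le> \<phi>\<^sup>2 * (cos \<phi>)\<^sup>2"
      using exp_ge_add_one_self[of "- s"] s2 cos2 mult_left_mono[of "1 / 2" "(cos \<phi>)\<^sup>2" "\<phi>\<^sup>2"] by simp
    also have "\<dots> = (\<phi> * cos \<phi>)\<^sup>2"
      by (simp add: power_mult_distrib)
    also have "\<dots> \<le> (sin \<phi>)\<^sup>2"
      using \<phi> cos b by (intro power_mono mult_cos_le_sin) auto
    also have "\<dots> \<le> s"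
      by (rule sin2_upper)
    finally have "2 * real n ^ 2 * \<phi>\<^sup>2 \<le> 2 * real n ^ 2 * (2 * s)"
      by (intro mult_left_mono) auto
    with sn'(2) show ?thesis
      by (simp add: power_mult_distrib ac_simps)
  qed
  then have "2 * real n * \<phi> \<le> 2"
    by (rule power2_le_imp_le) simp
  then have "1 / 2 \<le> sin (2 * real n * \<phi>)"
    by (rule sin_ge_half[OF lower])
  then have "(1 / 2)\<^sup>2 \<le> (sin (2 * real n * \<phi>))\<^sup>2"
    by (intro power_mono) auto
  then show "(\<Sum>k\<le>n. a k * exp (- s * real k))\<^sup>2 \<le> 3 / 4"
    unfolding val using sin_squared_eq[of "2 * real n * \<phi>"] by (simp add: power2_eq_square)
qed

text \<open>The Bernstein representation of a fractional power: replacing \<open>s\<close> by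
  \<open>s / u\<close> scales \<open>u\<close> out of the integral. The constant is
  \<open>Gamma (1 - \<theta>) / \<theta>\<close>, of which only positivity and finiteness matter;
  the integrand is at most \<open>s powr (- \<theta>)\<close> near 0 and
  \<open>s powr (- 1 - \<theta>)\<close> at infinity.\<close>

lemma powr_exp_kernel:
  fixes \<theta> :: real
  assumes \<theta>: "0 < \<theta>" "\<theta> < 1"
  obtains c where "0 < c"
    and "\<And>u. 0 \<le> u \<Longrightarrow> has_bochner_integral lborel
      (\<lambda>s. (1 - exp (- s * u)) * (indicator {0<..} s * s powr (- 1 - \<theta>))) (c * u powr \<theta>)"
proof -
  define f where "f u s = ennreal ((1 - exp (- s * u)) * (indicator {0<..} s * s powr (- 1 - \<theta>)))" for u s :: real
  have [measurable]: "f u \<in> borel_measurable borel" for u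
    unfolding f_def by measurable
  have scale: "(\<integral>\<^sup>+s. f u s \<partial>lborel) = ennreal (u powr \<theta>) * (\<integral>\<^sup>+s. f 1 s \<partial>lborel)" if u: "0 < u" for u
  proof -
    have "f u (0 + 1 / u * s) = ennreal (u powr (1 + \<theta>)) * f 1 s" for s
    proof -
      have "(s / u) powr (- 1 - \<theta>) = u powr (1 + \<theta>) * s powr (- 1 - \<theta>)" if "0 < s"
        using that u by (simp add: powr_divide powr_minus_divide[of u "1 + \<theta>"] flip: powr_minus)
          (simp add: powr_diff powr_minus powr_add field_simps)
      then show ?thesis
        using u by (auto simp: f_def indicator_def zero_less_divide_iff simp flip: ennreal_mult')
    qed
    then have "(\<integral>\<^sup>+s. f u s \<partial>lborel) = ennreal (1 / u) * (ennreal (u powr (1 + \<theta>)) * (\<integral>\<^sup>+s. f 1 s \<partial>lborel))"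
      using u nn_integral_real_affine[of "f u" "1 / u" 0] by (simp add: nn_integral_cmult)
    also have "\<dots> = ennreal (1 / u * u powr (1 + \<theta>)) * (\<integral>\<^sup>+s. f 1 s \<partial>lborel)"
      using u by (subst ennreal_mult) (simp_all add: mult.assoc)
    also have "1 / u * u powr (1 + \<theta>) = u powr \<theta>"
      using u by (simp add: powr_add)
    finally show ?thesis .
  qed
  have "(\<integral>\<^sup>+s. f 1 s \<partial>lborel) \<le> (\<integral>\<^sup>+s. ennreal (indicator {0..1} s * s powr (- \<theta>)) + ennreal (indicator {1..} s * s powr (- 1 - \<theta>)) \<partial>lborel)"
  proof (intro nn_integral_mono)
    fix s :: real
    consider "s \<le> 0" | "0 < s" "s \<le> 1" | "1 < s"
      by linarith
    then show "f 1 s \<le> ennreal (indicator {0..1} s * s powr (- \<theta>)) + ennreal (indicator {1..} s * s powr (- 1 - \<theta>))"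
    proof cases
      case 2
      have "(1 - exp (- s)) * s powr (- 1 - \<theta>) \<le> s * s powr (- 1 - \<theta>)"
        using exp_ge_add_one_self[of "- s"] by (intro mult_right_mono) auto
      also have "\<dots> = s powr (- \<theta>)"
        using 2 powr_add[of s 1 "- 1 - \<theta>"] by simp
      finally have "f 1 s \<le> ennreal (indicator {0..1} s * s powr (- \<theta>))"
        using 2 by (simp add: f_def ennreal_leI)
      then show ?thesis
        by (rule order_trans) simp
    next
      case 3
      have "(1 - exp (- s)) * s powr (- 1 - \<theta>) \<le> 1 * s powr (- 1 - \<theta>)"
        by (intro mult_right_mono) auto
      then have "f 1 s \<le> ennreal (indicator {1..} s * s powr (- 1 - \<theta>))"
        using 3 by (simp add: f_def ennreal_leI)
      then show ?thesis
        by (rule order_trans) simp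
    qed (simp add: f_def)
  qed
  also have "\<dots> = (\<integral>\<^sup>+s. ennreal (indicator {0..1} s * s powr (- \<theta>)) \<partial>lborel) + (\<integral>\<^sup>+s. ennreal (indicator {1..} s * s powr (- 1 - \<theta>)) \<partial>lborel)"
    by (rule nn_integral_add) auto
  also have "(\<integral>\<^sup>+s. ennreal (indicator {0..1} s * s powr (- \<theta>)) \<partial>lborel) = ennreal (1 powr (- \<theta> + 1) / (- \<theta> + 1))"
    by (rule nn_integral_has_integral_lebesgue[OF _ has_integral_powr_from_0]) (use \<theta> in auto)
  also have "(\<integral>\<^sup>+s. ennreal (indicator {1..} s * s powr (- 1 - \<theta>)) \<partial>lborel) = ennreal (- (1 powr (- 1 - \<theta> + 1)) / (- 1 - \<theta> + 1))"
    by (rule nn_integral_has_integral_lebesgue[OF _ has_integral_powr_to_inf]) (use \<theta> in auto)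
  finally have fin: "(\<integral>\<^sup>+s. f 1 s \<partial>lborel) < \<infinity>"
    by (rule order_le_less_trans) simp
  have "(\<integral>\<^sup>+s. f 1 s \<partial>lborel) \<noteq> 0"
  proof
    assume "(\<integral>\<^sup>+s. f 1 s \<partial>lborel) = 0"
    then have "AE s in lborel. f 1 s = 0"
      by (subst (asm) nn_integral_0_iff_AE) auto
    then have "AE s in lborel. s \<notin> {0<..<1::real}"
      by eventually_elim (auto simp: f_def ennreal_eq_0_iff mult_le_0_iff not_le)
    then have "emeasure lborel {s \<in> space lborel. \<not> s \<notin> {0<..<1::real}} = 0"
      by (subst (asm) AE_iff_measurable[OF _ refl]) auto
    moreover have "{s \<in> space lborel. \<not> s \<notin> {0<..<1::real}} = {0<..<1}"
      by auto
    ultimately show False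
      by simp
  qed
  with fin obtain c where c: "(\<integral>\<^sup>+s. f 1 s \<partial>lborel) = ennreal c" "0 < c"
    by (intro that[of "enn2real (\<integral>\<^sup>+s. f 1 s \<partial>lborel)"]) (simp_all add: enn2real_positive_iff zero_less_iff_neq_zero)
  show ?thesis
  proof (rule that[OF c(2)])
    fix u :: real assume u: "0 \<le> u"
    show "has_bochner_integral lborel (\<lambda>s. (1 - exp (- s * u)) * (indicator {0<..} s * s powr (- 1 - \<theta>))) (c * u powr \<theta>)"
    proof (rule has_bochner_integral_nn_integral)
      show "(\<integral>\<^sup>+s. ennreal ((1 - exp (- s * u)) * (indicator {0<..} s * s powr (- 1 - \<theta>))) \<partial>lborel) = ennreal (c * u powr \<theta>)"
      proof (cases "u = 0")
        case False
        then show ?thesis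
          using scale[of u] c u by (simp add: f_def ennreal_mult' mult.commute)
      qed simp
      show "AE s in lborel. 0 \<le> (1 - exp (- s * u)) * (indicator {0<..} s * s powr (- 1 - \<theta>))"
        using u by (intro AE_I2) (auto simp: indicator_def)
    qed (use c in auto)
  qed
qed

text \<open>Since the weights sum to 1 and their exponential sum \<open>E\<close> stays in
  \<open>[- 1, 1]\<close>, the quadratic form is the integral of the nonnegative function
  \<open>(1 - E\<^sup>2) * w\<close>. Restricting it to an interval of length of order
  \<open>n powr (- 2)\<close>, where \<open>w\<close> has order
  \<open>n powr (2 + 2 * \<theta>)\<close>, leaves the order
  \<open>n powr (2 * \<theta>)\<close>.\<close>

lemma chebyshev_weights_energy:
  fixes \<theta> :: real
  assumes \<theta>: "0 < \<theta>" "\<theta> < 1"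
  obtains c where "0 < c"
    and "\<And>n a. 1 \<le> n \<Longrightarrow> (\<And>\<phi>. (\<Sum>k\<le>n. a k * ((cos \<phi>)\<^sup>2) ^ k) = cos (2 * real n * \<phi>)) \<Longrightarrow>
      c * real n powr (2 * \<theta>) \<le> (\<Sum>k\<le>n. \<Sum>l\<le>n. a k * a l * (real k + real l) powr \<theta>)"
proof -
  obtain C where C: "0 < C" and kernel: "\<And>u. 0 \<le> u \<Longrightarrow> has_bochner_integral lborel
      (\<lambda>s. (1 - exp (- s * u)) * (indicator {0<..} s * s powr (- 1 - \<theta>))) (C * u powr \<theta>)"
    using powr_exp_kernel[OF \<theta>] by blast
  have "real n powr (2 * \<theta>) / 8 \<le> C * (\<Sum>k\<le>n. \<Sum>l\<le>n. a k * a l * (real k + real l) powr \<theta>)"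
    if n: "1 \<le> n" and a: "\<And>\<phi>. (\<Sum>k\<le>n. a k * ((cos \<phi>)\<^sup>2) ^ k) = cos (2 * real n * \<phi>)" for n a
  proof -
    define w where "w s = indicator {0<..} s * s powr (- 1 - \<theta>)" for s :: real
    define E where "E s = (\<Sum>k\<le>n. a k * exp (- s * real k))" for s
    have one: "(\<Sum>k\<le>n. a k) = 1"
      using a[of 0] by simp
    have "has_bochner_integral lborel
        (\<lambda>s. \<Sum>k\<le>n. \<Sum>l\<le>n. a k * a l * ((1 - exp (- s * (real k + real l))) * w s))
        (\<Sum>k\<le>n. \<Sum>l\<le>n. a k * a l * (C * (real k + real l) powr \<theta>))"
      unfolding w_def by (intro has_bochner_integral_sum has_bochner_integral_mult_right kernel) auto
    moreover have "(\<Sum>k\<le>n. \<Sum>l\<le>n. a k * a l * ((1 - exp (- s * (real k + real l))) * w s)) = (1 - (E s)\<^sup>2) * w s" for s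
    proof -
      have "(1 - (E s)\<^sup>2) * w s = ((\<Sum>k\<le>n. a k) * (\<Sum>l\<le>n. a l) - E s * E s) * w s"
        by (simp add: one power2_eq_square)
      also have "\<dots> = (\<Sum>k\<le>n. \<Sum>l\<le>n. a k * a l * ((1 - exp (- s * (real k + real l))) * w s))"
        unfolding E_def sum_product unfolding sum_subtractf[symmetric] sum_distrib_right
        by (intro sum.cong refl) (simp add: distrib_left exp_add exp_diff exp_minus field_simps)
      finally show ?thesis ..
    qed
    moreover have "(\<Sum>k\<le>n. \<Sum>l\<le>n. a k * a l * (C * (real k + real l) powr \<theta>)) =
        C * (\<Sum>k\<le>n. \<Sum>l\<le>n. a k * a l * (real k + real l) powr \<theta>)"
      by (simp add: sum_distrib_left mult.left_commute)
    ultimately have int: "has_bochner_integral lborel (\<lambda>s. (1 - (E s)\<^sup>2) * w s) (C * (\<Sum>k\<le>n. \<Sum>l\<le>n. a k * a l * (real k + real l) powr \<theta>))"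
      by simp
    let ?S = "{1 / (4 * real n ^ 2)..1 / (2 * real n ^ 2)}"
    \<comment> \<open>A lower bound for the integrand on \<open>?S\<close>: the factor
      \<open>1 / 4\<close> is \<open>1 - 3 / 4\<close>, and the power is the decreasing weight at
      the right end. Multiplied by the length \<open>1 / (4 * n\<^sup>2)\<close> it yields the
      factor \<open>1 / 8\<close>.\<close>
    define h where "h = (2 * real n ^ 2) powr (1 + \<theta>) / 4"
    have n2: "0 < real n ^ 2"
      using n by simp
    have "emeasure lborel ?S < \<infinity>"
      by (simp add: emeasure_lborel_Icc_eq)
    then have int': "integrable lborel (\<lambda>s. indicator ?S s * h)"
      by (intro integrable_mult_left integrable_real_indicator) auto
    have le: "indicator ?S s * h \<le> (1 - (E s)\<^sup>2) * w s" for s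
    proof (cases "s \<in> ?S")
      case True
      have s: "0 < s"
        using True n2 by (auto intro: less_le_trans[rotated])
      have "(1 / (2 * real n ^ 2)) powr (- 1 - \<theta>) \<le> s powr (- 1 - \<theta>)"
        using True s \<theta> by (intro powr_mono2') auto
      also have "(1 / (2 * real n ^ 2)) powr (- 1 - \<theta>) = (2 * real n ^ 2) powr (1 + \<theta>)"
        using powr_minus_divide[of "1 / (2 * real n ^ 2)" "1 + \<theta>"] n2
        by (simp add: powr_divide)
      finally have "1 / 4 * (2 * real n ^ 2) powr (1 + \<theta>) \<le> (1 - (E s)\<^sup>2) * s powr (- 1 - \<theta>)"
        using chebyshev_weights_exp(2)[OF a, of s] s n True
        by (intro mult_mono) (auto simp: E_def)
      then show ?thesis
        using True s by (simp add: h_def w_def)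
    next
      case False
      have "0 \<le> 1 - (E s)\<^sup>2" if "0 < s"
        using chebyshev_weights_exp(1)[OF a, of s] that by (simp add: E_def abs_square_le_1)
      then show ?thesis
        using False by (auto simp: w_def indicator_def)
    qed
    have "(\<integral>s. indicator ?S s * h \<partial>lborel) \<le> (\<integral>s. (1 - (E s)\<^sup>2) * w s \<partial>lborel)"
      using int int' le by (intro integral_mono) (auto simp: has_bochner_integral_iff)
    also have "(\<integral>s. (1 - (E s)\<^sup>2) * w s \<partial>lborel) = C * (\<Sum>k\<le>n. \<Sum>l\<le>n. a k * a l * (real k + real l) powr \<theta>)"
      using int by (rule has_bochner_integral_integral_eq)
    also have "(\<integral>s. indicator ?S s * h \<partial>lborel) = (1 / (2 * real n ^ 2) - 1 / (4 * real n ^ 2)) * h"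
      using n2 by (simp add: divide_left_mono)
    also have "1 / (2 * real n ^ 2) - 1 / (4 * real n ^ 2) = 1 / (4 * real n ^ 2)"
      using n2 by (simp add: field_simps)
    also have "1 / (4 * real n ^ 2) * h = 2 powr \<theta> * real n powr (2 * \<theta>) / 8"
      using n n2 by (simp add: h_def powr_mult powr_add powr_powr powr_power powr_numeral[symmetric] del: powr_numeral)
    finally have "2 powr \<theta> * real n powr (2 * \<theta>) / 8 \<le> C * (\<Sum>k\<le>n. \<Sum>l\<le>n. a k * a l * (real k + real l) powr \<theta>)" .
    moreover have "1 * real n powr (2 * \<theta>) \<le> 2 powr \<theta> * real n powr (2 * \<theta>)"
      using \<theta> by (intro mult_right_mono) (auto simp: ge_one_powr_ge_zero)
    ultimately show ?thesis
      by linarith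
  qed
  then show ?thesis
    using C by (intro that[of "1 / (8 * C)"]) (auto simp: field_simps)
qed

subsection \<open>Integrals against linear combinations of measures\<close>

lemma finite_signed_measure_combination:
  fixes a :: "'i \<Rightarrow> real" and L :: "'i \<Rightarrow> 'b measure"
  assumes fin: "finite I" and L: "\<And>i. i \<in> I \<Longrightarrow> finite_measure (L i)" and sets: "\<And>i. i \<in> I \<Longrightarrow> sets (L i) = sets M"
  shows "finite_signed_measure M (\<lambda>B. \<Sum>i\<in>I. a i * measure (L i) B)"
  unfolding finite_signed_measure_def
proof (intro conjI allI impI)
  show "(\<Sum>i\<in>I. a i * measure (L i) {}) = 0"
    by simp
  fix A :: "nat \<Rightarrow> 'b set"
  assume A: "range A \<subseteq> sets M" "disjoint_family A"
  show "(\<lambda>j. \<Sum>i\<in>I. a i * measure (L i) (A j)) sums (\<Sum>i\<in>I. a i * measure (L i) (\<Union>j. A j))"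
  proof (intro sums_sum sums_mult)
    fix i assume i: "i \<in> I"
    show "(\<lambda>j. measure (L i) (A j)) sums measure (L i) (\<Union>j. A j)"
      using A sets[OF i] by (intro finite_measure.finite_measure_UNION L i) auto
  qed
qed

text \<open>The measures \<open>L i\<close> may overlap and cancel, so the Jordan parts of the
  combination are not the sums over positive and negative coefficients. The identity uses only that
  their difference is \<mu>; \<open>ennreal (a i)\<close> and \<open>ennreal (- a i)\<close> are the
  positive and negative parts of \<open>a i\<close>.\<close>

lemma nn_integral_upper_variation_combination:
  fixes a :: "'i \<Rightarrow> real" and L :: "'i \<Rightarrow> 'b measure"
  assumes fin: "finite I" and L: "\<And>i. i \<in> I \<Longrightarrow> finite_measure (L i)" and sets: "\<And>i. i \<in> I \<Longrightarrow> sets (L i) = sets M"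
    and f: "f \<in> borel_measurable M"
  defines "\<mu> \<equiv> \<lambda>B. \<Sum>i\<in>I. a i * measure (L i) B"
  shows "(\<integral>\<^sup>+x. f x \<partial>upper_variation M \<mu>) + (\<Sum>i\<in>I. ennreal (- a i) * (\<integral>\<^sup>+x. f x \<partial>L i)) =
    (\<integral>\<^sup>+x. f x \<partial>upper_variation M (\<lambda>B. - \<mu> B)) + (\<Sum>i\<in>I. ennreal (a i) * (\<integral>\<^sup>+x. f x \<partial>L i))"
proof -
  have \<mu>: "finite_signed_measure M \<mu>"
    unfolding \<mu>_def by (rule finite_signed_measure_combination) fact+
  \<comment> \<open>The index \<open>None\<close> carries the upper variation and
    \<open>Some i\<close> the measure \<open>L i\<close>, which turns each side into a single sum of
    weighted measures.\<close>
  define U where "U i = (case i of None \<Rightarrow> upper_variation M \<mu> | Some i \<Rightarrow> L i)" for i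
  define V where "V i = (case i of None \<Rightarrow> upper_variation M (\<lambda>B. - \<mu> B) | Some i \<Rightarrow> L i)" for i
  define c where "c i = (case i of None \<Rightarrow> 1 | Some i \<Rightarrow> ennreal (- a i))" for i
  define d where "d i = (case i of None \<Rightarrow> 1 | Some i \<Rightarrow> ennreal (a i))" for i
  have "(\<Sum>i\<in>insert None (Some ` I). c i * (\<integral>\<^sup>+x. f x \<partial>U i)) = (\<Sum>i\<in>insert None (Some ` I). d i * (\<integral>\<^sup>+x. f x \<partial>V i))"
  proof (rule nn_integral_sum_measures_cong[where M = M])
    fix A assume A: "A \<in> sets M"
    let ?P = "upper_variation M \<mu>" and ?N = "upper_variation M (\<lambda>B. - \<mu> B)"
    interpret P: finite_measure ?P
      by (rule finite_measure_upper_variation[OF \<mu>])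
    interpret N: finite_measure ?N
      by (rule finite_measure_upper_variation[OF finite_signed_measure_uminus[OF \<mu>]])
    have L': "ennreal b * emeasure (L i) A = ennreal (max 0 b * measure (L i) A)" if "i \<in> I" for i b
      using finite_measure.emeasure_eq_measure[OF L[OF that]]
      by (simp add: ennreal_mult' max_def ennreal_neg)
    have "measure ?P A + (\<Sum>i\<in>I. max 0 (- a i) * measure (L i) A) = measure ?N A + (\<Sum>i\<in>I. max 0 (a i) * measure (L i) A)"
    proof -
      have "a i * measure (L i) A = max 0 (a i) * measure (L i) A - max 0 (- a i) * measure (L i) A" for i
        by (simp add: max_def)
      then have "\<mu> A = (\<Sum>i\<in>I. max 0 (a i) * measure (L i) A) - (\<Sum>i\<in>I. max 0 (- a i) * measure (L i) A)"
        unfolding \<mu>_def sum_subtractf[symmetric] by (rule sum.cong[OF refl])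
      then show ?thesis
        using upper_variation_diff[OF \<mu> A] by linarith
    qed
    then have "ennreal (measure ?P A) + ennreal (\<Sum>i\<in>I. max 0 (- a i) * measure (L i) A) =
        ennreal (measure ?N A) + ennreal (\<Sum>i\<in>I. max 0 (a i) * measure (L i) A)"
      by (simp add: sum_nonneg flip: ennreal_plus)
    then have "emeasure ?P A + (\<Sum>i\<in>I. ennreal (- a i) * emeasure (L i) A) = emeasure ?N A + (\<Sum>i\<in>I. ennreal (a i) * emeasure (L i) A)"
      by (simp add: L' P.emeasure_eq_measure N.emeasure_eq_measure)
    then show "(\<Sum>i\<in>insert None (Some ` I). c i * emeasure (U i) A) = (\<Sum>i\<in>insert None (Some ` I). d i * emeasure (V i) A)"
      using fin by (simp add: sum.reindex c_def d_def U_def V_def)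
  qed (use fin f sets in \<open>auto simp: U_def V_def\<close>)
  then show ?thesis
    using fin by (simp add: sum.reindex c_def d_def U_def V_def)
qed

text \<open>For nonnegative bounded functions the preceding identity consists of finite terms and
  can be rearranged into differences. A general bounded function is made nonnegative by adding a
  constant, and the identity for that constant is subtracted again.\<close>

lemma signed_integral_combination:
  fixes a :: "'i \<Rightarrow> real" and L :: "'i \<Rightarrow> 'b measure"
  assumes fin: "finite I" and L: "\<And>i. i \<in> I \<Longrightarrow> finite_measure (L i)" and sets: "\<And>i. i \<in> I \<Longrightarrow> sets (L i) = sets M"
    and f: "f \<in> borel_measurable M" and C: "\<And>x. x \<in> space M \<Longrightarrow> \<bar>f x\<bar> \<le> C"
  defines "\<mu> \<equiv> \<lambda>B. \<Sum>i\<in>I. a i * measure (L i) B"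
  shows "signed_integral M \<mu> f = (\<Sum>i\<in>I. a i * (\<integral>x. f x \<partial>L i))"
proof -
  let ?P = "upper_variation M \<mu>" and ?N = "upper_variation M (\<lambda>B. - \<mu> B)"
  have \<mu>: "finite_signed_measure M \<mu>"
    unfolding \<mu>_def by (rule finite_signed_measure_combination) fact+
  have fP: "finite_measure ?P" and fN: "finite_measure ?N"
    using finite_measure_upper_variation \<mu> finite_signed_measure_uminus[OF \<mu>] by blast+
  have int: "integrable Q g" if "finite_measure Q" "sets Q = sets M" "g \<in> borel_measurable M"
    "\<And>x. x \<in> space M \<Longrightarrow> \<bar>g x\<bar> \<le> D" for Q and g :: "'b \<Rightarrow> real" and D
  proof -
    have "space Q = space M"
      using that(2) by (rule sets_eq_imp_space_eq)
    then show ?thesis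
      using that(3,4) unfolding measurable_cong_sets[OF that(2) refl, symmetric]
      by (intro finite_measure.integrable_const_bound[OF that(1), of _ D] AE_I2) auto
  qed
  have nonneg: "(\<integral>x. g x \<partial>?P) - (\<integral>x. g x \<partial>?N) = (\<Sum>i\<in>I. a i * (\<integral>x. g x \<partial>L i))"
    if g: "g \<in> borel_measurable M" "\<And>x. x \<in> space M \<Longrightarrow> 0 \<le> g x \<and> g x \<le> D" for g :: "'b \<Rightarrow> real" and D
  proof -
    have nn: "(\<integral>\<^sup>+x. ennreal (g x) \<partial>Q) = ennreal (\<integral>x. g x \<partial>Q)" and nn': "0 \<le> (\<integral>x. g x \<partial>Q)"
      if "finite_measure Q" "sets Q = sets M" for Q
    proof -
      have sp: "space Q = space M"
        using that(2) by (rule sets_eq_imp_space_eq)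
      show "(\<integral>\<^sup>+x. ennreal (g x) \<partial>Q) = ennreal (\<integral>x. g x \<partial>Q)"
        using g by (intro nn_integral_eq_integral int[OF that, of _ D] AE_I2) (auto simp: sp)
      show "0 \<le> (\<integral>x. g x \<partial>Q)"
        using g by (intro Bochner_Integration.integral_nonneg) (auto simp: sp)
    qed
    have mult: "ennreal b * ennreal (\<integral>x. g x \<partial>L i) = ennreal (max 0 b * (\<integral>x. g x \<partial>L i))" if "i \<in> I" for b i
      using nn'[OF L sets, OF that that] by (simp add: ennreal_mult' max_def ennreal_neg)
    have "(\<integral>\<^sup>+x. ennreal (g x) \<partial>?P) + (\<Sum>i\<in>I. ennreal (- a i) * (\<integral>\<^sup>+x. ennreal (g x) \<partial>L i)) =
        (\<integral>\<^sup>+x. ennreal (g x) \<partial>?N) + (\<Sum>i\<in>I. ennreal (a i) * (\<integral>\<^sup>+x. ennreal (g x) \<partial>L i))"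
      unfolding \<mu>_def using g by (intro nn_integral_upper_variation_combination fin L sets) auto
    then have "ennreal (\<integral>x. g x \<partial>?P) + (\<Sum>i\<in>I. ennreal (max 0 (- a i) * (\<integral>x. g x \<partial>L i))) =
        ennreal (\<integral>x. g x \<partial>?N) + (\<Sum>i\<in>I. ennreal (max 0 (a i) * (\<integral>x. g x \<partial>L i)))"
      by (simp add: nn L sets fP fN mult cong: sum.cong)
    then have "ennreal ((\<integral>x. g x \<partial>?P) + (\<Sum>i\<in>I. max 0 (- a i) * (\<integral>x. g x \<partial>L i))) =
        ennreal ((\<integral>x. g x \<partial>?N) + (\<Sum>i\<in>I. max 0 (a i) * (\<integral>x. g x \<partial>L i)))"
      using nn'[OF fP] nn'[OF fN] nn'[OF L sets] by (simp add: sum_ennreal sum_nonneg)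
    then have "(\<integral>x. g x \<partial>?P) + (\<Sum>i\<in>I. max 0 (- a i) * (\<integral>x. g x \<partial>L i)) =
        (\<integral>x. g x \<partial>?N) + (\<Sum>i\<in>I. max 0 (a i) * (\<integral>x. g x \<partial>L i))"
      using nn'[OF fP] nn'[OF fN] nn'[OF L sets]
      by (subst (asm) ennreal_inj) (auto intro!: add_nonneg_nonneg sum_nonneg mult_nonneg_nonneg)
    moreover have "a i * (\<integral>x. g x \<partial>L i) = max 0 (a i) * (\<integral>x. g x \<partial>L i) - max 0 (- a i) * (\<integral>x. g x \<partial>L i)" for i
      by (simp add: max_def)
    then have "(\<Sum>i\<in>I. a i * (\<integral>x. g x \<partial>L i)) = (\<Sum>i\<in>I. max 0 (a i) * (\<integral>x. g x \<partial>L i)) - (\<Sum>i\<in>I. max 0 (- a i) * (\<integral>x. g x \<partial>L i))"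
      unfolding sum_subtractf[symmetric] by (rule sum.cong[OF refl])
    ultimately show ?thesis
      by linarith
  qed
  \<comment> \<open>On an empty space the bound \<open>C\<close> may be negative, and the shift has
    to be nonnegative.\<close>
  define C' where "C' = max 0 C"
  have C': "\<bar>f x\<bar> \<le> C'" if "x \<in> space M" for x
    using C[OF that] by (simp add: C'_def)
  have shift: "(\<integral>x. f x + C' \<partial>Q) = (\<integral>x. f x \<partial>Q) + (\<integral>x. C' \<partial>Q)" if "finite_measure Q" "sets Q = sets M" for Q
    by (rule Bochner_Integration.integral_add[OF int[OF that f C'] finite_measure.integrable_const[OF that(1)]])
  have "(\<integral>x. f x + C' \<partial>?P) - (\<integral>x. f x + C' \<partial>?N) = (\<Sum>i\<in>I. a i * (\<integral>x. f x + C' \<partial>L i))"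
  proof (rule nonneg[of _ "2 * C'"])
    show "0 \<le> f x + C' \<and> f x + C' \<le> 2 * C'" if "x \<in> space M" for x
      using C'[OF that] by linarith
  qed (use f in auto)
  moreover have "(\<integral>x. C' \<partial>?P) - (\<integral>x. C' \<partial>?N) = (\<Sum>i\<in>I. a i * (\<integral>x. C' \<partial>L i))"
    by (rule nonneg[of _ C']) (auto simp: C'_def)
  moreover have "(\<Sum>i\<in>I. a i * (\<integral>x. f x + C' \<partial>L i)) =
      (\<Sum>i\<in>I. a i * (\<integral>x. f x \<partial>L i)) + (\<Sum>i\<in>I. a i * (\<integral>x. C' \<partial>L i))"
    unfolding sum.distrib[symmetric] distrib_left[symmetric]
    by (intro sum.cong refl arg_cong2[where f = "(*)"] shift L sets)
  ultimately have "(\<integral>x. f x \<partial>?P) - (\<integral>x. f x \<partial>?N) = (\<Sum>i\<in>I. a i * (\<integral>x. f x \<partial>L i))"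
    using shift[OF fP] shift[OF fN] by simp
  then show ?thesis
    by (simp add: signed_integral_def)
qed

subsection \<open>Truncated Gaussian vectors\<close>

text \<open>Points of \<open>gauss n\<close> are \<open>undefined\<close> from index
  \<open>n\<close> on, whereas the carrier of the \<open>n\<close>-dimensional space requires 0
  there; the case distinction repairs this.\<close>

definition scaled :: "nat \<Rightarrow> real \<Rightarrow> (nat \<Rightarrow> real) \<Rightarrow> nat \<Rightarrow> real" where
  "scaled n \<sigma> g = (\<lambda>i. if i < n then \<sigma> * g i else 0)"

text \<open>Sending outside points to the origin, instead of conditioning on the ball, keeps the
  mass 1 without a normalising factor. Each value is still a multiple of \<open>g\<close>, with
  factor \<sigma> or 0, so distance bounds for scaled vectors cover truncated ones too.\<close>

definition truncated :: "nat \<Rightarrow> real \<Rightarrow> real \<Rightarrow> (nat \<Rightarrow> real) \<Rightarrow> nat \<Rightarrow> real" where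
  "truncated n q \<sigma> g = (if scaled n \<sigma> g \<in> lq_ball n q then scaled n \<sigma> g else (\<lambda>_. 0))"

lemma scaled_mem_lq_ball: "scaled n \<sigma> g \<in> lq_ball n q \<longleftrightarrow> (\<Sum>i<n. \<bar>\<sigma> * g i\<bar> powr q) \<le> 1"
  by (simp add: mem_lq_ball scaled_def)

lemma zero_mem_lq_ball: "(\<lambda>_. 0) \<in> lq_ball n q"
  by (simp add: mem_lq_ball)

lemma truncated_mem_lq_ball: "truncated n q \<sigma> g \<in> lq_ball n q"
  by (simp add: truncated_def zero_mem_lq_ball)

lemma measurable_truncated [measurable]:
  "truncated n q \<sigma> \<in> gauss n \<rightarrow>\<^sub>M restrict_space borel (lq_ball n q)"
proof (rule measurable_restrict_space2)
  show "truncated n q \<sigma> \<in> borel_measurable (gauss n)"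
  proof (rule measurable_coordinatewise_then_product)
    fix i
    show "(\<lambda>g. truncated n q \<sigma> g i) \<in> borel_measurable (gauss n)"
    proof (cases "i < n")
      case True
      have "(\<lambda>g. if (\<Sum>i<n. \<bar>\<sigma> * g i\<bar> powr q) \<le> 1 then \<sigma> * g i else 0) \<in> borel_measurable (gauss n)"
        using True by measurable
      also have "(\<lambda>g. if (\<Sum>i<n. \<bar>\<sigma> * g i\<bar> powr q) \<le> 1 then \<sigma> * g i else 0) = (\<lambda>g. truncated n q \<sigma> g i)"
        using True by (auto simp: truncated_def scaled_mem_lq_ball fun_eq_iff) (simp_all add: scaled_def)
      finally show ?thesis .
    next
      case False
      then have "(\<lambda>g. truncated n q \<sigma> g i) = (\<lambda>_. 0)"
        by (auto simp: truncated_def scaled_def)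
      then show ?thesis
        by simp
    qed
  qed
qed (simp add: truncated_mem_lq_ball)

lemma dist2_scaled: "dist2 n (scaled n \<sigma> g) (scaled n \<tau> g') = L2_set (\<lambda>i. \<sigma> * g i - \<tau> * g' i) {..<n}"
  by (simp add: dist2_def scaled_def L2_set_def)

lemma borel_measurable_L2_set_gauss [measurable]:
  "(\<lambda>g. L2_set g {..<n}) \<in> borel_measurable (gauss n)"
  unfolding L2_set_def by measurable

section \<open>Moments of Gaussian norms and distances\<close>

definition gauss_norm_moment :: "nat \<Rightarrow> real \<Rightarrow> real" where
  "gauss_norm_moment n p = (\<integral>g. L2_set g {..<n} powr p \<partial>gauss n)"

lemma nn_integral_gauss_norm:
  assumes p: "0 < p" "p < 2"
  shows "(\<integral>\<^sup>+g. ennreal (L2_set g {..<n} powr p) \<partial>gauss n) = ennreal (gauss_norm_moment n p)"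
proof -
  have "(\<integral>\<^sup>+g. ennreal (L2_set g {..<n} powr p) \<partial>gauss n) \<le> (\<integral>\<^sup>+g. 1 + (\<Sum>i<n. ennreal (\<bar>g i\<bar> powr 2)) \<partial>gauss n)"
  proof (intro nn_integral_mono)
    fix g :: "nat \<Rightarrow> real"
    have "L2_set g {..<n} powr p \<le> 1 + (L2_set g {..<n})\<^sup>2"
    proof (cases "L2_set g {..<n} \<le> 1")
      case True
      then have "L2_set g {..<n} powr p \<le> 1 powr p"
        using p by (intro powr_mono2) (auto simp: L2_set_nonneg)
      then show ?thesis
        by (simp add: add_increasing2)
    next
      case False
      then have "L2_set g {..<n} powr p \<le> L2_set g {..<n} powr 2"
        using p by (intro powr_mono) auto
      then show ?thesis
        using False by (simp add: powr_numeral)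
    qed
    also have "\<dots> = 1 + (\<Sum>i<n. \<bar>g i\<bar> powr 2)"
      by (simp add: L2_set_def sum_nonneg powr_numeral)
    finally have "ennreal (L2_set g {..<n} powr p) \<le> ennreal (1 + (\<Sum>i<n. \<bar>g i\<bar> powr 2))"
      by (rule ennreal_leI)
    also have "\<dots> = 1 + (\<Sum>i<n. ennreal (\<bar>g i\<bar> powr 2))"
      by (subst ennreal_plus) (simp_all add: sum_nonneg sum_ennreal)
    finally show "ennreal (L2_set g {..<n} powr p) \<le> 1 + (\<Sum>i<n. ennreal (\<bar>g i\<bar> powr 2))" .
  qed
  also have "\<dots> = 1 + (\<Sum>i<n. \<integral>\<^sup>+g. ennreal (\<bar>g i\<bar> powr 2) \<partial>gauss n)"
  proof -
    have [measurable]: "(\<lambda>g. ennreal (\<bar>g i\<bar> powr 2)) \<in> borel_measurable (gauss n)" if "i < n" for i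
      using that by measurable
    have "(\<integral>\<^sup>+g. (\<Sum>i<n. ennreal (\<bar>g i\<bar> powr 2)) \<partial>gauss n) = (\<Sum>i<n. \<integral>\<^sup>+g. ennreal (\<bar>g i\<bar> powr 2) \<partial>gauss n)"
      by (rule nn_integral_sum) simp
    then show ?thesis
      by (simp add: nn_integral_add gauss.emeasure_space_1 del: sum_ennreal)
  qed
  also have "(\<Sum>i<n. \<integral>\<^sup>+g. ennreal (\<bar>g i\<bar> powr 2) \<partial>gauss n) = of_nat n * ennreal (abs_moment 2)"
    using nn_integral_gauss_component[of "\<lambda>z. ennreal (\<bar>z\<bar> powr 2)"] nn_integral_abs_moment[of 2] by simp
  also have "1 + of_nat n * ennreal (abs_moment 2) < \<infinity>"
    by (simp add: ennreal_mult_less_top of_nat_less_top)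
  finally have "integrable (gauss n) (\<lambda>g. L2_set g {..<n} powr p)"
    by (intro integrableI_nonneg) auto
  then show ?thesis
    unfolding gauss_norm_moment_def by (intro nn_integral_eq_integral) auto
qed

text \<open>The power mean inequality between exponents \<open>r\<close> and 2. It serves with
  \<open>r = q\<close> to place a Euclidean ball inside the unit ball, and with \<open>r = p\<close>
  to bound the moment of the Gaussian norm from below.\<close>

lemma sum_powr_le_L2_set:
  assumes r: "0 < r" "r \<le> 2" and n: "1 \<le> n"
  shows "(\<Sum>i<n. \<bar>x i\<bar> powr r) \<le> real n powr (1 - r / 2) * L2_set x {..<n} powr r"
proof (cases "L2_set x {..<n} = 0")
  case True
  then show ?thesis
    by (simp add: L2_set_eq_0_iff)
next
  case False
  \<comment> \<open>The mean of the squares. Relative to it, Young's inequality with weights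
    \<open>r / 2\<close> and \<open>1 - r / 2\<close> becomes sharp when all coordinates have equal
    modulus.\<close>
  define A where "A = (L2_set x {..<n})\<^sup>2 / n"
  have L: "0 < L2_set x {..<n}"
    using False L2_set_nonneg[of x "{..<n}"] by (simp only: less_le) simp
  have A: "0 < A"
    using L n by (simp add: A_def)
  have "\<bar>x i\<bar> powr r \<le> A powr (r / 2) * (r / 2 * ((x i)\<^sup>2 / A) + (1 - r / 2))" for i
  proof (cases "x i = 0")
    case True
    then show ?thesis
      using r by simp
  next
    case False
    have "(x i)\<^sup>2 = \<bar>x i\<bar> powr 2"
      by (simp add: powr_numeral)
    then have "\<bar>x i\<bar> powr r = ((x i)\<^sup>2) powr (r / 2)"
      by (simp only: powr_powr) simp
    also have "\<dots> = A powr (r / 2) * ((x i)\<^sup>2 / A) powr (r / 2)"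
      using A by (simp flip: powr_mult)
    also have "((x i)\<^sup>2 / A) powr (r / 2) \<le> r / 2 * ((x i)\<^sup>2 / A) + (1 - r / 2)"
      using Youngs_inequality_0[of "r / 2" "1 - r / 2" "(x i)\<^sup>2 / A" 1] r A False by simp
    finally show ?thesis
      by (simp add: mult_left_mono)
  qed
  then have "(\<Sum>i<n. \<bar>x i\<bar> powr r) \<le> (\<Sum>i<n. A powr (r / 2) * (r / 2 * ((x i)\<^sup>2 / A) + (1 - r / 2)))"
    by (rule sum_mono)
  also have "\<dots> = A powr (r / 2) * (r / 2 * ((\<Sum>i<n. (x i)\<^sup>2) / A) + n * (1 - r / 2))"
    by (simp add: sum.distrib flip: sum_distrib_left sum_divide_distrib)
  also have "(\<Sum>i<n. (x i)\<^sup>2) / A = n"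
  proof -
    have "(\<Sum>i<n. (x i)\<^sup>2) = (L2_set x {..<n})\<^sup>2"
      by (simp add: L2_set_def sum_nonneg)
    then show ?thesis
      using L n by (simp add: A_def)
  qed
  also have "r / 2 * real n + real n * (1 - r / 2) = real n"
    by (simp add: algebra_simps)
  also have "A powr (r / 2) * real n = real n powr (1 - r / 2) * L2_set x {..<n} powr r"
  proof -
    have "((L2_set x {..<n})\<^sup>2) powr (r / 2) = L2_set x {..<n} powr r"
      unfolding powr_numeral[OF L2_set_nonneg, symmetric] powr_powr by simp
    then show ?thesis
      using L n by (simp add: A_def powr_divide powr_diff)
  qed
  finally show ?thesis .
qed

text \<open>Integrating the power mean inequality suffices, because the \<open>n\<close> coordinates
  all have the same absolute moment.\<close>

lemma gauss_norm_moment_ge: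
  assumes p: "0 < p" "p < 2" and n: "1 \<le> n"
  shows "abs_moment p * real n powr (p / 2) \<le> gauss_norm_moment n p"
proof -
  have "ennreal (real n * abs_moment p) = (\<Sum>i<n. \<integral>\<^sup>+g. ennreal (\<bar>g i\<bar> powr p) \<partial>gauss n)"
    using nn_integral_gauss_component[of "\<lambda>z. ennreal (\<bar>z\<bar> powr p)"] nn_integral_abs_moment[of p] p abs_moment_pos[of p]
    by (simp add: ennreal_mult ennreal_of_nat_eq_real_of_nat)
  also have "\<dots> = (\<integral>\<^sup>+g. (\<Sum>i<n. ennreal (\<bar>g i\<bar> powr p)) \<partial>gauss n)"
    by (rule nn_integral_sum[symmetric]) measurable
  also have "\<dots> \<le> (\<integral>\<^sup>+g. ennreal (real n powr (1 - p / 2)) * ennreal (L2_set g {..<n} powr p) \<partial>gauss n)"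
    using sum_powr_le_L2_set[of p n] p n
    by (intro nn_integral_mono) (simp add: sum_ennreal flip: ennreal_mult)
  also have "\<dots> = ennreal (real n powr (1 - p / 2)) * ennreal (gauss_norm_moment n p)"
    by (subst nn_integral_cmult) (simp_all add: nn_integral_gauss_norm p)
  also have "\<dots> = ennreal (real n powr (1 - p / 2) * gauss_norm_moment n p)"
    by (simp add: ennreal_mult')
  finally have le: "real n * abs_moment p \<le> real n powr (1 - p / 2) * gauss_norm_moment n p"
    by (subst (asm) ennreal_le_iff) (simp_all add: gauss_norm_moment_def)
  have "real n powr (1 - p / 2) * (abs_moment p * real n powr (p / 2)) = real n * abs_moment p"
    using n by (simp add: powr_diff)
  then have "real n powr (1 - p / 2) * (abs_moment p * real n powr (p / 2)) \<le> real n powr (1 - p / 2) * gauss_norm_moment n p"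
    using le by (simp only:)
  then show ?thesis
    using n by (simp add: mult_le_cancel_left_pos)
qed

text \<open>An auxiliary Gaussian \<open>h\<close> rewrites \<open>m\<close> times the distance
  power as the moment of \<open><h, \<sigma> g - \<tau> g'>\<close>. For fixed \<open>h\<close> this
  is a problem about two independent normal variables with value
  \<open>m * (\<sigma>\<^sup>2 + \<tau>\<^sup>2) powr (p / 2)\<close> times the power of the norm of
  \<open>h\<close>; integrating over \<open>h\<close> turns that power into the norm moment.\<close>

lemma nn_integral_gauss_dist:
  assumes p: "0 < p" "p < 2"
  shows "(\<integral>\<^sup>+g'. \<integral>\<^sup>+g. ennreal (dist2 n (scaled n \<sigma> g) (scaled n \<tau> g') powr p) \<partial>gauss n \<partial>gauss n) =
    ennreal ((\<sigma>\<^sup>2 + \<tau>\<^sup>2) powr (p / 2) * gauss_norm_moment n p)"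
proof -
  interpret pair_sigma_finite "gauss n" "gauss n" ..
  define m where "m = abs_moment p"
  have m: "0 < m"
    using abs_moment_pos[of p] p by (simp add: m_def)
  define S where "S h g = (\<Sum>i<n. h i * g i)" for h g :: "nat \<Rightarrow> real"
  have [measurable]: "(\<lambda>(h, g). S h g) \<in> borel_measurable (gauss n \<Otimes>\<^sub>M gauss n)"
    unfolding S_def by measurable
  have lin: "(\<integral>\<^sup>+g. F (S h g) \<partial>gauss n) = (\<integral>\<^sup>+z. F (L2_set h {..<n} * z) \<partial>std_gauss)"
    if "F \<in> borel_measurable borel" for F h
    unfolding S_def by (rule nn_integral_gauss_linear[OF that])
  have plane: "(\<integral>\<^sup>+g'. \<integral>\<^sup>+g. ennreal (\<bar>\<sigma> * S h g - \<tau> * S h g'\<bar> powr p) \<partial>gauss n \<partial>gauss n) =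
      ennreal (m * (\<sigma>\<^sup>2 + \<tau>\<^sup>2) powr (p / 2)) * ennreal (L2_set h {..<n} powr p)" for h
  proof -
    let ?L = "L2_set h {..<n}"
    have "(\<integral>\<^sup>+g'. \<integral>\<^sup>+g. ennreal (\<bar>\<sigma> * S h g - \<tau> * S h g'\<bar> powr p) \<partial>gauss n \<partial>gauss n) =
        (\<integral>\<^sup>+g'. \<integral>\<^sup>+z. ennreal (\<bar>\<sigma> * (?L * z) - \<tau> * S h g'\<bar> powr p) \<partial>std_gauss \<partial>gauss n)"
      by (intro nn_integral_cong lin[of "\<lambda>t. ennreal (\<bar>\<sigma> * t - \<tau> * c\<bar> powr p)" for c]) measurable
    also have "\<dots> = (\<integral>\<^sup>+w. \<integral>\<^sup>+z. ennreal (\<bar>\<sigma> * (?L * z) - \<tau> * (?L * w)\<bar> powr p) \<partial>std_gauss \<partial>std_gauss)"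
      by (rule lin[of "\<lambda>t. \<integral>\<^sup>+z. ennreal (\<bar>\<sigma> * (?L * z) - \<tau> * t\<bar> powr p) \<partial>std_gauss"]) measurable
    also have "\<dots> = (\<integral>\<^sup>+w. \<integral>\<^sup>+z. ennreal (\<bar>(- \<tau> * ?L) * w + (\<sigma> * ?L) * z\<bar> powr p) \<partial>std_gauss \<partial>std_gauss)"
      by (simp add: algebra_simps)
    also have "\<dots> = (\<integral>\<^sup>+z. ennreal (\<bar>sqrt ((- \<tau> * ?L)\<^sup>2 + (\<sigma> * ?L)\<^sup>2) * z\<bar> powr p) \<partial>std_gauss)"
      by (rule nn_integral_std_gauss_linear2[of "\<lambda>t. ennreal (\<bar>t\<bar> powr p)"]) measurable
    also have "sqrt ((- \<tau> * ?L)\<^sup>2 + (\<sigma> * ?L)\<^sup>2) = sqrt (\<sigma>\<^sup>2 + \<tau>\<^sup>2) * ?L"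
    proof -
      have "(- \<tau> * ?L)\<^sup>2 + (\<sigma> * ?L)\<^sup>2 = (\<sigma>\<^sup>2 + \<tau>\<^sup>2) * ?L\<^sup>2"
        by (simp add: power_mult_distrib algebra_simps)
      then show ?thesis
        by (simp add: real_sqrt_mult L2_set_nonneg)
    qed
    also have "(\<integral>\<^sup>+z. ennreal (\<bar>sqrt (\<sigma>\<^sup>2 + \<tau>\<^sup>2) * ?L * z\<bar> powr p) \<partial>std_gauss) =
        (\<integral>\<^sup>+z. ennreal ((\<sigma>\<^sup>2 + \<tau>\<^sup>2) powr (p / 2) * ?L powr p) * ennreal (\<bar>z\<bar> powr p) \<partial>std_gauss)"
    proof -
      have "\<bar>sqrt (\<sigma>\<^sup>2 + \<tau>\<^sup>2) * ?L * z\<bar> powr p = (\<sigma>\<^sup>2 + \<tau>\<^sup>2) powr (p / 2) * ?L powr p * \<bar>z\<bar> powr p" for z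
      proof -
        have "sqrt (\<sigma>\<^sup>2 + \<tau>\<^sup>2) powr p = (\<sigma>\<^sup>2 + \<tau>\<^sup>2) powr (p / 2)"
          by (simp add: powr_powr flip: powr_half_sqrt)
        then show ?thesis
          by (simp add: abs_mult powr_mult L2_set_nonneg)
      qed
      then show ?thesis
        by (simp add: ennreal_mult)
    qed
    also have "\<dots> = ennreal ((\<sigma>\<^sup>2 + \<tau>\<^sup>2) powr (p / 2) * ?L powr p) * ennreal m"
      using p by (simp add: nn_integral_cmult nn_integral_abs_moment m_def)
    also have "\<dots> = ennreal (m * (\<sigma>\<^sup>2 + \<tau>\<^sup>2) powr (p / 2)) * ennreal (?L powr p)"
      using m by (simp add: ac_simps flip: ennreal_mult)
    finally show ?thesis .
  qed
  have rep: "ennreal m * ennreal (dist2 n (scaled n \<sigma> g) (scaled n \<tau> g') powr p) =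
      (\<integral>\<^sup>+h. ennreal (\<bar>\<sigma> * S h g - \<tau> * S h g'\<bar> powr p) \<partial>gauss n)" for g g'
  proof -
    have "(\<Sum>i<n. (\<sigma> * g i - \<tau> * g' i) * h i) = \<sigma> * S h g - \<tau> * S h g'" for h
      by (simp add: S_def sum_distrib_left sum_subtractf algebra_simps)
    then show ?thesis
      using nn_integral_gauss_linear_powr[of p, where h = "\<lambda>i. \<sigma> * g i - \<tau> * g' i" and n = n] p m
      by (simp add: dist2_scaled m_def ennreal_mult)
  qed
  have [measurable]: "(\<lambda>(g', g). dist2 n (scaled n \<sigma> g) (scaled n \<tau> g')) \<in> borel_measurable (gauss n \<Otimes>\<^sub>M gauss n)"
    unfolding dist2_scaled L2_set_def by measurable
  have "ennreal m * (\<integral>\<^sup>+g'. \<integral>\<^sup>+g. ennreal (dist2 n (scaled n \<sigma> g) (scaled n \<tau> g') powr p) \<partial>gauss n \<partial>gauss n) =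
      (\<integral>\<^sup>+g'. \<integral>\<^sup>+g. \<integral>\<^sup>+h. ennreal (\<bar>\<sigma> * S h g - \<tau> * S h g'\<bar> powr p) \<partial>gauss n \<partial>gauss n \<partial>gauss n)"
    unfolding rep[symmetric]
    by (subst nn_integral_cmult[symmetric], measurable, rule nn_integral_cong, subst nn_integral_cmult[symmetric], measurable)
  also have "\<dots> = (\<integral>\<^sup>+g'. \<integral>\<^sup>+h. \<integral>\<^sup>+g. ennreal (\<bar>\<sigma> * S h g - \<tau> * S h g'\<bar> powr p) \<partial>gauss n \<partial>gauss n \<partial>gauss n)"
    by (intro nn_integral_cong Fubini') measurable
  also have "\<dots> = (\<integral>\<^sup>+h. \<integral>\<^sup>+g'. \<integral>\<^sup>+g. ennreal (\<bar>\<sigma> * S h g - \<tau> * S h g'\<bar> powr p) \<partial>gauss n \<partial>gauss n \<partial>gauss n)"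
    by (intro Fubini') measurable
  also have "\<dots> = (\<integral>\<^sup>+h. ennreal (m * (\<sigma>\<^sup>2 + \<tau>\<^sup>2) powr (p / 2)) * ennreal (L2_set h {..<n} powr p) \<partial>gauss n)"
    by (simp only: plane)
  also have "\<dots> = ennreal m * ennreal ((\<sigma>\<^sup>2 + \<tau>\<^sup>2) powr (p / 2) * gauss_norm_moment n p)"
    using p m by (simp add: nn_integral_cmult nn_integral_gauss_norm ennreal_mult' mult.assoc)
  finally show ?thesis
    using m by (simp add: ennreal_mult_cancel_left)
qed

subsection \<open>The lower bound\<close>

lemma sqrt_powr:
  fixes x r :: real
  assumes "0 \<le> x"
  shows "sqrt x powr r = x powr (r / 2)"
  using assms by (simp add: powr_powr flip: powr_half_sqrt)

text \<open>For \<open>q \<le> 2\<close> the Euclidean ball of radius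
  \<open>n powr (1 / 2 - 1 / q)\<close> is contained in the unit ball, by the power mean
  inequality.\<close>

lemma scaled_mem_lq_ballI:
  assumes q: "0 < q" "q \<le> 2" and n: "1 \<le> n" and le: "\<sigma>\<^sup>2 * (\<Sum>i<n. (g i)\<^sup>2) \<le> real n powr (1 - 2 / q)"
  shows "scaled n \<sigma> g \<in> lq_ball n q"
proof -
  have "(\<Sum>i<n. \<bar>\<sigma> * g i\<bar> powr q) \<le> real n powr (1 - q / 2) * L2_set (\<lambda>i. \<sigma> * g i) {..<n} powr q"
    using q n by (intro sum_powr_le_L2_set)
  also have "L2_set (\<lambda>i. \<sigma> * g i) {..<n} powr q = (\<sigma>\<^sup>2 * (\<Sum>i<n. (g i)\<^sup>2)) powr (q / 2)"
    by (simp add: L2_set_def power_mult_distrib sum_distrib_left[symmetric] sqrt_powr sum_nonneg)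
  also have "\<dots> \<le> (real n powr (1 - 2 / q)) powr (q / 2)"
    using q le by (intro powr_mono2) (auto simp: sum_nonneg)
  also have "real n powr (1 - q / 2) * (real n powr (1 - 2 / q)) powr (q / 2) = real n powr ((1 - q / 2) + (1 - 2 / q) * (q / 2))"
    by (simp add: powr_powr powr_add)
  also have "(1 - q / 2) + (1 - 2 / q) * (q / 2) = 0"
    using q by (simp add: field_simps)
  finally show ?thesis
    using n by (simp add: scaled_mem_lq_ball mult_left_mono)
qed

lemma truncated_eq_scaled:
  obtains \<sigma>' where "truncated n q \<sigma> g = scaled n \<sigma>' g" "\<sigma>'\<^sup>2 \<le> \<sigma>\<^sup>2"
proof (cases "scaled n \<sigma> g \<in> lq_ball n q")
  case True
  then show ?thesis
    by (intro that[of \<sigma>]) (auto simp: truncated_def)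
next
  case False
  then show ?thesis
    by (intro that[of 0]) (auto simp: truncated_def scaled_def)
qed

lemma dist2_scaled_powr_le:
  assumes p: "0 < p" and \<rho>: "\<sigma>\<^sup>2 \<le> \<rho>" "\<tau>\<^sup>2 \<le> \<rho>"
  shows "dist2 n (scaled n \<sigma> g) (scaled n \<tau> g') powr p \<le> (2 * \<rho> * ((\<Sum>i<n. (g i)\<^sup>2) + (\<Sum>i<n. (g' i)\<^sup>2))) powr (p / 2)"
proof -
  have "(\<Sum>i<n. (\<sigma> * g i - \<tau> * g' i)\<^sup>2) \<le> (\<Sum>i<n. 2 * \<rho> * ((g i)\<^sup>2 + (g' i)\<^sup>2))"
  proof (rule sum_mono)
    fix i
    have "(\<sigma> * g i - \<tau> * g' i)\<^sup>2 \<le> 2 * (\<sigma> * g i)\<^sup>2 + 2 * (\<tau> * g' i)\<^sup>2"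
      using zero_le_power2[of "\<sigma> * g i + \<tau> * g' i"] unfolding power2_sum power2_diff by linarith
    also have "\<dots> \<le> 2 * (\<rho> * (g i)\<^sup>2) + 2 * (\<rho> * (g' i)\<^sup>2)"
      unfolding power_mult_distrib using \<rho> by (intro add_mono mult_left_mono mult_right_mono) auto
    finally show "(\<sigma> * g i - \<tau> * g' i)\<^sup>2 \<le> 2 * \<rho> * ((g i)\<^sup>2 + (g' i)\<^sup>2)"
      by (simp add: algebra_simps)
  qed
  also have "\<dots> = 2 * \<rho> * ((\<Sum>i<n. (g i)\<^sup>2) + (\<Sum>i<n. (g' i)\<^sup>2))"
    by (simp only: sum.distrib[symmetric] sum_distrib_left)
  finally have "(\<Sum>i<n. (\<sigma> * g i - \<tau> * g' i)\<^sup>2) powr (p / 2) \<le> \<dots> powr (p / 2)"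
    using p by (intro powr_mono2) (auto simp: sum_nonneg)
  then show ?thesis
    by (simp add: dist2_scaled L2_set_def sqrt_powr sum_nonneg)
qed

text \<open>The distances differ only if a vector leaves the ball, which forces the total squared
  norm \<open>R\<close> above \<open>n / \<kappa>\<close>. Both distances are nonnegative and at
  most \<open>(2 * \<rho> * R) powr (p / 2)\<close>; this moderate growth is absorbed by
  \<open>exp (R / 4)\<close>, with \<open>exp (- n / (8 * \<kappa>))\<close> to spare.\<close>

lemma truncation_error_le:
  assumes q: "1 < q" "q \<le> 2" and p: "0 < p" "p < 2" and n: "1 \<le> n" and \<kappa>: "0 < \<kappa>" "\<kappa> \<le> 1 / 8"
    and \<sigma>: "\<sigma>\<^sup>2 \<le> \<kappa> * real n powr (- 2 / q)" and \<tau>: "\<tau>\<^sup>2 \<le> \<kappa> * real n powr (- 2 / q)"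
  shows "\<bar>dist2 n (truncated n q \<sigma> g) (truncated n q \<tau> g') powr p - dist2 n (scaled n \<sigma> g) (scaled n \<tau> g') powr p\<bar>
    \<le> 2 * real n powr (p / 2 - p / q) * exp (- real n / (8 * \<kappa>)) * (exp ((\<Sum>i<n. (g i)\<^sup>2) / 4) * exp ((\<Sum>i<n. (g' i)\<^sup>2) / 4))"
    (is "\<bar>?D1 - ?D0\<bar> \<le> ?rhs")
proof (cases "scaled n \<sigma> g \<in> lq_ball n q \<and> scaled n \<tau> g' \<in> lq_ball n q")
  case True
  then show ?thesis
    by (simp add: truncated_def)
next
  case False
  define R where "R = (\<Sum>i<n. (g i)\<^sup>2) + (\<Sum>i<n. (g' i)\<^sup>2)"
  define \<rho> where "\<rho> = \<kappa> * real n powr (- 2 / q)"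
  have out: "real n / \<kappa> < (\<Sum>i<n. (h i)\<^sup>2)" if "scaled n \<upsilon> h \<notin> lq_ball n q" "\<upsilon>\<^sup>2 \<le> \<rho>" for \<upsilon> h
  proof (rule ccontr)
    assume "\<not> real n / \<kappa> < (\<Sum>i<n. (h i)\<^sup>2)"
    then have "\<upsilon>\<^sup>2 * (\<Sum>i<n. (h i)\<^sup>2) \<le> \<rho> * (real n / \<kappa>)"
      using that(2) \<kappa> by (intro mult_mono) (auto simp: sum_nonneg \<rho>_def)
    also have "\<dots> = real n powr (1 - 2 / q)"
      using \<kappa> n by (simp add: \<rho>_def powr_diff powr_minus field_simps)
    finally show False
      using scaled_mem_lq_ballI[of q n \<upsilon> h] q n that(1) by auto
  qed
  have "real n / \<kappa> < R"
    using False out[of \<sigma> g] out[of \<tau> g'] \<sigma> \<tau> sum_nonneg[of "{..<n}" "\<lambda>i. (g i)\<^sup>2"] sum_nonneg[of "{..<n}" "\<lambda>i. (g' i)\<^sup>2"]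
    unfolding R_def \<rho>_def by (auto simp: add_strict_increasing add_strict_increasing2)
  define y where "y = \<kappa> * R / n"
  have y: "1 < y"
    using \<open>real n / \<kappa> < R\<close> n \<kappa> by (simp add: y_def field_simps)
  have R: "R = real n / \<kappa> * y"
    using n \<kappa> by (simp add: y_def)
  have "2 * \<rho> * R = real n powr (1 - 2 / q) * (2 * y)"
    using n \<kappa> by (simp add: R \<rho>_def powr_diff powr_minus field_simps)
  then have "(2 * \<rho> * R) powr (p / 2) = real n powr ((1 - 2 / q) * (p / 2)) * (2 * y) powr (p / 2)"
    using y by (simp only:) (simp add: powr_mult powr_powr)
  also have "(1 - 2 / q) * (p / 2) = p / 2 - p / q"
    by (simp add: field_simps)
  also have "(2 * y) powr (p / 2) \<le> (2 * y) powr 1"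
    using y p by (intro powr_mono) auto
  also have "(2 * y) powr 1 = 2 * y"
    using y by simp
  also have "2 * y \<le> 2 * exp y"
    using exp_ge_add_one_self[of y] by linarith
  \<comment> \<open>In terms of \<open>y\<close> the exponent on the right is
    \<open>n / \<kappa> * (y / 4 - 1 / 8)\<close>. As \<kappa> is at most \<open>1 / 8\<close>, it
    is at least \<open>2 * y - 1\<close>, which exceeds \<open>y\<close> for
    \<open>y > 1\<close>.\<close>
  also have "exp y \<le> exp (- real n / (8 * \<kappa>) + R / 4)"
  proof -
    have "8 \<le> real n / \<kappa>"
      using \<kappa> n by (simp add: pos_le_divide_eq)
    then have "8 * (y / 4 - 1 / 8) \<le> real n / \<kappa> * (y / 4 - 1 / 8)"
      using y by (intro mult_right_mono) auto
    also have "\<dots> = - real n / (8 * \<kappa>) + R / 4"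
      by (simp add: R algebra_simps)
    finally show ?thesis
      using y by simp
  qed
  also have "exp (- real n / (8 * \<kappa>) + R / 4) = exp (- real n / (8 * \<kappa>)) * (exp ((\<Sum>i<n. (g i)\<^sup>2) / 4) * exp ((\<Sum>i<n. (g' i)\<^sup>2) / 4))"
    by (simp only: R_def add_divide_distrib exp_add)
  finally have bound: "(2 * \<rho> * R) powr (p / 2) \<le> ?rhs"
    by (simp add: mult_left_mono mult.assoc mult.left_commute[of _ 2])
  obtain \<sigma>' \<tau>' where tr: "truncated n q \<sigma> g = scaled n \<sigma>' g" "\<sigma>'\<^sup>2 \<le> \<sigma>\<^sup>2" "truncated n q \<tau> g' = scaled n \<tau>' g'" "\<tau>'\<^sup>2 \<le> \<tau>\<^sup>2"
    using truncated_eq_scaled[of n q \<sigma> g] truncated_eq_scaled[of n q \<tau> g'] by metis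
  have "?D0 \<le> (2 * \<rho> * R) powr (p / 2)" "?D1 \<le> (2 * \<rho> * R) powr (p / 2)"
    unfolding tr(1,3) R_def using p \<sigma> \<tau> tr(2,4)
    by (intro dist2_scaled_powr_le; simp add: \<rho>_def)+
  moreover have "0 \<le> ?D0" "0 \<le> ?D1"
    by simp_all
  ultimately show ?thesis
    using bound by linarith
qed

text \<open>A crude estimate from coordinates in \<open>[- 1, 1]\<close>. It serves only to make the
  kernel bounded, hence integrable, on the ball and has no influence on the asymptotic
  order.\<close>

lemma dist2_lq_ball_powr_le:
  assumes q: "0 < q" and p: "0 < p" and x: "x \<in> lq_ball n q" and y: "y \<in> lq_ball n q"
  shows "dist2 n x y powr p \<le> (4 * real n) powr (p / 2)"
proof -
  have coord: "\<bar>z i\<bar> \<le> 1" if "z \<in> lq_ball n q" "i < n" for z i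
  proof (rule ccontr)
    assume "\<not> \<bar>z i\<bar> \<le> 1"
    then have "1 < \<bar>z i\<bar> powr q"
      using q by simp
    also have "\<dots> \<le> (\<Sum>i<n. \<bar>z i\<bar> powr q)"
      using that(2) by (intro member_le_sum) auto
    finally show False
      using that(1) by (simp add: mem_lq_ball)
  qed
  have "(\<Sum>i<n. (x i - y i)\<^sup>2) \<le> (\<Sum>i<n. 4)"
  proof (rule sum_mono)
    fix i assume "i \<in> {..<n}"
    then have "\<bar>x i - y i\<bar> \<le> 2"
      using coord[OF x, of i] coord[OF y, of i] by auto
    then show "(x i - y i)\<^sup>2 \<le> 4"
      using abs_le_square_iff[of "x i - y i" 2] by simp
  qed
  then have "(\<Sum>i<n. (x i - y i)\<^sup>2) powr (p / 2) \<le> (4 * real n) powr (p / 2)"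
    using p by (intro powr_mono2) (auto simp: sum_nonneg mult.commute)
  then show ?thesis
    by (simp add: dist2_def L2_set_def sqrt_powr sum_nonneg)
qed

text \<open>The pointwise error bound is a product of functions of the two independent vectors, and
  each factor integrates to \<open>sqrt 2 ^ n\<close>.\<close>

lemma truncated_dist_integral:
  assumes q: "1 < q" "q \<le> 2" and p: "0 < p" "p < 2" and n: "1 \<le> n" and \<kappa>: "0 < \<kappa>" "\<kappa> \<le> 1 / 8"
    and \<sigma>: "\<sigma>\<^sup>2 \<le> \<kappa> * real n powr (- 2 / q)" and \<tau>: "\<tau>\<^sup>2 \<le> \<kappa> * real n powr (- 2 / q)"
  shows "\<bar>(\<integral>g'. \<integral>g. dist2 n (truncated n q \<sigma> g) (truncated n q \<tau> g') powr p \<partial>gauss n \<partial>gauss n)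
      - (\<sigma>\<^sup>2 + \<tau>\<^sup>2) powr (p / 2) * gauss_norm_moment n p\<bar> \<le> 2 * real n powr (p / 2 - p / q) * exp (- real n / (8 * \<kappa>)) * 2 ^ n"
proof -
  interpret G: pair_prob_space "gauss n" "gauss n" ..
  let ?G = "gauss n \<Otimes>\<^sub>M gauss n"
  define D0 where "D0 = (\<lambda>(g', g). dist2 n (scaled n \<sigma> g) (scaled n \<tau> g') powr p)"
  define D1 where "D1 = (\<lambda>(g', g). dist2 n (truncated n q \<sigma> g) (truncated n q \<tau> g') powr p)"
  define X where "X = (\<lambda>(g', g). exp ((\<Sum>i<n. (g i :: real)\<^sup>2) / 4) * exp ((\<Sum>i<n. (g' i)\<^sup>2) / 4))"
  define e where "e = 2 * real n powr (p / 2 - p / q) * exp (- real n / (8 * \<kappa>))"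
  have D0_nonneg: "0 \<le> D0 z" for z
    by (simp add: D0_def case_prod_beta)
  have [measurable]: "D0 \<in> borel_measurable ?G"
    unfolding D0_def dist2_scaled L2_set_def by measurable
  have [measurable]: "(\<lambda>g. truncated n q \<upsilon> g i) \<in> borel_measurable (gauss n)" for \<upsilon> i
    using measurable_compose[OF measurable_truncated borel_measurable_coordinate] .
  have [measurable]: "D1 \<in> borel_measurable ?G"
    unfolding D1_def dist2_def L2_set_def by measurable
  have [measurable]: "X \<in> borel_measurable ?G"
    unfolding X_def by measurable
  have X: "has_bochner_integral ?G X (2 ^ n)"
  proof (rule has_bochner_integral_nn_integral)
    have "(\<integral>\<^sup>+z. ennreal (X z) \<partial>?G) = (\<integral>\<^sup>+g'. \<integral>\<^sup>+g. ennreal (X (g', g)) \<partial>gauss n \<partial>gauss n)"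
      by (rule gauss.nn_integral_fst[symmetric]) measurable
    also have "\<dots> = (\<integral>\<^sup>+g'. \<integral>\<^sup>+g. ennreal (exp ((\<Sum>i<n. (g i)\<^sup>2) / 4)) * ennreal (exp ((\<Sum>i<n. (g' i)\<^sup>2) / 4)) \<partial>gauss n \<partial>gauss n)"
      by (simp add: X_def ennreal_mult)
    also have "\<dots> = ennreal (sqrt 2 ^ n) * ennreal (sqrt 2 ^ n)"
      by (simp add: nn_integral_multc nn_integral_cmult nn_integral_gauss_exp_square)
    also have "\<dots> = ennreal (2 ^ n)"
      by (simp flip: ennreal_mult power_mult_distrib)
    finally show "(\<integral>\<^sup>+z. ennreal (X z) \<partial>?G) = ennreal (2 ^ n)" .
  qed (auto simp: X_def)
  have D0: "has_bochner_integral ?G D0 ((\<sigma>\<^sup>2 + \<tau>\<^sup>2) powr (p / 2) * gauss_norm_moment n p)"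
  proof (rule has_bochner_integral_nn_integral)
    have "(\<integral>\<^sup>+z. ennreal (D0 z) \<partial>?G) = (\<integral>\<^sup>+g'. \<integral>\<^sup>+g. ennreal (D0 (g', g)) \<partial>gauss n \<partial>gauss n)"
      by (rule gauss.nn_integral_fst[symmetric]) measurable
    then show "(\<integral>\<^sup>+z. ennreal (D0 z) \<partial>?G) = ennreal ((\<sigma>\<^sup>2 + \<tau>\<^sup>2) powr (p / 2) * gauss_norm_moment n p)"
      using nn_integral_gauss_dist[OF p, of n \<sigma> \<tau>] by (simp add: D0_def)
  qed (simp_all add: gauss_norm_moment_def D0_nonneg)
  have D1: "integrable ?G D1"
  proof (rule G.P.integrable_const_bound[where B = "(4 * real n) powr (p / 2)"])
    show "AE z in ?G. norm (D1 z) \<le> (4 * real n) powr (p / 2)"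
      using q p dist2_lq_ball_powr_le[of q p _ n] truncated_mem_lq_ball
      by (intro AE_I2) (simp add: D1_def case_prod_beta)
  qed measurable
  have err: "\<bar>D1 z - D0 z\<bar> \<le> e * X z" for z
    unfolding D1_def D0_def X_def e_def case_prod_beta
    by (rule truncation_error_le) fact+
  have "\<bar>(\<integral>z. D1 z \<partial>?G) - (\<integral>z. D0 z \<partial>?G)\<bar> = \<bar>\<integral>z. D1 z - D0 z \<partial>?G\<bar>"
    using D1 D0 by (simp add: has_bochner_integral_iff)
  also have "\<dots> \<le> (\<integral>z. \<bar>D1 z - D0 z\<bar> \<partial>?G)"
    by (rule integral_abs_bound)
  also have "\<dots> \<le> (\<integral>z. e * X z \<partial>?G)"
    using D1 D0 X by (intro integral_mono err) (auto simp: has_bochner_integral_iff)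
  also have "\<dots> = e * 2 ^ n"
    using X by (simp add: has_bochner_integral_iff)
  finally have "\<bar>(\<integral>z. D1 z \<partial>?G) - (\<integral>z. D0 z \<partial>?G)\<bar> \<le> e * 2 ^ n" .
  moreover have "(\<integral>z. D0 z \<partial>?G) = (\<sigma>\<^sup>2 + \<tau>\<^sup>2) powr (p / 2) * gauss_norm_moment n p"
    using D0 by (rule has_bochner_integral_integral_eq)
  moreover have "(\<integral>z. D1 z \<partial>?G) = (\<integral>g'. \<integral>g. dist2 n (truncated n q \<sigma> g) (truncated n q \<tau> g') powr p \<partial>gauss n \<partial>gauss n)"
    using G.integral_fst'[OF D1] by (simp add: D1_def)
  ultimately show ?thesis
    by (simp add: e_def)
qed

lemma signed_integral_cong:
  assumes "\<And>x. x \<in> space M \<Longrightarrow> f x = g x"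
  shows "signed_integral M \<mu> f = signed_integral M \<mu> g"
  unfolding signed_integral_def using assms
  by (intro arg_cong2[where f = "(-)"] Bochner_Integration.integral_cong) auto

text \<open>Bilinearity of the energy, by expanding the inner and the outer signed integral. The
  expansion needs bounded integrands, and the inner formula is available only for points of the
  ball.\<close>

lemma energy_truncated_combination:
  fixes a \<sigma> :: "nat \<Rightarrow> real" and n :: nat
  assumes q: "0 < q" and p: "0 < p" and fin: "finite I" and one: "(\<Sum>k\<in>I. a k) = 1"
  defines "M \<equiv> restrict_space borel (lq_ball n q)"
  defines "\<mu> \<equiv> \<lambda>B. \<Sum>k\<in>I. a k * measure (distr (gauss n) M (truncated n q (\<sigma> k))) B"
  shows "\<mu> \<in> signed_measures_mass1 (lq_ball n q)"
    and "energy n p (lq_ball n q) \<mu> = (\<Sum>l\<in>I. \<Sum>k\<in>I. a l * a k *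
      (\<integral>g'. \<integral>g. dist2 n (truncated n q (\<sigma> k) g) (truncated n q (\<sigma> l) g') powr p \<partial>gauss n \<partial>gauss n))"
proof -
  define L where "L k = distr (gauss n) M (truncated n q (\<sigma> k))" for k
  have T [measurable]: "truncated n q (\<sigma> k) \<in> gauss n \<rightarrow>\<^sub>M M" for k
    unfolding M_def by measurable
  have L: "prob_space (L k)" for k
    unfolding L_def by (rule gauss.prob_space_distr[OF T])
  interpret L: prob_space "L k" for k
    by (rule L)
  have finL: "finite_measure (L k)" for k
    by (rule L.finite_measure_axioms)
  have sets [simp, measurable_cong]: "sets (L k) = sets M" for k
    by (simp add: L_def)
  have spM: "space M = lq_ball n q" and [simp]: "space (L k) = lq_ball n q" for k
    by (simp_all add: M_def L_def space_restrict_space)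
  have "finite_signed_measure M \<mu>"
    unfolding \<mu>_def L_def[symmetric] by (rule finite_signed_measure_combination[OF fin finL sets])
  moreover have "\<mu> (lq_ball n q) = 1"
    using L.prob_space one by (simp add: \<mu>_def flip: L_def)
  ultimately show "\<mu> \<in> signed_measures_mass1 (lq_ball n q)"
    by (simp add: signed_measures_mass1_def M_def)
  define D where "D x y = dist2 n x y powr p" for x y
  define C where "C = (4 * real n) powr (p / 2)"
  have D: "\<bar>D x y\<bar> \<le> C" if "x \<in> lq_ball n q" "y \<in> lq_ball n q" for x y
    using dist2_lq_ball_powr_le[OF q p that] by (simp add: D_def C_def)
  have [measurable]: "(\<lambda>(x, y). D x y) \<in> borel_measurable (M \<Otimes>\<^sub>M M)"
    unfolding D_def dist2_def L2_set_def M_def by measurable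
  have [measurable]: "(\<lambda>x. D x y) \<in> borel_measurable M" for y
    unfolding D_def dist2_def L2_set_def M_def by measurable
  have inner: "signed_integral M \<mu> (\<lambda>x. D x y) = (\<Sum>k\<in>I. a k * (\<integral>x. D x y \<partial>L k))" if "y \<in> space M" for y
    unfolding \<mu>_def L_def[symmetric] using that D
    by (intro signed_integral_combination[OF fin finL sets, where C = C]) (auto simp: spM)
  have meas [measurable]: "(\<lambda>y. \<integral>x. D x y \<partial>L k) \<in> borel_measurable M" for k
    by measurable
  have bound: "\<bar>\<integral>x. D x y \<partial>L k\<bar> \<le> C" if "y \<in> lq_ball n q" for y k
  proof -
    have "integrable (L k) (\<lambda>x. D x y)"
      using D that by (intro L.integrable_const_bound[where B = C] AE_I2) auto
    then have "\<bar>\<integral>x. D x y \<partial>L k\<bar> \<le> (\<integral>x. C \<partial>L k)"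
      using D that by (intro order_trans[OF integral_abs_bound] integral_mono) auto
    then show ?thesis
      using L.prob_space by simp
  qed
  have "energy n p (lq_ball n q) \<mu> = signed_integral M \<mu> (\<lambda>y. signed_integral M \<mu> (\<lambda>x. D x y))"
    by (simp add: energy_def M_def D_def)
  also have "\<dots> = signed_integral M \<mu> (\<lambda>y. \<Sum>k\<in>I. a k * (\<integral>x. D x y \<partial>L k))"
    by (rule signed_integral_cong) (rule inner)
  also have "\<dots> = (\<Sum>l\<in>I. a l * (\<integral>y. (\<Sum>k\<in>I. a k * (\<integral>x. D x y \<partial>L k)) \<partial>L l))"
    unfolding \<mu>_def L_def[symmetric]
  proof (rule signed_integral_combination[OF fin finL sets, where C = "\<Sum>k\<in>I. \<bar>a k\<bar> * C"])
    show "\<bar>\<Sum>k\<in>I. a k * (\<integral>x. D x y \<partial>L k)\<bar> \<le> (\<Sum>k\<in>I. \<bar>a k\<bar> * C)" if "y \<in> space M" for y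
      using that bound by (intro order_trans[OF sum_abs] sum_mono) (auto simp: abs_mult spM intro!: mult_left_mono)
  qed measurable
  also have "\<dots> = (\<Sum>l\<in>I. \<Sum>k\<in>I. a l * a k * (\<integral>y. \<integral>x. D x y \<partial>L k \<partial>L l))"
  proof (rule sum.cong[OF refl])
    fix l
    have "integrable (L l) (\<lambda>y. \<integral>x. D x y \<partial>L k)" for k
      using bound by (intro L.integrable_const_bound[where B = C] AE_I2) auto
    then have "(\<integral>y. (\<Sum>k\<in>I. a k * (\<integral>x. D x y \<partial>L k)) \<partial>L l) = (\<Sum>k\<in>I. a k * (\<integral>y. \<integral>x. D x y \<partial>L k \<partial>L l))"
      by simp
    then show "a l * (\<integral>y. (\<Sum>k\<in>I. a k * (\<integral>x. D x y \<partial>L k)) \<partial>L l) = (\<Sum>k\<in>I. a l * a k * (\<integral>y. \<integral>x. D x y \<partial>L k \<partial>L l))"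
      by (simp add: sum_distrib_left mult.assoc)
  qed
  finally have energy: "energy n p (lq_ball n q) \<mu> = (\<Sum>l\<in>I. \<Sum>k\<in>I. a l * a k * (\<integral>y. \<integral>x. D x y \<partial>L k \<partial>L l))" .
  have entry: "(\<integral>y. \<integral>x. D x y \<partial>L k \<partial>L l) =
      (\<integral>g'. \<integral>g. D (truncated n q (\<sigma> k) g) (truncated n q (\<sigma> l) g') \<partial>gauss n \<partial>gauss n)" for k l
  proof -
    have "(\<integral>y. \<integral>x. D x y \<partial>L k \<partial>L l) = (\<integral>g'. \<integral>x. D x (truncated n q (\<sigma> l) g') \<partial>L k \<partial>gauss n)"
      unfolding L_def[of l] by (rule integral_distr[OF T meas])
    also have "\<dots> = (\<integral>g'. \<integral>g. D (truncated n q (\<sigma> k) g) (truncated n q (\<sigma> l) g') \<partial>gauss n \<partial>gauss n)"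
      unfolding L_def[of k] by (subst integral_distr[OF T]) simp_all
    finally show ?thesis .
  qed
  show "energy n p (lq_ball n q) \<mu> = (\<Sum>l\<in>I. \<Sum>k\<in>I. a l * a k *
      (\<integral>g'. \<integral>g. dist2 n (truncated n q (\<sigma> k) g) (truncated n q (\<sigma> l) g') powr p \<partial>gauss n \<partial>gauss n))"
    unfolding energy entry unfolding D_def ..
qed

lemma energy_lower_bound:
  assumes q: "1 < q" "q \<le> 2" and r: "1 / q + 1 / r = 1" and p: "0 < p" "p < 2"
  obtains A where "0 < A"
    and "\<And>n. 1 \<le> n \<Longrightarrow> \<exists>\<mu>\<in>signed_measures_mass1 (lq_ball n q). A * real n powr (p / r) \<le> energy n p (lq_ball n q) \<mu>"
proof -
  have exponent: "p / r = p - p / q"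
  proof -
    have "1 / r = 1 - 1 / q"
      using r by simp
    then have "p * (1 / r) = p * (1 - 1 / q)"
      by simp
    then show ?thesis
      by (simp add: algebra_simps)
  qed
  obtain c where c: "0 < c" and cheb: "\<And>n a. 1 \<le> n \<Longrightarrow> (\<And>\<phi>. (\<Sum>k\<le>n. a k * ((cos \<phi>)\<^sup>2) ^ k) = cos (2 * real n * \<phi>)) \<Longrightarrow>
      c * real n powr (2 * (p / 2)) \<le> (\<Sum>k\<le>n. \<Sum>l\<le>n. a k * a l * (real k + real l) powr (p / 2))"
    using chebyshev_weights_energy[of "p / 2"] p by auto
  define m where "m = abs_moment p"
  have m: "0 < m"
    using abs_moment_pos[of p] p by (simp add: m_def)
  text \<open>The truncation error carries the factor \<open>(2 * 49 * exp (- u)) ^ n\<close>, where \<open>\<kappa> = 1 / (8 * u)\<close>,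
    while the main term only loses \<open>\<kappa> powr (p / 2)\<close>.\<close>
  define u where "u = 98 + 6272 / (m * c)"
  define \<kappa> where "\<kappa> = 1 / (8 * u)"
  \<comment> \<open>The summand 98 yields \<open>\<epsilon> \<le> 1\<close>, so that
    \<open>\<epsilon> ^ n \<le> \<epsilon>\<close> for \<open>n \<ge> 1\<close>, and it also keeps
    \<kappa> below \<open>1 / 8\<close>.\<close>
  have u: "98 \<le> u" "6272 / (m * c) \<le> u"
    using m c by (simp_all add: u_def)
  have \<kappa>: "0 < \<kappa>" "\<kappa> \<le> 1 / 8" "1 / (8 * \<kappa>) = u"
    using u by (simp_all add: \<kappa>_def divide_le_eq)
  define \<epsilon> where "\<epsilon> = 98 * exp (- u)"
  have "98 \<le> exp u"
    using exp_ge_add_one_self[of u] u(1) by linarith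
  then have \<epsilon>: "0 \<le> \<epsilon>" "\<epsilon> \<le> 1"
    using \<open>98 \<le> exp u\<close> by (simp_all add: \<epsilon>_def exp_minus field_simps)
  \<comment> \<open>The quadratic bound on \<open>exp u\<close> gives
    \<open>2 * \<epsilon> \<le> 392 / u\<^sup>2\<close>. Because \<open>6272 = 16 * 392\<close>, one
    factor \<open>392 / u\<close> is at most \<open>m * c / 16\<close>; the remaining
    \<open>1 / u\<close> is \<open>8 * \<kappa>\<close>, and
    \<open>\<kappa> \<le> \<kappa> powr (p / 2)\<close>.\<close>
  have small: "2 * \<epsilon> \<le> \<kappa> powr (p / 2) * m * c / 2"
  proof -
    have "u\<^sup>2 / 2 \<le> exp u"
      using exp_lower_Taylor_quadratic[of u] u by linarith
    then have "exp (- u) \<le> 2 / u\<^sup>2"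
      using u by (simp add: exp_minus field_simps)
    then have "2 * \<epsilon> \<le> 392 / u\<^sup>2"
      by (simp add: \<epsilon>_def)
    also have "\<dots> = 392 / u * (1 / u)"
      by (simp add: power2_eq_square)
    also have "392 / u * (1 / u) \<le> m * c / 16 * (1 / u)"
    proof (rule mult_right_mono)
      show "392 / u \<le> m * c / 16"
        using u m c by (simp add: field_simps)
    qed (use u in auto)
    also have "m * c / 16 * (1 / u) = \<kappa> powr 1 * m * c / 2"
      using u by (simp add: \<kappa>_def)
    also have "\<dots> \<le> \<kappa> powr (p / 2) * m * c / 2"
      using \<kappa> p m c by (intro divide_right_mono mult_right_mono powr_mono') auto
    finally show ?thesis .
  qed
  have "\<exists>\<mu>\<in>signed_measures_mass1 (lq_ball n q). \<kappa> powr (p / 2) * m * c / 2 * real n powr (p / r) \<le> energy n p (lq_ball n q) \<mu>"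
    if n: "1 \<le> n" for n
  proof -
    obtain a where a: "\<And>\<theta>. (\<Sum>k\<le>n. a k * ((cos \<theta>)\<^sup>2) ^ k) = cos (2 * real n * \<theta>)" and a7: "(\<Sum>k\<le>n. \<bar>a k\<bar>) \<le> 7 ^ n"
      using chebyshev_weights by blast
    have one: "(\<Sum>k\<le>n. a k) = 1"
      using a[of 0] by simp
    \<comment> \<open>The largest variance, at \<open>k = n\<close>, is
      \<open>\<kappa> * n powr (- 2 / q)\<close>. The typical Euclidean norm is then the square root
      of \<kappa> times the radius \<open>n powr (1 / 2 - 1 / q)\<close> of the Euclidean ball
      inside the unit ball.\<close>
    define v where "v = \<kappa> * real n powr (- 1 - 2 / q)"
    have v: "0 < v"
      using \<kappa> n by (simp add: v_def)
    define \<sigma> where "\<sigma> k = sqrt (v * real k)" for k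
    have \<sigma>2: "(\<sigma> k)\<^sup>2 = v * real k" for k
      using v by (simp add: \<sigma>_def)
    have \<sigma>: "(\<sigma> k)\<^sup>2 \<le> \<kappa> * real n powr (- 2 / q)" if "k \<le> n" for k
    proof -
      have "(\<sigma> k)\<^sup>2 \<le> v * real n"
        using that v by (simp add: \<sigma>2)
      also have "\<dots> = \<kappa> * real n powr (- 2 / q)"
        using n powr_add[of "real n" "- 1 - 2 / q" 1] by (simp add: v_def)
      finally show ?thesis .
    qed
    define \<mu> where "\<mu> = (\<lambda>B. \<Sum>k\<in>{..n}. a k * measure (distr (gauss n) (restrict_space borel (lq_ball n q)) (truncated n q (\<sigma> k))) B)"
    define E where "E k l = (\<integral>g'. \<integral>g. dist2 n (truncated n q (\<sigma> k) g) (truncated n q (\<sigma> l) g') powr p \<partial>gauss n \<partial>gauss n)" for k l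
    define N where "N = gauss_norm_moment n p"
    define e where "e = 2 * real n powr (p / 2 - p / q) * exp (- real n / (8 * \<kappa>)) * 2 ^ n"
    have q0: "0 < q"
      using q by simp
    note comb = energy_truncated_combination[OF q0 p(1) finite_atMost one, where n = n and \<sigma> = \<sigma>, folded \<mu>_def E_def]
    have err: "\<bar>E k l - (v * (real k + real l)) powr (p / 2) * N\<bar> \<le> e" if "k \<le> n" "l \<le> n" for k l
      using truncated_dist_integral[OF q p n \<kappa>(1,2) \<sigma>[OF that(1)] \<sigma>[OF that(2)]]
      by (simp add: E_def N_def e_def \<sigma>2 distrib_left)
    have "(\<Sum>l\<le>n. \<Sum>k\<le>n. a l * a k * ((v * (real k + real l)) powr (p / 2) * N)) - energy n p (lq_ball n q) \<mu>
        = (\<Sum>l\<le>n. \<Sum>k\<le>n. a l * a k * ((v * (real k + real l)) powr (p / 2) * N - E k l))"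
      unfolding comb(2) by (simp add: sum_subtractf right_diff_distrib)
    also have "\<dots> \<le> (\<Sum>l\<le>n. \<Sum>k\<le>n. \<bar>a l\<bar> * \<bar>a k\<bar> * e)"
    proof (intro sum_mono)
      fix k l assume "k \<in> {..n}" "l \<in> {..n}"
      then have "\<bar>(v * (real k + real l)) powr (p / 2) * N - E k l\<bar> \<le> e"
        using err[of k l] by (simp add: abs_minus_commute)
      then have "\<bar>a l * a k\<bar> * \<bar>(v * (real k + real l)) powr (p / 2) * N - E k l\<bar> \<le> \<bar>a l * a k\<bar> * e"
        by (intro mult_left_mono) auto
      then show "a l * a k * ((v * (real k + real l)) powr (p / 2) * N - E k l) \<le> \<bar>a l\<bar> * \<bar>a k\<bar> * e"
        using abs_ge_self[of "a l * a k * ((v * (real k + real l)) powr (p / 2) * N - E k l)"]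
        by (simp add: abs_mult)
    qed
    also have "\<dots> = (\<Sum>k\<le>n. \<bar>a k\<bar>) * (\<Sum>k\<le>n. \<bar>a k\<bar>) * e"
      unfolding sum_product unfolding sum_distrib_right ..
    also have "\<dots> \<le> 7 ^ n * 7 ^ n * e"
      using a7 by (intro mult_right_mono mult_mono) (auto simp: e_def sum_nonneg)
    also have "\<dots> = 2 * real n powr (p / 2 - p / q) * \<epsilon> ^ n"
    proof -
      have "- real n / (8 * \<kappa>) = real n * (- u)"
        unfolding \<kappa>(3)[symmetric] by simp
      then have "exp (- real n / (8 * \<kappa>)) = exp (- u) ^ n"
        by (simp only: exp_of_nat_mult)
      moreover have "(98 :: real) ^ n = 7 ^ n * 7 ^ n * 2 ^ n"
        by (simp flip: power_mult_distrib)
      ultimately show ?thesis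
        by (simp add: e_def \<epsilon>_def power_mult_distrib)
    qed
    also have "\<dots> \<le> 2 * real n powr (p / r) * \<epsilon>"
    proof (intro mult_mono)
      show "real n powr (p / 2 - p / q) \<le> real n powr (p / r)"
        using n p by (intro powr_mono) (auto simp: exponent)
      show "\<epsilon> ^ n \<le> \<epsilon>"
        using \<epsilon> n power_decreasing[of 1 n \<epsilon>] by simp
    qed (use \<epsilon> in auto)
    also have "\<dots> \<le> \<kappa> powr (p / 2) * m * c / 2 * real n powr (p / r)"
      using mult_right_mono[OF small, of "real n powr (p / r)"] by (simp add: ac_simps)
    finally have upper: "(\<Sum>l\<le>n. \<Sum>k\<le>n. a l * a k * ((v * (real k + real l)) powr (p / 2) * N)) - energy n p (lq_ball n q) \<mu>
        \<le> \<kappa> powr (p / 2) * m * c / 2 * real n powr (p / r)" .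
    \<comment> \<open>Balance of exponents: \<open>- p / 2 - p / q\<close> from the variances,
      \<open>p / 2\<close> from the norm of the Gaussian vector and \<open>p\<close> from the
      Chebyshev weights add up to \<open>p - p / q = p / r\<close>.\<close>
    have "\<kappa> powr (p / 2) * m * c * real n powr (p / r) = v powr (p / 2) * (m * real n powr (p / 2)) * (c * real n powr (2 * (p / 2)))"
    proof -
      have "v powr (p / 2) = \<kappa> powr (p / 2) * real n powr ((- 1 - 2 / q) * (p / 2))"
        using \<kappa> by (simp add: v_def powr_mult powr_powr)
      moreover have "p / r = (- 1 - 2 / q) * (p / 2) + p / 2 + 2 * (p / 2)"
        using q0 by (simp add: exponent field_simps)
      ultimately show ?thesis
        by (simp only: powr_add) simp
    qed
    also have "\<dots> \<le> v powr (p / 2) * N * (\<Sum>k\<le>n. \<Sum>l\<le>n. a k * a l * (real k + real l) powr (p / 2))"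
      using cheb[OF n a] gauss_norm_moment_ge[OF p n] v m c
      by (intro mult_mono) (auto simp: N_def m_def gauss_norm_moment_def)
    also have "\<dots> = (\<Sum>l\<le>n. \<Sum>k\<le>n. a l * a k * ((v * (real k + real l)) powr (p / 2) * N))"
      using v by (simp add: sum_distrib_left powr_mult ac_simps)
    finally have "\<kappa> powr (p / 2) * m * c / 2 * real n powr (p / r) \<le> energy n p (lq_ball n q) \<mu>"
      using upper by simp
    then show ?thesis
      using comb(1) by blast
  qed
  then show ?thesis
    using \<kappa> m c by (intro that[of "\<kappa> powr (p / 2) * m * c / 2"]) auto
qed

text \<open>In dimension 0 all distances vanish, and so do both bounds because
  \<open>0 powr x = 0\<close>. An admissible measure still has to be exhibited: the supremum over
  the empty set would be minus infinity.\<close>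

lemma M_const_zero: "M_const 0 p (lq_ball 0 q) = 0"
proof -
  have "energy 0 p (lq_ball 0 q) \<mu> = 0" for \<mu>
    by (simp add: energy_def signed_integral_def dist2_def)
  moreover have "signed_measures_mass1 (lq_ball 0 q) \<noteq> {}"
  proof -
    let ?M = "restrict_space borel (lq_ball 0 q)"
    \<comment> \<open>The point mass at the origin, written as a combination with one term so that
      \<open>finite_signed_measure_combination\<close> applies.\<close>
    have "(\<lambda>B. \<Sum>k\<in>{()}. 1 * measure (return ?M (\<lambda>_. 0)) B) \<in> signed_measures_mass1 (lq_ball 0 q)"
      unfolding signed_measures_mass1_def
    proof (intro CollectI conjI)
      show "finite_signed_measure ?M (\<lambda>B. \<Sum>k\<in>{()}. 1 * measure (return ?M (\<lambda>_. 0)) B)"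
      proof (rule finite_signed_measure_combination)
        interpret prob_space "return ?M (\<lambda>_. 0)"
          by (rule prob_space_return) (simp add: space_restrict_space zero_mem_lq_ball)
        show "finite_measure (return ?M (\<lambda>_. 0))"
          by (rule finite_measure_axioms)
      qed simp_all
      have "lq_ball 0 q \<in> sets ?M"
        using sets.top[of ?M] by (simp add: space_restrict_space)
      then show "(\<Sum>k\<in>{()}. 1 * measure (return ?M (\<lambda>_. 0)) (lq_ball 0 q)) = 1"
        by (simp add: measure_return zero_mem_lq_ball)
    qed
    then show ?thesis
      by blast
  qed
  ultimately show ?thesis
    by (simp add: M_const_def zero_ereal_def)
qed

theorem theorem2p11:
  fixes p q q' :: real
  assumes "1 < q" and "q \<le> 2"
    and "0 < p" and "p < 2"
    and "1 / q + 1 / q' = 1"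
  shows "\<exists>A>0. \<exists>B>0. \<forall>n::nat.
           ereal (A * real n powr (p / q')) \<le> M_const n p (lq_ball n q) \<and>
           M_const n p (lq_ball n q) \<le> ereal (B * real n powr (p / q'))"
proof -
  have "1 < q'"
  proof -
    have "1 / q' = 1 - 1 / q"
      using assms(5) by linarith
    then have "0 < 1 / q'" "1 / q' < 1"
      using assms(1) by simp_all
    then show ?thesis
      by (auto simp: zero_less_divide_iff divide_less_eq_1)
  qed
  obtain A where A: "0 < A" "\<And>n. 1 \<le> n \<Longrightarrow>
      \<exists>\<mu>\<in>signed_measures_mass1 (lq_ball n q). A * real n powr (p / q') \<le> energy n p (lq_ball n q) \<mu>"
    using energy_lower_bound[OF assms(1,2,5,3,4)] by blast
  obtain B where B: "0 < B" "\<And>n \<mu>. \<mu> \<in> signed_measures_mass1 (lq_ball n q) \<Longrightarrow>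
      energy n p (lq_ball n q) \<mu> \<le> B * real n powr (p / q')"
    using energy_upper_bound[OF assms(1) \<open>1 < q'\<close> assms(5,3,4)] by blast
  have "ereal (A * real n powr (p / q')) \<le> M_const n p (lq_ball n q) \<and>
      M_const n p (lq_ball n q) \<le> ereal (B * real n powr (p / q'))" for n
  proof (cases "n = 0")
    case True
    then show ?thesis
      by (simp add: M_const_zero)
  next
    case False
    then obtain \<mu> where \<mu>: "\<mu> \<in> signed_measures_mass1 (lq_ball n q)" "A * real n powr (p / q') \<le> energy n p (lq_ball n q) \<mu>"
      using A(2)[of n] by auto
    have "ereal (A * real n powr (p / q')) \<le> M_const n p (lq_ball n q)"
      unfolding M_const_def using \<mu> by (intro SUP_upper2[of \<mu>]) auto
    moreover have "M_const n p (lq_ball n q) \<le> ereal (B * real n powr (p / q'))"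
      unfolding M_const_def using B(2) by (intro SUP_least) auto
    ultimately show ?thesis ..
  qed
  then show ?thesis
    using A(1) B(1) by blast
qed

end
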